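(* Let $c>0$, let $\nu,\tilde\nu$ be probability measures on $\mathbb R_+$ different from $\boldsymbol d_0$, and let $m,\mu$ be as below. For $x\neq 0$ let $f(x)=\pi^{-1}\Im m(x)$, where $m(x)=\lim_{z\in\mathbb C_+\to x}m(z)$ (this limit exists and $f$ is the density of $\mu$ on $\mathbb R\setminus\{0\}$). Then $f$ is real analytic in a neighborhood of every $x\neq 0$ for which $f(x)>0$.
   Context: $\mathbb C_+=\{z:\Im z>0\}$, $\boldsymbol d_0$ is the Dirac mass at $0$. For $z\in\mathbb C_+$, $(\delta(z),\tilde\delta(z))$ is the unique solution in $\mathbb C_+^2$ of $\delta = c\int \frac{t}{-z(1+\tilde\delta t)}\nu(dt)$, $\tilde\delta=\int\frac{t}{-z(1+\delta t)}\tilde\nu(dt)$; $m(z)=\int\frac{1}{-z(1+\tilde\delta(z)t)}\nu(dt)$ is the Stieltjes transform $\int\frac{\mu(dt)}{t-z}$ of a probability measure $\mu$ on $\mathbb R_+$. *)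

theory Defs
  imports "HOL-Probability.Probability"
begin

definition upper_half :: "complex set" where
  "upper_half = {z. 0 < Im z}"

definition delta_pair :: "real \<Rightarrow> real measure \<Rightarrow> real measure \<Rightarrow> complex \<Rightarrow> complex \<times> complex" where
  "delta_pair c \<nu> \<nu>' z = (THE p. fst p \<in> upper_half \<and> snd p \<in> upper_half \<and>
      fst p = complex_of_real c *
        (\<integral>t. complex_of_real t / (- z * (1 + snd p * complex_of_real t)) \<partial>\<nu>) \<and>
      snd p = (\<integral>t. complex_of_real t / (- z * (1 + fst p * complex_of_real t)) \<partial>\<nu>'))"

definition m_fun :: "real \<Rightarrow> real measure \<Rightarrow> real measure \<Rightarrow> complex \<Rightarrow> complex" where
  "m_fun c \<nu> \<nu>' z =
     (\<integral>t. 1 / (- z * (1 + snd (delta_pair c \<nu> \<nu>' z) * complex_of_real t)) \<partial>\<nu>)"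

definition dens_f :: "real \<Rightarrow> real measure \<Rightarrow> real measure \<Rightarrow> real \<Rightarrow> real" where
  "dens_f c \<nu> \<nu>' x =
     Im (Lim (at (complex_of_real x) within upper_half) (m_fun c \<nu> \<nu>')) / pi"

definition real_analytic_on :: "(real \<Rightarrow> real) \<Rightarrow> real set \<Rightarrow> bool" where
  "real_analytic_on g U \<longleftrightarrow> (\<forall>y\<in>U. \<exists>r>0. \<exists>a::nat \<Rightarrow> real.
      \<forall>x. \<bar>x - y\<bar> < r \<longrightarrow> (\<lambda>n. a n * (x - y) ^ n) sums g x)"

end

theory Submission
  imports Defs "HOL-Complex_Analysis.Complex_Analysis"
begin

text \<open>Taking imaginary parts in the system gives \<open>c \<gamma> \<gamma>' < \<bar>z\<bar>\<^sup>2\<close> for the second moments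
  \<open>\<gamma> = \<integral> t\<^sup>2 / \<bar>1 + \<delta>' t\<bar>\<^sup>2 d\<nu>\<close> and \<open>\<gamma>' = \<integral> t\<^sup>2 / \<bar>1 + \<delta> t\<bar>\<^sup>2 d\<nu>'\<close>.
  Together with the Cauchy--Schwarz inequality this yields uniqueness and keeps solutions bounded as
  \<open>z \<rightarrow> x \<noteq> 0\<close>; existence follows from Brouwer's theorem for truncated measures and a limit.
  Two distinct boundary limits at \<open>x\<close> would force equality in Cauchy--Schwarz, hence both measures would
  live on \<open>{0, t\<^sub>0}\<close>; there the limits are roots of one quadratic polynomial and connectedness of the
  cluster set excludes two of them. Finally \<open>m = - 1 / z - \<delta> \<delta>' / c\<close>, so \<open>f(x) > 0\<close> puts the limits of
  \<open>\<delta>\<close> and \<open>\<delta>'\<close> in the open upper half plane, where the derivative of the system does not vanish, and the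
  implicit function theorem continues \<open>m\<close> holomorphically across \<open>x\<close>.\<close>

section \<open>Nonnegative random variables and their kernels\<close>

text \<open>No moments of the measures are assumed, so every estimate has to come from the system
  itself. Inside the half plane the kernels are bounded by \<open>1 / Im w\<close>; near the real
  axis this is lost, and what survives is the bound \<open>|u|^2 gam u <= a / b\<close>, which does
  not depend on \<open>z\<close>. One object, \<open>cov\<close>, carries the argument: it is the
  exact difference quotient of the transform, so \<open>z^2 - a b cov cov\<close> is the factor that
  decides uniqueness, its limit compares two boundary limits, and on the diagonal it is the
  derivative needed for the implicit function theorem. Cauchy--Schwarz bounds \<open>cov\<close> by
  \<open>gam\<close>, with strict inequality against \<open>z^2\<close> inside the half plane and
  only a weak one in the limit. If each variable takes a single nonzero value, equality in
  Cauchy--Schwarz is automatic and says nothing; this is why that case needs algebra and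
  connectedness. Truncation enters existence because the bound that makes the Brouwer domain compact
  requires bounded variables.\<close>

lemma Cauchy_Schwarz_integral_mult:
  fixes f g :: "'a \<Rightarrow> complex"
  assumes [measurable]: "f \<in> borel_measurable M" "g \<in> borel_measurable M"
    and f: "integrable M (\<lambda>t. (cmod (f t))\<^sup>2)" and g: "integrable M (\<lambda>t. (cmod (g t))\<^sup>2)"
  shows "(cmod (\<integral>t. f t * g t \<partial>M))\<^sup>2 \<le> (\<integral>t. (cmod (f t))\<^sup>2 \<partial>M) * (\<integral>t. (cmod (g t))\<^sup>2 \<partial>M)"
proof -
  define A where "A = (\<integral>t. (cmod (f t))\<^sup>2 \<partial>M)"
  define B where "B = (\<integral>t. cmod (f t) * cmod (g t) \<partial>M)"
  define C where "C = (\<integral>t. (cmod (g t))\<^sup>2 \<partial>M)"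
  have fg: "integrable M (\<lambda>t. cmod (f t) * cmod (g t))"
  proof (rule Bochner_Integration.integrable_bound[OF Bochner_Integration.integrable_add[OF f g]])
    show "AE t in M. norm (cmod (f t) * cmod (g t)) \<le> norm ((cmod (f t))\<^sup>2 + (cmod (g t))\<^sup>2)"
    proof (rule AE_I2)
      fix t
      have "2 * (cmod (f t) * cmod (g t)) \<le> (cmod (f t))\<^sup>2 + (cmod (g t))\<^sup>2"
        using sum_squares_bound[of "cmod (f t)" "cmod (g t)"] by simp
      moreover have "0 \<le> cmod (f t) * cmod (g t)"
        by simp
      ultimately show "norm (cmod (f t) * cmod (g t)) \<le> norm ((cmod (f t))\<^sup>2 + (cmod (g t))\<^sup>2)"
        unfolding real_norm_def by linarith
    qed
  qed simp
  have quad: "0 \<le> s\<^sup>2 * A - 2 * s * r * B + r\<^sup>2 * C" for s r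
  proof -
    have "0 \<le> (\<integral>t. (s * cmod (f t) - r * cmod (g t))\<^sup>2 \<partial>M)"
      by simp
    also have "\<dots> = (\<integral>t. s\<^sup>2 * (cmod (f t))\<^sup>2 - 2 * s * r * (cmod (f t) * cmod (g t)) + r\<^sup>2 * (cmod (g t))\<^sup>2 \<partial>M)"
      by (intro Bochner_Integration.integral_cong) (auto simp: power2_eq_square algebra_simps)
    also have "\<dots> = s\<^sup>2 * A - 2 * s * r * B + r\<^sup>2 * C"
      unfolding A_def B_def C_def using f g fg by simp
    finally show ?thesis .
  qed
  have AC: "0 \<le> A" "0 \<le> C"
    unfolding A_def C_def by simp_all
  have "B\<^sup>2 \<le> A * C"
  proof (cases "C = 0")
    case True
    \<comment> \<open>For \<open>C = 0\<close> the form at \<open>s = B\<close> is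
      \<open>B^2 (A - 2 r)\<close>; the choice \<open>r = A + 1\<close> makes it negative unless
      \<open>B = 0\<close>.\<close>
    have "0 \<le> B\<^sup>2 * A - 2 * B * (A + 1) * B"
      using quad[of B "A + 1"] True by simp
    also have "\<dots> = - (B\<^sup>2 * (A + 2))"
      by (simp add: power2_eq_square algebra_simps)
    finally have "B\<^sup>2 * (A + 2) \<le> 0" by simp
    then have "B = 0" using AC by (simp add: mult_le_0_iff)
    then show ?thesis using AC by simp
  next
    case False
    have "0 \<le> C\<^sup>2 * A - 2 * C * B * B + B\<^sup>2 * C"
      using quad[of C B] by simp
    also have "\<dots> = C * (A * C - B\<^sup>2)"
      by (simp add: power2_eq_square algebra_simps)
    finally show ?thesis using AC False by (simp add: zero_le_mult_iff)
  qed
  moreover have "cmod (\<integral>t. f t * g t \<partial>M) \<le> B"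
    unfolding B_def using integral_norm_bound[of M "\<lambda>t. f t * g t"] by (simp add: norm_mult)
  then have "(cmod (\<integral>t. f t * g t \<partial>M))\<^sup>2 \<le> B\<^sup>2"
    by (intro power_mono) auto
  ultimately show ?thesis
    unfolding A_def C_def by linarith
qed

section \<open>Pointwise estimates for the kernel\<close>

definition kern :: "complex \<Rightarrow> real \<Rightarrow> complex" where
  "kern w x = of_real x / (1 + w * of_real x)"

lemma kern_denom_nonzero: "0 < Im w \<Longrightarrow> 1 + w * of_real x \<noteq> 0"
  by (auto simp: complex_eq_iff)

lemma kern_0 [simp]: "kern w 0 = 0"
  by (simp add: kern_def)

text \<open>From \<open>|1 + w x| >= x Im w\<close>. The bound is uniform in \<open>x\<close>, which
  gives integrability without any moment assumption.\<close>

lemma norm_kern_le: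
  assumes "0 < Im w" "0 \<le> x"
  shows "cmod (kern w x) \<le> 1 / Im w"
proof -
  have "x * Im w \<le> cmod (1 + w * of_real x)"
    using abs_Im_le_cmod[of "1 + w * of_real x"] assms by (simp add: mult.commute)
  then show ?thesis
    using assms kern_denom_nonzero[of w x] by (simp add: kern_def norm_divide divide_simps mult.commute)
qed

text \<open>Expand by the conjugate denominator. Both real coefficients are nonnegative, so
  imaginary parts of the transform have a known sign.\<close>

lemma kern_decomp:
  assumes "0 < Im w"
  shows "kern w x = of_real (x / (cmod (1 + w * of_real x))\<^sup>2) + cnj w * of_real ((cmod (kern w x))\<^sup>2)"
proof -
  let ?d = "1 + w * of_real x"
  have d: "?d \<noteq> 0" using assms by (rule kern_denom_nonzero)
  have "kern w x = of_real x * cnj ?d / of_real ((cmod ?d)\<^sup>2)"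
    unfolding kern_def complex_norm_square using d
    by (metis complex_cnj_zero_iff mult.commute mult_divide_mult_cancel_left)
  also have "\<dots> = of_real x / of_real ((cmod ?d)\<^sup>2) + cnj w * (of_real (x\<^sup>2) / of_real ((cmod ?d)\<^sup>2))"
    by (simp add: algebra_simps add_divide_distrib power2_eq_square)
  also have "of_real (x\<^sup>2) / of_real ((cmod ?d)\<^sup>2) = (of_real ((cmod (kern w x))\<^sup>2) :: complex)"
    by (simp add: kern_def norm_divide power_divide)
  finally show ?thesis by simp
qed

text \<open>The resolvent identity; integrated, it turns \<open>cov\<close> into an exact difference
  quotient.\<close>

lemma kern_diff:
  assumes "0 < Im w" "0 < Im w'"
  shows "kern w x - kern w' x = (w' - w) * (kern w x * kern w' x)"
  using kern_denom_nonzero[of w x] kern_denom_nonzero[of w' x] assms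
  unfolding kern_def by (simp add: field_simps)

text \<open>Rewrites the integrand of \<open>m\<close> through that of \<open>stj\<close>, and shows
  that \<open>w * kern w x\<close> tends to 1 when \<open>w x\<close> tends to infinity.\<close>

lemma one_plus_mult_kern:
  assumes "0 < Im w"
  shows "1 / (1 + w * of_real x) = 1 - w * kern w x"
  using kern_denom_nonzero[of w x] assms unfolding kern_def by (simp add: field_simps)

lemma norm_denom_le:
  assumes "cmod w \<le> R" "0 \<le> x"
  shows "cmod (1 + w * of_real x) \<le> 1 + R * x"
proof -
  have "cmod (1 + w * of_real x) \<le> 1 + cmod w * x"
    using norm_triangle_ineq[of 1 "w * of_real x"] assms by (simp add: norm_mult)
  then show ?thesis using mult_right_mono[OF assms] by linarith
qed

lemma norm_kern_ge:
  assumes "0 < Im w" "cmod w \<le> R" "0 \<le> x"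
  shows "x / (1 + R * x) \<le> cmod (kern w x)"
proof -
  have "0 < cmod (1 + w * of_real x)"
    using kern_denom_nonzero[of w x] assms by simp
  then show ?thesis
    unfolding kern_def norm_divide using norm_denom_le[of w R x] assms
    by (simp add: frac_le)
qed

lemma kern_minorant_sq_le: 
  fixes R x :: real
  assumes "0 < R" "0 \<le> x" shows "(x / (1 + R * x))\<^sup>2 \<le> (1/R)\<^sup>2"
proof -
  have "0 < 1 + R * x" using assms by (intro add_pos_nonneg) auto
  then have "x / (1 + R * x) \<le> 1 / R" using assms by (simp add: field_simps)
  moreover have "0 \<le> x / (1 + R * x)" using assms by simp
  ultimately show ?thesis by (rule power_mono)
qed

lemma alp_minorant_le:
  fixes R x :: real
  assumes "0 < R" "0 \<le> x" shows "x / (1 + R * x)\<^sup>2 \<le> 1/R"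
proof -
  have "0 < 1 + R * x" using assms by (intro add_pos_nonneg) auto
  moreover have "R * x \<le> (1 + R * x)\<^sup>2" using assms by (simp add: power2_eq_square algebra_simps)
  ultimately show ?thesis using assms by (simp add: field_simps)
qed

lemma tendsto_kern:
  assumes "(\<lambda>n. w n) \<longlonglongrightarrow> w'" "(\<lambda>n. x n) \<longlonglongrightarrow> x'" "0 < Im w'"
  shows "(\<lambda>n. kern (w n) (x n)) \<longlonglongrightarrow> kern w' x'"
  unfolding kern_def using assms kern_denom_nonzero[of w' x']
  by (intro tendsto_intros) auto

lemma kern_measurable [measurable]: "kern w \<in> borel_measurable borel"
  unfolding kern_def by measurable

lemma min_truncate_tendsto:
  fixes x :: real
  shows "(\<lambda>n. min x (real (Suc n))) \<longlonglongrightarrow> x"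
proof (rule tendsto_eventually)
  show "\<forall>\<^sub>F n in sequentially. min x (real (Suc n)) = x"
    using eventually_ge_at_top[of "nat \<lceil>x\<rceil>"] by eventually_elim (auto simp: min_def nat_le_iff ceiling_le_iff)
qed

text \<open>A random variable instead of its law: truncation then changes \<open>X\<close> on a
  fixed space and pointwise convergence theorems apply. Nonnegativity is demanded everywhere; a
  measure enters through \<open>max t 0\<close>.\<close>

locale pos_rv = prob_space M for M :: "'a measure" +
  fixes X :: "'a \<Rightarrow> real"
  assumes X_meas [measurable]: "X \<in> borel_measurable M" and X_nonneg: "0 \<le> X t"
    and X_nonzero: "\<not> (AE t in M. X t = 0)"
begin

text \<open>The factor \<open>- 1 / z\<close> of the defining integrals is split off, so that \<open>stj\<close> is
  \<open>\<integral> t / (1 + w t)\<close>. It decomposes as \<open>alp w + cnj w * gam w\<close>, and \<open>- cov\<close> is its difference quotient.\<close>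

definition "stj w = (\<integral>t. kern w (X t) \<partial>M)"
definition "gam w = (\<integral>t. (cmod (kern w (X t)))\<^sup>2 \<partial>M)"
definition "alp w = (\<integral>t. X t / (cmod (1 + w * of_real (X t)))\<^sup>2 \<partial>M)"
definition "cov w w' = (\<integral>t. kern w (X t) * kern w' (X t) \<partial>M)"

lemma integrable_kern: "0 < Im w \<Longrightarrow> integrable M (\<lambda>t. kern w (X t))"
  by (rule integrable_const_bound[of _ "1 / Im w"]) (auto intro!: norm_kern_le simp: X_nonneg)

lemma integrable_kern_sq:
  assumes "0 < Im w" shows "integrable M (\<lambda>t. (cmod (kern w (X t)))\<^sup>2)"
proof (rule integrable_const_bound[of _ "(1 / Im w)\<^sup>2"])
  show "AE t in M. norm ((cmod (kern w (X t)))\<^sup>2) \<le> (1 / Im w)\<^sup>2"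
  proof (rule AE_I2)
    fix t
    have "(cmod (kern w (X t)))\<^sup>2 \<le> (1 / Im w)\<^sup>2"
      using norm_kern_le[OF assms X_nonneg] by (intro power_mono) auto
    then show "norm ((cmod (kern w (X t)))\<^sup>2) \<le> (1 / Im w)\<^sup>2" by simp
  qed
qed simp

lemma integrable_kern_mult:
  assumes "0 < Im w" "0 < Im w'" shows "integrable M (\<lambda>t. kern w (X t) * kern w' (X t))"
proof (rule integrable_const_bound[of _ "(1 / Im w) * (1 / Im w')"])
  show "AE t in M. norm (kern w (X t) * kern w' (X t)) \<le> (1 / Im w) * (1 / Im w')"
    unfolding norm_mult
    using norm_kern_le[OF assms(1) X_nonneg] norm_kern_le[OF assms(2) X_nonneg] assms
    by (intro AE_I2 mult_mono) auto
qed simp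

lemma integrable_alp:
  assumes "0 < Im w" shows "integrable M (\<lambda>t. X t / (cmod (1 + w * of_real (X t)))\<^sup>2)"
proof -
  have eq: "X t / (cmod (1 + w * of_real (X t)))\<^sup>2 =
      Re (kern w (X t)) - Re w * (cmod (kern w (X t)))\<^sup>2" for t
    using arg_cong[OF kern_decomp[OF assms, of "X t"], of Re] by simp
  show ?thesis
    unfolding eq using integrable_kern[OF assms] integrable_kern_sq[OF assms] by auto
qed

lemma stj_decomp:
  assumes "0 < Im w"
  shows "stj w = of_real (alp w) + cnj w * of_real (gam w)"
proof -
  have "stj w = (\<integral>t. of_real (X t / (cmod (1 + w * of_real (X t)))\<^sup>2)
      + cnj w * of_real ((cmod (kern w (X t)))\<^sup>2) \<partial>M)"
    unfolding stj_def by (intro Bochner_Integration.integral_cong refl kern_decomp assms)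
  also have "\<dots> = of_real (alp w) + cnj w * of_real (gam w)"
    unfolding alp_def gam_def using integrable_alp[OF assms] integrable_kern_sq[OF assms]
    by (subst Bochner_Integration.integral_add) (auto simp del: of_real_power of_real_divide)
  finally show ?thesis .
qed

lemma Im_stj: "0 < Im w \<Longrightarrow> Im (stj w) = - (Im w * gam w)"
  by (simp add: stj_decomp)

lemma gam_nonneg: "0 \<le> gam w"
  unfolding gam_def by simp

lemma stj_diff:
  assumes "0 < Im w" "0 < Im w'"
  shows "stj w - stj w' = (w' - w) * cov w w'"
  unfolding stj_def cov_def using assms
  by (simp add: integrable_kern flip: Bochner_Integration.integral_diff integral_mult_right_zero)
     (simp add: kern_diff)

lemma norm_cov_sq_le:
  assumes "0 < Im w" "0 < Im w'"
  shows "(cmod (cov w w'))\<^sup>2 \<le> gam w * gam w'"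
  unfolding cov_def gam_def
  using integrable_kern_sq[OF assms(1)] integrable_kern_sq[OF assms(2)]
  by (intro Cauchy_Schwarz_integral_mult) auto

text \<open>Cauchy--Schwarz against the constant 1, whose integral is 1.\<close>

lemma norm_stj_sq_le:
  assumes "0 < Im w"
  shows "(cmod (stj w))\<^sup>2 \<le> gam w"
proof -
  have "(cmod (\<integral>t. kern w (X t) * 1 \<partial>M))\<^sup>2 \<le> gam w * (\<integral>t. (cmod 1)\<^sup>2 \<partial>M)"
    unfolding gam_def using integrable_kern_sq[OF assms]
    by (intro Cauchy_Schwarz_integral_mult) auto
  then show ?thesis unfolding stj_def by (simp add: prob_space)
qed

text \<open>A vanishing integral would give \<open>g (X t) = 0\<close> and hence
  \<open>X t = 0\<close> almost everywhere. All strict positivity that comes from excluding the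
  Dirac mass passes through here.\<close>

lemma integral_pos_function:
  fixes g :: "real \<Rightarrow> real"
  assumes [measurable]: "g \<in> borel_measurable borel"
    and pos: "\<And>x. 0 < x \<Longrightarrow> 0 < g x" and "g 0 = 0" and bd: "\<And>x. 0 \<le> x \<Longrightarrow> g x \<le> C"
  shows "0 < (\<integral>t. g (X t) \<partial>M)"
proof -
  have nn: "0 \<le> g (X t)" for t
    using X_nonneg[of t] pos[of "X t"] \<open>g 0 = 0\<close> by (cases "X t = 0") auto
  have int: "integrable M (\<lambda>t. g (X t))"
    using nn bd X_nonneg by (intro integrable_const_bound[of _ C]) auto
  have "(\<integral>t. g (X t) \<partial>M) \<noteq> 0"
  proof
    assume "(\<integral>t. g (X t) \<partial>M) = 0"
    then have "AE t in M. g (X t) = 0"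
      using integral_nonneg_eq_0_iff_AE[OF int] nn by auto
    then have "AE t in M. X t = 0"
    proof eventually_elim
      case (elim t)
      then show ?case using X_nonneg[of t] pos[of "X t"] by (cases "X t = 0") auto
    qed
    with X_nonzero show False ..
  qed
  moreover have "0 \<le> (\<integral>t. g (X t) \<partial>M)" using nn by simp
  ultimately show ?thesis by linarith
qed

text \<open>The minorant depends on \<open>w\<close> only through a bound on its modulus, so it
  persists when \<open>Im w\<close> tends to 0.\<close>

lemma gam_ge:
  assumes "0 < Im w" "cmod w \<le> R"
  shows "(\<integral>t. (X t / (1 + R * X t))\<^sup>2 \<partial>M) \<le> gam w"
  unfolding gam_def
proof (rule integral_mono)
  have R: "0 < R" using assms abs_Im_le_cmod[of w] by linarith
  show "integrable M (\<lambda>t. (X t / (1 + R * X t))\<^sup>2)"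
    using kern_minorant_sq_le[OF R X_nonneg]
    by (intro integrable_const_bound[of _ "(1/R)\<^sup>2"]) auto
  show "(X t / (1 + R * X t))\<^sup>2 \<le> (cmod (kern w (X t)))\<^sup>2" for t
    using norm_kern_ge[OF assms X_nonneg] R X_nonneg[of t] by (intro power_mono) auto
qed (rule integrable_kern_sq[OF assms(1)])

lemma alp_ge:
  assumes "0 < Im w" "cmod w \<le> R"
  shows "(\<integral>t. X t / (1 + R * X t)\<^sup>2 \<partial>M) \<le> alp w"
  unfolding alp_def
proof (rule integral_mono)
  have R: "0 < R" using assms abs_Im_le_cmod[of w] by linarith
  show "integrable M (\<lambda>t. X t / (1 + R * X t)\<^sup>2)"
    using alp_minorant_le[OF R X_nonneg] X_nonneg
    by (intro integrable_const_bound[of _ "1/R"]) auto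
  show "X t / (1 + R * X t)\<^sup>2 \<le> X t / (cmod (1 + w * of_real (X t)))\<^sup>2" for t
  proof (rule divide_left_mono)
    have "0 < cmod (1 + w * of_real (X t))" "0 < 1 + R * X t"
      using kern_denom_nonzero[OF assms(1)] R X_nonneg[of t] by (auto simp: add_pos_nonneg)
    then show "0 < (1 + R * X t)\<^sup>2 * (cmod (1 + w * of_real (X t)))\<^sup>2" by simp
    show "(cmod (1 + w * of_real (X t)))\<^sup>2 \<le> (1 + R * X t)\<^sup>2"
      using norm_denom_le[OF assms(2) X_nonneg] by (intro power_mono) auto
  qed (rule X_nonneg)
qed (rule integrable_alp[OF assms(1)])

lemma gam_pos:
  assumes "0 < Im w"
  shows "0 < gam w"
proof -
  have R: "0 < cmod w" using assms by auto
  have "0 < (\<integral>t. (X t / (1 + cmod w * X t))\<^sup>2 \<partial>M)"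
  proof (rule integral_pos_function[where g="\<lambda>x. (x / (1 + cmod w * x))\<^sup>2"])
    show "0 < (x / (1 + cmod w * x))\<^sup>2" if "0 < x" for x
      using that add_pos_nonneg[of 1 "cmod w * x"] by (simp add: zero_less_power2)
    show "(x / (1 + cmod w * x))\<^sup>2 \<le> (1 / cmod w)\<^sup>2" if "0 \<le> x" for x
      using kern_minorant_sq_le[OF R that] .
  qed (use assms in auto)
  also have "\<dots> \<le> gam w" using assms by (intro gam_ge) auto
  finally show ?thesis .
qed

lemma alp_pos:
  assumes "0 < Im w"
  shows "0 < alp w"
proof -
  have R: "0 < cmod w" using assms by auto
  have "0 < (\<integral>t. X t / (1 + cmod w * X t)\<^sup>2 \<partial>M)"
  proof (rule integral_pos_function[where g="\<lambda>x. x / (1 + cmod w * x)\<^sup>2"])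
    show "0 < x / (1 + cmod w * x)\<^sup>2" if "0 < x" for x
      using that add_pos_nonneg[of 1 "cmod w * x"] by simp
    show "x / (1 + cmod w * x)\<^sup>2 \<le> 1 / cmod w" if "0 \<le> x" for x
      using alp_minorant_le[OF R that] .
  qed (use assms in auto)
  also have "\<dots> \<le> alp w" using assms by (intro alp_ge) auto
  finally show ?thesis .
qed

lemma tendsto_cov:
  assumes "(\<lambda>n. w n) \<longlonglongrightarrow> w0" "(\<lambda>n. w' n) \<longlonglongrightarrow> w0'"
    and im: "\<And>n. 0 < Im (w n)" "\<And>n. 0 < Im (w' n)" "0 < Im w0" "0 < Im w0'"
  shows "(\<lambda>n. cov (w n) (w' n)) \<longlonglongrightarrow> cov w0 w0'"
proof -
  have "\<forall>\<^sub>F n in sequentially. Im w0 / 2 < Im (w n)" "\<forall>\<^sub>F n in sequentially. Im w0' / 2 < Im (w' n)"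
    using order_tendstoD(1)[OF tendsto_Im[OF assms(1)], of "Im w0 / 2"]
      order_tendstoD(1)[OF tendsto_Im[OF assms(2)], of "Im w0' / 2"] im by auto
  then have "\<forall>\<^sub>F n in sequentially. Im w0 / 2 < Im (w n) \<and> Im w0' / 2 < Im (w' n)"
    by (rule eventually_conj)
  then obtain N where N: "\<And>n. n \<ge> N \<Longrightarrow> Im w0 / 2 < Im (w n) \<and> Im w0' / 2 < Im (w' n)"
    unfolding eventually_sequentially by blast
  \<comment> \<open>Dropping the first \<open>N\<close> terms makes the constant majorant valid for
    every index.\<close>
  have "(\<lambda>n. cov (w (n + N)) (w' (n + N))) \<longlonglongrightarrow> cov w0 w0'"
    unfolding cov_def
  proof (rule integral_dominated_convergence[where w="\<lambda>_. 2 / Im w0 * (2 / Im w0')"])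
    show "AE t in M. (\<lambda>n. kern (w (n + N)) (X t) * kern (w' (n + N)) (X t)) \<longlonglongrightarrow> kern w0 (X t) * kern w0' (X t)"
      using LIMSEQ_ignore_initial_segment[OF assms(1), of N] LIMSEQ_ignore_initial_segment[OF assms(2), of N] im
      by (intro AE_I2 tendsto_mult tendsto_kern tendsto_const)
    show "AE t in M. norm (kern (w (n + N)) (X t) * kern (w' (n + N)) (X t)) \<le> 2 / Im w0 * (2 / Im w0')" for n
    proof (rule AE_I2)
      fix t
      have "cmod (kern (w (n + N)) (X t)) \<le> 1 / Im (w (n + N))" "cmod (kern (w' (n + N)) (X t)) \<le> 1 / Im (w' (n + N))"
        using norm_kern_le[OF im(1) X_nonneg] norm_kern_le[OF im(2) X_nonneg] by auto
      moreover have "1 / Im (w (n + N)) \<le> 1 / (Im w0 / 2)" "1 / Im (w' (n + N)) \<le> 1 / (Im w0' / 2)"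
        using N[of "n + N"] im(1,2)[of "n + N"] im(3,4) by (simp_all add: field_simps)
      ultimately show "norm (kern (w (n + N)) (X t) * kern (w' (n + N)) (X t)) \<le> 2 / Im w0 * (2 / Im w0')"
        unfolding norm_mult using im by (intro mult_mono) auto
    qed
  qed auto
  then show ?thesis by (rule LIMSEQ_offset)
qed

lemma continuous_on_cov: "continuous_on ({w. 0 < Im w} \<times> {w. 0 < Im w}) (\<lambda>(w, w'). cov w w')"
  unfolding continuous_on_sequentially
proof (intro allI ballI impI)
  fix x a assume a: "a \<in> {w. 0 < Im w} \<times> {w. 0 < Im w}"
    and x: "(\<forall>n. x n \<in> {w. 0 < Im w} \<times> {w. 0 < Im w}) \<and> x \<longlonglongrightarrow> a"
  have "(\<lambda>n. cov (fst (x n)) (snd (x n))) \<longlonglongrightarrow> cov (fst a) (snd a)"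
    using x a by (intro tendsto_cov tendsto_fst tendsto_snd) (auto simp: mem_Times_iff)
  then show "((\<lambda>(w, w'). cov w w') \<circ> x) \<longlonglongrightarrow> (case a of (w, w') \<Rightarrow> cov w w')"
    by (simp add: o_def case_prod_beta)
qed

text \<open>The difference quotient equals \<open>- cov y w\<close> exactly, so continuity of
  \<open>cov\<close> suffices and nothing is differentiated under the integral.\<close>

lemma stj_has_field_derivative:
  assumes "0 < Im w"
  shows "(stj has_field_derivative - cov w w) (at w)"
proof -
  have open_H: "open {w. 0 < Im w}" by (rule open_halfspace_Im_gt)
  have "continuous_on {w. 0 < Im w} (\<lambda>y. (\<lambda>(w, w'). cov w w') (y, w))"
    using assms by (intro continuous_on_compose2[OF continuous_on_cov] continuous_intros) auto
  then have "isCont (\<lambda>y. cov y w) w"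
    using continuous_on_eq_continuous_at[OF open_H] assms by auto
  then have "((\<lambda>y. - cov y w) \<longlongrightarrow> - cov w w) (at w)"
    by (intro tendsto_minus) (simp add: isCont_def)
  moreover have "\<forall>\<^sub>F y in at w. - cov y w = (stj y - stj w) / (y - w)"
  proof -
    have "\<forall>\<^sub>F y in at w. y \<in> {w. 0 < Im w}"
      using open_H assms by (intro eventually_at_in_open') auto
    then show ?thesis
      using eventually_neq_at_within[of w]
    proof eventually_elim
      case (elim y)
      then show ?case using stj_diff[of y w] assms by (simp add: field_simps)
    qed
  qed
  ultimately show ?thesis
    unfolding has_field_derivative_iff by (rule Lim_transform_eventually)
qed

lemma stj_holomorphic_on: "stj holomorphic_on {w. 0 < Im w}"
  unfolding holomorphic_on_def field_differentiable_def
  by (auto intro!: has_field_derivative_at_within stj_has_field_derivative)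

end

text \<open>A Vitali argument: bounded second moments give uniform integrability. It replaces
  dominated convergence where \<open>Im w\<close> may tend to 0 and no majorant is at hand.\<close>

lemma (in prob_space) tendsto_integral_L2_bounded:
  fixes f :: "nat \<Rightarrow> 'a \<Rightarrow> complex"
  assumes [measurable]: "\<And>n. f n \<in> borel_measurable M" "g \<in> borel_measurable M"
    and int: "\<And>n. integrable M (\<lambda>t. (cmod (f n t))\<^sup>2)"
    and C: "\<And>n. (\<integral>t. (cmod (f n t))\<^sup>2 \<partial>M) \<le> C"
    and g: "\<And>t. cmod (g t) \<le> 1"
    and lim: "\<And>t. (\<lambda>n. f n t) \<longlonglongrightarrow> g t"
  shows "(\<lambda>n. \<integral>t. f n t \<partial>M) \<longlonglongrightarrow> (\<integral>t. g t \<partial>M)"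
proof -
  define h where "h n t = cmod (f n t - g t)" for n t
  have [measurable]: "h n \<in> borel_measurable M" for n
    unfolding h_def by measurable
  have "0 \<le> C"
    using C[of 0] by (rule order_trans[rotated]) simp
  \<comment> \<open>Bound for the second moments of \<open>h\<close>, from
    \<open>(y + 1)^2 <= 2 y^2 + 2\<close>.\<close>
  define D where "D = 2 * C + 2"
  have "0 < D" using \<open>0 \<le> C\<close> by (simp add: D_def)
  have h_nn: "0 \<le> h n t" for n t by (simp add: h_def)
  have h2: "(h n t)\<^sup>2 \<le> 2 * (cmod (f n t))\<^sup>2 + 2" for n t
  proof -
    have "h n t \<le> cmod (f n t) + 1"
      unfolding h_def using norm_triangle_ineq4[of "f n t" "g t"] g[of t] by linarith
    then have "(h n t)\<^sup>2 \<le> (cmod (f n t) + 1)\<^sup>2" using h_nn by (intro power_mono)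
    also have "\<dots> \<le> 2 * (cmod (f n t))\<^sup>2 + 2"
      using zero_le_power2[of "cmod (f n t) - 1"] by (simp add: power2_eq_square algebra_simps)
    finally show ?thesis .
  qed
  have int_bd: "integrable M (\<lambda>t. 2 * (cmod (f n t))\<^sup>2 + 2)" for n
    using int by auto
  have int_h2: "integrable M (\<lambda>t. (h n t)\<^sup>2)" for n
    using h2 by (intro Bochner_Integration.integrable_bound[OF int_bd[of n]]) (auto intro!: AE_I2 order_trans[OF h2])
  have Eh2: "(\<integral>t. (h n t)\<^sup>2 \<partial>M) \<le> D" for n
  proof -
    have "(\<integral>t. (h n t)\<^sup>2 \<partial>M) \<le> (\<integral>t. 2 * (cmod (f n t))\<^sup>2 + 2 \<partial>M)"
      using h2 by (intro integral_mono int_h2 int_bd)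
    also have "\<dots> = 2 * (\<integral>t. (cmod (f n t))\<^sup>2 \<partial>M) + 2"
      using int by (simp add: prob_space)
    finally show ?thesis using C[of n] by (simp add: D_def)
  qed
  have int_f: "integrable M (f n)" for n
  proof (rule Bochner_Integration.integrable_bound[OF int_bd[of n]])
    have "cmod (f n t) \<le> 2 * (cmod (f n t))\<^sup>2 + 2" for t
      using zero_le_power2[of "cmod (f n t) - 1"] zero_le_power2[of "cmod (f n t)"]
      by (simp add: power2_eq_square algebra_simps) (smt (verit) mult_nonneg_nonneg norm_ge_zero)
    then show "AE t in M. cmod (f n t) \<le> norm (2 * (cmod (f n t))\<^sup>2 + 2)"
      by (auto intro!: AE_I2 order_trans[OF _ abs_ge_self])
  qed simp
  have int_g: "integrable M g"
    using g by (intro integrable_const_bound[of _ 1]) auto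
  have int_min: "integrable M (\<lambda>t. min (h n t) K)" if "0 < K" for n K
    using h_nn that by (intro integrable_const_bound[of _ K]) auto
  have trunc: "(\<lambda>n. \<integral>t. min (h n t) K \<partial>M) \<longlonglongrightarrow> 0" if "0 < K" for K
  proof -
    have "(\<lambda>n. \<integral>t. min (h n t) K \<partial>M) \<longlonglongrightarrow> (\<integral>t. 0 \<partial>M)"
    proof (rule integral_dominated_convergence[where w="\<lambda>_. K"])
      show "AE t in M. (\<lambda>n. min (h n t) K) \<longlonglongrightarrow> 0"
      proof (rule AE_I2)
        fix t
        have "(\<lambda>n. h n t) \<longlonglongrightarrow> 0"
          unfolding h_def using lim[of t] by (simp add: LIM_zero_iff tendsto_norm_zero)
        then have "(\<lambda>n. min (h n t) K) \<longlonglongrightarrow> min 0 K" by (intro tendsto_min tendsto_const)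
        then show "(\<lambda>n. min (h n t) K) \<longlonglongrightarrow> 0" using that by simp
      qed
      show "AE t in M. norm (min (h n t) K) \<le> K" for n
        using h_nn that by (intro AE_I2) (auto simp: min_def)
    qed auto
    then show ?thesis by simp
  qed
  have "(\<lambda>n. (\<integral>t. f n t \<partial>M) - (\<integral>t. g t \<partial>M)) \<longlonglongrightarrow> 0"
  proof (rule LIMSEQ_I)
    fix e :: real assume "0 < e"
    \<comment> \<open>Splitting \<open>h <= min h K + h^2 / K\<close>; this \<open>K\<close> makes
      the second part at most \<open>D / K = e / 2\<close>.\<close>
    define K where "K = 2 * D / e"
    have "0 < K" using \<open>0 < e\<close> \<open>0 < D\<close> by (simp add: K_def)
    obtain n0 where n0: "\<And>n. n \<ge> n0 \<Longrightarrow> norm ((\<integral>t. min (h n t) K \<partial>M) - 0) < e / 2"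
      using LIMSEQ_D[OF trunc[OF \<open>0 < K\<close>], of "e/2"] \<open>0 < e\<close> by auto
    have "norm ((\<integral>t. f n t \<partial>M) - (\<integral>t. g t \<partial>M) - 0) < e" if "n \<ge> n0" for n
    proof -
      have "norm ((\<integral>t. f n t \<partial>M) - (\<integral>t. g t \<partial>M) - 0) = norm (\<integral>t. f n t - g t \<partial>M)"
        using int_f int_g by simp
      also have "\<dots> \<le> (\<integral>t. h n t \<partial>M)"
        unfolding h_def by (rule integral_norm_bound)
      also have "\<dots> \<le> (\<integral>t. min (h n t) K + (h n t)\<^sup>2 / K \<partial>M)"
      proof (rule integral_mono)
        show "integrable M (h n)"
          unfolding h_def using int_f int_g by auto
        show "integrable M (\<lambda>t. min (h n t) K + (h n t)\<^sup>2 / K)"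
          using int_h2[of n] int_min[OF \<open>0 < K\<close>, of n] by simp
        show "h n t \<le> min (h n t) K + (h n t)\<^sup>2 / K" for t
        proof (cases "h n t \<le> K")
          case True
          then show ?thesis using \<open>0 < K\<close> by (simp add: min_def)
        next
          case False
          then have "h n t * K \<le> h n t * h n t" using h_nn by (intro mult_left_mono) auto
          then have "h n t \<le> (h n t)\<^sup>2 / K" using \<open>0 < K\<close> by (simp add: field_simps power2_eq_square)
          then show ?thesis using False \<open>0 < K\<close> by (simp add: min_def)
        qed
      qed
      also have "\<dots> = (\<integral>t. min (h n t) K \<partial>M) + (\<integral>t. (h n t)\<^sup>2 \<partial>M) / K"
        using int_h2[of n] int_min[OF \<open>0 < K\<close>, of n] by simp
      also have "\<dots> < e / 2 + D / K"
        using n0[OF that] Eh2[of n] \<open>0 < K\<close> by (intro add_less_le_mono divide_right_mono) auto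
      also have "D / K = e / 2" using \<open>0 < D\<close> \<open>0 < e\<close> by (simp add: K_def)
      finally show ?thesis by simp
    qed
    then show "\<exists>n0. \<forall>n\<ge>n0. norm ((\<integral>t. f n t \<partial>M) - (\<integral>t. g t \<partial>M) - 0) < e" by blast
  qed
  then show ?thesis by (simp add: LIM_zero_iff)
qed

section \<open>The coupled system\<close>

locale rv_pair = A: pos_rv M X + B: pos_rv N Y
  for M :: "'a measure" and X and N :: "'b measure" and Y +
  fixes a b :: real
  assumes a_pos: "0 < a" and b_pos: "0 < b"
begin

text \<open>With \<open>a = c\<close> and \<open>b = 1\<close> the pair \<open>(u, v)\<close> is the pair \<open>(\<delta>, \<delta>')\<close> of the paper;
  two constants make the system symmetric under exchanging the two measures.\<close>

definition sol :: "complex \<Rightarrow> complex \<Rightarrow> complex \<Rightarrow> bool" where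
  "sol z u v \<longleftrightarrow> 0 < Im z \<and> 0 < Im u \<and> 0 < Im v \<and>
     - (z * u) = of_real a * A.stj v \<and> - (z * v) = of_real b * B.stj u"

lemma rv_pair_swap: "rv_pair N Y M X b a"
  by unfold_locales (auto intro: a_pos b_pos)

lemma sol_swap: "sol z u v \<longleftrightarrow> rv_pair.sol N Y M X b a z v u"
proof -
  interpret sw: rv_pair N Y M X b a by (rule rv_pair_swap)
  show ?thesis unfolding sol_def sw.sol_def by auto
qed

text \<open>Besides \<open>Im u > 0\<close> this yields a second positivity,
  \<open>Im (z * u) >= 0\<close>, on which the existence proof rests.\<close>

lemma Im_mult_fst:
  assumes "- (z * u) = of_real a * A.stj v" "0 < Im v"
  shows "Im (z * u) = a * Im v * A.gam v"
proof -
  have "Im (- (z * u)) = a * Im (A.stj v)" using assms(1) by simp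
  then show ?thesis using A.Im_stj[OF assms(2)] by simp
qed

lemma Im_mult_snd:
  assumes "- (z * v) = of_real b * B.stj u" "0 < Im u"
  shows "Im (z * v) = b * Im u * B.gam u"
proof -
  have "Im (- (z * v)) = b * Im (B.stj u)" using assms(1) by simp
  then show ?thesis using B.Im_stj[OF assms(2)] by simp
qed

text \<open>Multiply the equation by \<open>cnj z\<close> and decompose \<open>stj v\<close>: the
  products of conjugates combine to \<open>cnj (z * v)\<close>, so both terms have a sign once
  \<open>Im (z * v) >= 0\<close>. Only one equation is assumed, so that the estimate also serves a
  single iteration step.\<close>

lemma norm_sq_Im_fst:
  assumes "- (z * u) = of_real a * A.stj v" "0 < Im v"
  shows "(cmod z)\<^sup>2 * Im u = a * Im z * A.alp v + a * A.gam v * Im (z * v)"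
proof -
  have "of_real ((cmod z)\<^sup>2) * u = - cnj z * (- (z * u))"
    unfolding complex_norm_square by simp
  also have "\<dots> = of_real a * (- cnj z * of_real (A.alp v) - cnj (z * v) * of_real (A.gam v))"
    unfolding assms(1) A.stj_decomp[OF assms(2)] by (simp add: algebra_simps)
  finally have "of_real ((cmod z)\<^sup>2) * u
      = of_real a * (- cnj z * of_real (A.alp v) - cnj (z * v) * of_real (A.gam v))" .
  from arg_cong[OF this, of Im]
  have "(cmod z)\<^sup>2 * Im u = a * (Im z * A.alp v + Im (z * v) * A.gam v)"
    by (simp add: algebra_simps del: of_real_power)
  then show ?thesis by (simp only: algebra_simps)
qed

context
  fixes z u v
  assumes sol: "sol z u v"
begin

lemma sol_pos: "0 < Im z" "0 < Im u" "0 < Im v" "0 < cmod z"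
  using sol by (auto simp: sol_def)

lemma sol_eqs: "- (z * u) = of_real a * A.stj v" "- (z * v) = of_real b * B.stj u"
  using sol by (auto simp: sol_def)

text \<open>Inserting \<open>Im (z * v)\<close> from the other equation leaves multiples of
  \<open>Im u\<close> and the positive \<open>alp\<close> term. That term carries the factor
  \<open>Im z\<close>, which is why strictness is lost on the real axis.\<close>

lemma sol_norm_sq_Im: "(cmod z)\<^sup>2 * Im u = a * Im z * A.alp v + a * b * A.gam v * B.gam u * Im u"
  using norm_sq_Im_fst[OF sol_eqs(1) sol_pos(3)] Im_mult_snd[OF sol_eqs(2) sol_pos(2)]
  by (simp only: algebra_simps)

lemma sol_gam_less: "a * b * A.gam v * B.gam u < (cmod z)\<^sup>2"
proof -
  have "0 < a * Im z * A.alp v"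
    using a_pos sol_pos A.alp_pos by simp
  then have "a * b * A.gam v * B.gam u * Im u < (cmod z)\<^sup>2 * Im u"
    using sol_norm_sq_Im by linarith
  then show ?thesis using sol_pos by simp
qed

lemma sol_norm_fst: "(cmod z)\<^sup>2 * (cmod u)\<^sup>2 \<le> a\<^sup>2 * A.gam v"
proof -
  have "cmod z * cmod u = a * cmod (A.stj v)"
    using arg_cong[OF sol_eqs(1), of cmod] a_pos by (simp add: norm_mult)
  then have "(cmod z)\<^sup>2 * (cmod u)\<^sup>2 = a\<^sup>2 * (cmod (A.stj v))\<^sup>2"
    by (simp flip: power_mult_distrib)
  also have "\<dots> \<le> a\<^sup>2 * A.gam v"
    using A.norm_stj_sq_le[OF sol_pos(3)] by (intro mult_left_mono) auto
  finally show ?thesis .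
qed

text \<open>Cauchy--Schwarz gives \<open>|z u|^2 gam u <= a^2 gam v gam u\<close>, and the product
  of the moments is below \<open>|z|^2 / (a b)\<close>; the factor \<open>|z|^2\<close> cancels. The
  result bounds the second moment of \<open>u * kern u\<close> uniformly in
  \<open>z\<close>.\<close>

lemma sol_norm_gam: "(cmod u)\<^sup>2 * B.gam u \<le> a / b"
proof -
  have "(cmod z)\<^sup>2 * ((cmod u)\<^sup>2 * B.gam u) \<le> a\<^sup>2 * A.gam v * B.gam u"
    using mult_right_mono[OF sol_norm_fst B.gam_nonneg[of u]] by (simp add: mult.assoc)
  also have "\<dots> = (a / b) * (a * b * A.gam v * B.gam u)"
    using b_pos by (simp add: power2_eq_square)
  also have "\<dots> \<le> (a / b) * (cmod z)\<^sup>2"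
    using sol_gam_less a_pos b_pos by (intro mult_left_mono) auto
  finally have "(cmod z)\<^sup>2 * ((cmod u)\<^sup>2 * B.gam u) \<le> (cmod z)\<^sup>2 * (a / b)"
    by (simp only: mult.commute)
  then show ?thesis using sol_pos(4) by (simp only: mult_le_cancel_left_pos zero_less_power)
qed

text \<open>Each equation times the other unknown has the left-hand side
  \<open>- (z * u * v)\<close>. The factor \<open>u\<close> stays under the integral because
  \<open>u * kern u\<close> is what has bounded second moment.\<close>

lemma sol_prod: "- (z * u * v) = of_real b * (\<integral>t. u * kern u (Y t) \<partial>N)"
proof -
  have "- (z * u * v) = u * (of_real b * B.stj u)"
    unfolding sol_eqs(2)[symmetric] by simp
  then show ?thesis unfolding B.stj_def by simp
qed

end

lemma sol_norm_gam':
  assumes "sol z u v" shows "(cmod v)\<^sup>2 * A.gam v \<le> b / a"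
  using rv_pair.sol_norm_gam[OF rv_pair_swap] assms sol_swap by blast

lemma sol_prod':
  assumes "sol z u v" shows "- (z * u * v) = of_real a * (\<integral>t. v * kern v (X t) \<partial>M)"
proof -
  have "- (z * v * u) = of_real a * (\<integral>t. v * kern v (X t) \<partial>M)"
    using rv_pair.sol_prod[OF rv_pair_swap] assms sol_swap by blast
  then show ?thesis by (simp only: mult_ac)
qed

text \<open>For \<open>z\<close> away from 0, one unknown must tend to 0 when the other blows
  up.\<close>

lemma sol_norm_prod:
  assumes "sol z u v" shows "(cmod z)\<^sup>2 * (cmod u)\<^sup>2 * (cmod v)\<^sup>2 \<le> a * b"
proof -
  have "(cmod z)\<^sup>2 * (cmod u)\<^sup>2 * (cmod v)\<^sup>2 \<le> a\<^sup>2 * A.gam v * (cmod v)\<^sup>2"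
    by (intro mult_right_mono sol_norm_fst[OF assms]) auto
  also have "\<dots> = a\<^sup>2 * ((cmod v)\<^sup>2 * A.gam v)" by simp
  also have "\<dots> \<le> a\<^sup>2 * (b / a)"
    by (intro mult_left_mono sol_norm_gam'[OF assms]) auto
  finally show ?thesis using a_pos by (simp add: power2_eq_square)
qed

text \<open>Subtracting the systems and eliminating \<open>v - v'\<close> leaves
  \<open>(u - u') * (z^2 - a b cov cov) = 0\<close>. By Cauchy--Schwarz and
  \<open>sol_gam_less\<close> for both solutions the second factor is nonzero.\<close>

lemma sol_unique:
  assumes s1: "sol z u v" and s2: "sol z u' v'"
  shows "u = u' \<and> v = v'"
proof -
  note p1 = sol_pos[OF s1] and p2 = sol_pos[OF s2]
  have "- (z * u) - (- (z * u')) = of_real a * (A.stj v - A.stj v')"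
    unfolding sol_eqs(1)[OF s1] sol_eqs(1)[OF s2] by (simp add: algebra_simps)
  then have e1: "z * (u - u') = of_real a * (v - v') * A.cov v v'"
    unfolding A.stj_diff[OF p1(3) p2(3)] by (simp add: algebra_simps)
  have "- (z * v) - (- (z * v')) = of_real b * (B.stj u - B.stj u')"
    unfolding sol_eqs(2)[OF s1] sol_eqs(2)[OF s2] by (simp add: algebra_simps)
  then have e2: "z * (v - v') = of_real b * (u - u') * B.cov u u'"
    unfolding B.stj_diff[OF p1(2) p2(2)] by (simp add: algebra_simps)
  have "z\<^sup>2 * (u - u') = z * (z * (u - u'))" by (simp add: power2_eq_square)
  also have "\<dots> = of_real a * (z * (v - v')) * A.cov v v'" unfolding e1 by simp
  finally have e3: "(u - u') * (z\<^sup>2 - of_real (a * b) * A.cov v v' * B.cov u u') = 0"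
    unfolding e2 by (simp add: algebra_simps)
  have "(a * b)\<^sup>2 * ((cmod (A.cov v v'))\<^sup>2 * (cmod (B.cov u u'))\<^sup>2)
      \<le> (a * b)\<^sup>2 * ((A.gam v * A.gam v') * (B.gam u * B.gam u'))"
    using A.norm_cov_sq_le[OF p1(3) p2(3)] B.norm_cov_sq_le[OF p1(2) p2(2)]
    by (intro mult_left_mono mult_mono) (auto intro!: mult_nonneg_nonneg A.gam_nonneg)
  also have "\<dots> = (a * b * A.gam v * B.gam u) * (a * b * A.gam v' * B.gam u')"
    by (simp add: power2_eq_square)
  also have "\<dots> < (cmod z)\<^sup>2 * (cmod z)\<^sup>2"
    using sol_gam_less[OF s1] sol_gam_less[OF s2] a_pos b_pos
    by (intro mult_strict_mono) (use p1(4) in \<open>auto intro!: mult_nonneg_nonneg A.gam_nonneg B.gam_nonneg\<close>)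
  finally have "(cmod (of_real (a * b) * A.cov v v' * B.cov u u'))\<^sup>2 < (cmod (z\<^sup>2))\<^sup>2"
    by (simp add: norm_mult norm_power power_mult_distrib power2_eq_square mult_ac)
  then have "of_real (a * b) * A.cov v v' * B.cov u u' \<noteq> z\<^sup>2" by auto
  with e3 have "u = u'" by auto
  moreover from this have "z * (v - v') = 0" using e2 by simp
  then have "v = v'" using p1 by auto
  ultimately show ?thesis by simp
qed

end

section \<open>Sequences of solutions\<close>

text \<open>One setting for two limits: truncated variables at a fixed \<open>z\<close> for
  existence, and fixed variables with \<open>z\<close> tending to a boundary point. The domination
  \<open>Ys n s \<le> Y s\<close> forces approximations to vanish where the limit does.\<close>

locale sol_seq = rv_pair M X N Y a b
  for M :: "'a measure" and X and N :: "'b measure" and Y and a b :: real +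
  fixes Xs :: "nat \<Rightarrow> 'a \<Rightarrow> real" and Ys :: "nat \<Rightarrow> 'b \<Rightarrow> real"
    and z u v :: "nat \<Rightarrow> complex" and z0 :: complex
  assumes pairs: "rv_pair M (Xs n) N (Ys n) a b"
    and Xs_le: "Xs n t \<le> X t" and Xs_lim: "(\<lambda>n. Xs n t) \<longlonglongrightarrow> X t"
    and Ys_le: "Ys n s \<le> Y s" and Ys_lim: "(\<lambda>n. Ys n s) \<longlonglongrightarrow> Y s"
    and sols: "rv_pair.sol M (Xs n) N (Ys n) a b (z n) (u n) (v n)"
    and z_lim: "z \<longlonglongrightarrow> z0" and z0_nz: "z0 \<noteq> 0"
begin

lemma sol_seq_swap: "sol_seq N Y M X b a Ys Xs z v u z0"
proof -
  show ?thesis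
  proof (rule sol_seq.intro[OF rv_pair_swap sol_seq_axioms.intro])
    fix n
    interpret p: rv_pair M "Xs n" N "Ys n" a b by (rule pairs)
    show "rv_pair N (Ys n) M (Xs n) b a" by (rule p.rv_pair_swap)
    show "rv_pair.sol N (Ys n) M (Xs n) b a (z n) (v n) (u n)"
      using sols[of n] p.sol_swap by blast
  qed (rule Xs_le Xs_lim Ys_le Ys_lim z_lim z0_nz)+
qed

lemma seq_Im_pos: "0 < Im (z n)" "0 < Im (u n)" "0 < Im (v n)"
  using rv_pair.sol_pos[OF pairs sols] by auto

text \<open>If \<open>u\<close> were unbounded, then \<open>v \<rightarrow> 0\<close>, and the two expressions for \<open>- z u v\<close> would tend to
  \<open>b P(Y > 0)\<close> and to \<open>0\<close> respectively.\<close>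

lemma fst_bounded: "\<exists>R>0. \<forall>n. cmod (u n) \<le> R"
proof (rule ccontr)
  assume unb: "\<not> (\<exists>R>0. \<forall>n. cmod (u n) \<le> R)"
  have "\<exists>k\<ge>n. real n < cmod (u k)" for n
  proof (rule ccontr)
    assume "\<not> (\<exists>k\<ge>n. real n < cmod (u k))"
    then have *: "cmod (u k) \<le> real n" if "k \<ge> n" for k using that by (auto simp: not_less)
    \<comment> \<open>A bound for the tail plus the sum of the finitely many earlier terms bounds
      the whole sequence.\<close>
    have "cmod (u k) \<le> real n + 1 + (\<Sum>i<n. cmod (u i))" for k
    proof (cases "k < n")
      case True
      then have "cmod (u k) \<le> (\<Sum>i<n. cmod (u i))" by (intro member_le_sum) auto
      then show ?thesis by linarith
    next
      case False
      moreover have "0 \<le> (\<Sum>i<n. cmod (u i))" by (intro sum_nonneg) auto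
      ultimately show ?thesis using *[of k] by simp
    qed
    moreover have "0 < (real n + 1) + (\<Sum>i<n. cmod (u i))"
      by (intro add_nonneg_pos add_pos_nonneg sum_nonneg) auto
    ultimately show False using unb by blast
  qed
  then obtain k where k: "\<And>n. k n \<ge> n" "\<And>n. real n < cmod (u (k n))" by metis
  have k_top: "filterlim k at_top sequentially"
    by (rule filterlim_at_top_mono[OF filterlim_ident]) (use k in auto)
  have nu: "filterlim (\<lambda>n. cmod (u (k n))) at_top sequentially"
    by (rule filterlim_at_top_mono[OF filterlim_real_sequentially]) (use k in \<open>auto intro!: always_eventually less_imp_le\<close>)
  then have u_inf: "filterlim (\<lambda>n. u (k n)) at_infinity sequentially"
    by (rule filterlim_norm_at_top_imp_at_infinity)
  have z_k: "(\<lambda>n. z (k n)) \<longlonglongrightarrow> z0" by (rule filterlim_compose[OF z_lim k_top])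
  have v_0: "(\<lambda>n. v (k n)) \<longlonglongrightarrow> 0"
  proof (rule Lim_null_comparison)
    show "\<forall>\<^sub>F n in sequentially. norm (v (k n)) \<le> sqrt (a * b) / (cmod (z (k n)) * cmod (u (k n)))"
    proof (rule always_eventually, rule allI)
      fix n
      have "(cmod (z (k n)) * cmod (u (k n)) * cmod (v (k n)))\<^sup>2 \<le> a * b"
        using rv_pair.sol_norm_prod[OF pairs sols] by (simp add: power_mult_distrib)
      then have "cmod (z (k n)) * cmod (u (k n)) * cmod (v (k n)) \<le> sqrt (a * b)"
        by (rule real_le_rsqrt)
      moreover have "0 < cmod (z (k n)) * cmod (u (k n))"
        using seq_Im_pos[of "k n"] by (intro mult_pos_pos) auto
      ultimately show "norm (v (k n)) \<le> sqrt (a * b) / (cmod (z (k n)) * cmod (u (k n)))"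
        by (simp add: field_simps)
    qed
    have "filterlim (\<lambda>n. cmod (z (k n)) * cmod (u (k n))) at_top sequentially"
      using z0_nz by (intro filterlim_tendsto_pos_mult_at_top[OF tendsto_norm[OF z_k] _ nu]) auto
    then show "(\<lambda>n. sqrt (a * b) / (cmod (z (k n)) * cmod (u (k n)))) \<longlonglongrightarrow> 0"
      by (intro tendsto_divide_0[OF tendsto_const] filterlim_at_top_imp_at_infinity)
  qed
  \<comment> \<open>Pointwise limit of \<open>u * kern u Y = 1 - 1 / (1 + u Y)\<close> as
    \<open>u\<close> tends to infinity, the indicator of \<open>Y \<noteq> 0\<close>.\<close>
  define g where "g t = (if Y t = 0 then 0 else 1 :: real)" for t
  have X_k: "(\<lambda>n. Xs (k n) t) \<longlonglongrightarrow> X t" for t by (rule filterlim_compose[OF Xs_lim k_top])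
  have Y_k: "(\<lambda>n. Ys (k n) t) \<longlonglongrightarrow> Y t" for t by (rule filterlim_compose[OF Ys_lim k_top])
  have limY: "(\<lambda>n. \<integral>t. u (k n) * kern (u (k n)) (Ys (k n) t) \<partial>N) \<longlonglongrightarrow> (\<integral>t. of_real (g t) \<partial>N)"
  proof (rule B.tendsto_integral_L2_bounded)
    fix n
    interpret p: rv_pair M "Xs (k n)" N "Ys (k n)" a b by (rule pairs)
    have [measurable]: "Ys (k n) \<in> borel_measurable N" by (rule p.B.X_meas)
    show "(\<lambda>t. u (k n) * kern (u (k n)) (Ys (k n) t)) \<in> borel_measurable N" by measurable
    show "integrable N (\<lambda>t. (cmod (u (k n) * kern (u (k n)) (Ys (k n) t)))\<^sup>2)"
      using p.B.integrable_kern_sq[OF seq_Im_pos(2)] by (simp add: norm_mult power_mult_distrib)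
    show "(\<integral>t. (cmod (u (k n) * kern (u (k n)) (Ys (k n) t)))\<^sup>2 \<partial>N) \<le> a / b"
      using p.sol_norm_gam[OF sols] by (simp add: norm_mult power_mult_distrib p.B.gam_def)
  next
    show "(\<lambda>t. complex_of_real (g t)) \<in> borel_measurable N" unfolding g_def by measurable
  next
    fix t
    show "cmod (of_real (g t)) \<le> 1" by (simp add: g_def)
    show "(\<lambda>n. u (k n) * kern (u (k n)) (Ys (k n) t)) \<longlonglongrightarrow> of_real (g t)"
    proof (cases "Y t = 0")
      case True
      have "Ys (k n) t = 0" for n
        using Ys_le[of "k n" t] rv_pair.axioms(2)[OF pairs, of "k n"] pos_rv.X_nonneg True by (metis order_antisym)
      then show ?thesis using True by (simp add: g_def)
    next
      case False
      have "filterlim (\<lambda>n. of_real (Ys (k n) t) * u (k n)) at_infinity sequentially"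
        using False by (intro tendsto_mult_filterlim_at_infinity[OF tendsto_of_real[OF Y_k] _ u_inf]) auto
      then have "filterlim (\<lambda>n. 1 + u (k n) * of_real (Ys (k n) t)) at_infinity sequentially"
        by (intro tendsto_add_filterlim_at_infinity[OF tendsto_const]) (simp add: mult.commute)
      then have "(\<lambda>n. 1 / (1 + u (k n) * of_real (Ys (k n) t))) \<longlonglongrightarrow> 0"
        by (intro tendsto_divide_0[OF tendsto_const])
      then have "(\<lambda>n. 1 - 1 / (1 + u (k n) * of_real (Ys (k n) t))) \<longlonglongrightarrow> 1 - 0"
        by (intro tendsto_diff tendsto_const)
      then show ?thesis
        unfolding one_plus_mult_kern[OF seq_Im_pos(2)] using False by (simp add: g_def)
    qed
  qed
  have limX: "(\<lambda>n. \<integral>t. v (k n) * kern (v (k n)) (Xs (k n) t) \<partial>M) \<longlonglongrightarrow> (\<integral>t. 0 \<partial>M)"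
  proof (rule A.tendsto_integral_L2_bounded)
    fix n
    interpret p: rv_pair M "Xs (k n)" N "Ys (k n)" a b by (rule pairs)
    have [measurable]: "Xs (k n) \<in> borel_measurable M" by (rule p.A.X_meas)
    show "(\<lambda>t. v (k n) * kern (v (k n)) (Xs (k n) t)) \<in> borel_measurable M" by measurable
    show "integrable M (\<lambda>t. (cmod (v (k n) * kern (v (k n)) (Xs (k n) t)))\<^sup>2)"
      using p.A.integrable_kern_sq[OF seq_Im_pos(3)] by (simp add: norm_mult power_mult_distrib)
    show "(\<integral>t. (cmod (v (k n) * kern (v (k n)) (Xs (k n) t)))\<^sup>2 \<partial>M) \<le> b / a"
      using p.sol_norm_gam'[OF sols] by (simp add: norm_mult power_mult_distrib p.A.gam_def)
  next
    fix t
    have "(\<lambda>n. v (k n) * (of_real (Xs (k n) t) / (1 + v (k n) * of_real (Xs (k n) t))))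
        \<longlonglongrightarrow> 0 * (of_real (X t) / (1 + 0 * of_real (X t)))"
      by (intro tendsto_intros v_0 X_k) auto
    then show "(\<lambda>n. v (k n) * kern (v (k n)) (Xs (k n) t)) \<longlonglongrightarrow> 0"
      by (simp add: kern_def)
  qed auto
  have "of_real b * (\<integral>t. u (k n) * kern (u (k n)) (Ys (k n) t) \<partial>N)
      = of_real a * (\<integral>t. v (k n) * kern (v (k n)) (Xs (k n) t) \<partial>M)" for n
    using rv_pair.sol_prod[OF pairs sols, of "k n"] rv_pair.sol_prod'[OF pairs sols, of "k n"] by simp
  then have "(\<lambda>n. of_real a * (\<integral>t. v (k n) * kern (v (k n)) (Xs (k n) t) \<partial>M))
      \<longlonglongrightarrow> of_real b * (\<integral>t. of_real (g t) \<partial>N)"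
    using tendsto_mult[OF tendsto_const[of "complex_of_real b"] limY] by simp
  moreover have "(\<lambda>n. of_real a * (\<integral>t. v (k n) * kern (v (k n)) (Xs (k n) t) \<partial>M)) \<longlonglongrightarrow> of_real a * 0"
    using tendsto_mult[OF tendsto_const[of "complex_of_real a"] limX] by simp
  ultimately have "of_real b * (\<integral>t. complex_of_real (g t) \<partial>N) = of_real a * 0"
    by (rule LIMSEQ_unique)
  then have "(\<integral>t. g t \<partial>N) = 0" using b_pos by simp
  moreover have "0 < (\<integral>t. g t \<partial>N)"
    unfolding g_def by (rule B.integral_pos_function[where C=1]) auto
  ultimately show False by simp
qed

text \<open>Since \<open>Im v0 > 0\<close>, the kernels are eventually dominated by the constant
  \<open>2 / Im v0\<close>.\<close>

lemma limit_eq_fst: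
  assumes "u \<longlonglongrightarrow> u0" "v \<longlonglongrightarrow> v0" "0 < Im v0"
  shows "- (z0 * u0) = of_real a * A.stj v0"
proof -
  have "\<forall>\<^sub>F n in sequentially. Im v0 / 2 < Im (v n)"
    using order_tendstoD(1)[OF tendsto_Im[OF assms(2)], of "Im v0 / 2"] assms by auto
  then obtain n0 where n0: "\<And>n. n \<ge> n0 \<Longrightarrow> Im v0 / 2 < Im (v n)"
    unfolding eventually_sequentially by blast
  have "(\<lambda>n. \<integral>t. kern (v (n + n0)) (Xs (n + n0) t) \<partial>M) \<longlonglongrightarrow> A.stj v0"
    unfolding A.stj_def
  proof (rule integral_dominated_convergence[where w="\<lambda>_. 2 / Im v0"])
    show "AE t in M. (\<lambda>n. kern (v (n + n0)) (Xs (n + n0) t)) \<longlonglongrightarrow> kern v0 (X t)"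
      using LIMSEQ_ignore_initial_segment[OF assms(2), of n0] LIMSEQ_ignore_initial_segment[OF Xs_lim, of n0] assms(3)
      by (intro AE_I2 tendsto_kern)
    fix n
    interpret p: rv_pair M "Xs (n + n0)" N "Ys (n + n0)" a b by (rule pairs)
    have [measurable]: "Xs (n + n0) \<in> borel_measurable M" by (rule p.A.X_meas)
    show "(\<lambda>t. kern (v (n + n0)) (Xs (n + n0) t)) \<in> borel_measurable M" by measurable
    show "AE t in M. norm (kern (v (n + n0)) (Xs (n + n0) t)) \<le> 2 / Im v0"
    proof (rule AE_I2)
      fix t
      have "cmod (kern (v (n + n0)) (Xs (n + n0) t)) \<le> 1 / Im (v (n + n0))"
        using norm_kern_le[OF seq_Im_pos(3) p.A.X_nonneg] .
      also have "\<dots> \<le> 2 / Im v0"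
        using n0[of "n + n0"] assms(3) seq_Im_pos(3)[of "n + n0"] by (simp add: field_simps)
      finally show "norm (kern (v (n + n0)) (Xs (n + n0) t)) \<le> 2 / Im v0" .
    qed
  qed auto
  then have "(\<lambda>n. \<integral>t. kern (v n) (Xs n t) \<partial>M) \<longlonglongrightarrow> A.stj v0" by (rule LIMSEQ_offset)
  then have "(\<lambda>n. of_real a * (\<integral>t. kern (v n) (Xs n t) \<partial>M)) \<longlonglongrightarrow> of_real a * A.stj v0"
    by (intro tendsto_mult tendsto_const)
  moreover have "of_real a * (\<integral>t. kern (v n) (Xs n t) \<partial>M) = - (z n * u n)" for n
  proof -
    interpret p: rv_pair M "Xs n" N "Ys n" a b by (rule pairs)
    show ?thesis using p.sol_eqs(1)[OF sols] by (simp add: p.A.stj_def)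
  qed
  moreover have "(\<lambda>n. - (z n * u n)) \<longlonglongrightarrow> - (z0 * u0)"
    by (intro tendsto_intros z_lim assms)
  ultimately show ?thesis using LIMSEQ_unique by simp
qed

text \<open>The sequence \<open>v\<close> is bounded, so \<open>alp (v n)\<close> has a positive
  lower bound, and \<open>|z|^2 Im u\<close> dominates \<open>a Im z\<close> times it. Thus an
  interior \<open>z0\<close> keeps the limit off the real axis.\<close>

lemma limit_Im_fst_pos:
  assumes "0 < Im z0" "u \<longlonglongrightarrow> u0"
  shows "0 < Im u0"
proof -
  have "sol_seq N Y M X b a Ys Xs z v u z0" by (rule sol_seq_swap)
  then obtain R where R: "0 < R" "\<And>n. cmod (v n) \<le> R"
    using sol_seq.fst_bounded by blast
  \<comment> \<open>Minorant of the integrand of \<open>alp\<close> for all \<open>w\<close> of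
    modulus at most \<open>R\<close>.\<close>
  define q where "q x = x / (1 + R * x)\<^sup>2" for x :: real
  have q_lim: "(\<lambda>n. \<integral>t. q (Xs n t) \<partial>M) \<longlonglongrightarrow> (\<integral>t. q (X t) \<partial>M)"
  proof (rule integral_dominated_convergence[where w="\<lambda>_. 1 / R"])
    show "AE t in M. (\<lambda>n. q (Xs n t)) \<longlonglongrightarrow> q (X t)"
    proof (rule AE_I2)
      fix t
      have "(1 + R * X t)\<^sup>2 \<noteq> 0" using A.X_nonneg[of t] R by (simp add: add_nonneg_eq_0_iff)
      then show "(\<lambda>n. q (Xs n t)) \<longlonglongrightarrow> q (X t)"
        unfolding q_def by (intro tendsto_intros Xs_lim)
    qed
    fix n
    interpret p: rv_pair M "Xs n" N "Ys n" a b by (rule pairs)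
    have [measurable]: "Xs n \<in> borel_measurable M" by (rule p.A.X_meas)
    show "(\<lambda>t. q (Xs n t)) \<in> borel_measurable M" unfolding q_def by measurable
    show "AE t in M. norm (q (Xs n t)) \<le> 1 / R"
      using alp_minorant_le[OF R(1) p.A.X_nonneg] p.A.X_nonneg by (auto simp: q_def)
  qed (auto simp: q_def)
  have q_pos: "0 < (\<integral>t. q (X t) \<partial>M)"
  proof (rule A.integral_pos_function)
    show "0 < q x" if "0 < x" for x
      using that R add_pos_nonneg[of 1 "R * x"] by (simp add: q_def)
    show "q x \<le> 1 / R" if "0 \<le> x" for x
      unfolding q_def using alp_minorant_le[OF R(1) that] .
  qed (auto simp: q_def)
  have "a * Im (z n) * (\<integral>t. q (Xs n t) \<partial>M) \<le> (cmod (z n))\<^sup>2 * Im (u n)" for n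
  proof -
    interpret p: rv_pair M "Xs n" N "Ys n" a b by (rule pairs)
    have "a * Im (z n) * (\<integral>t. q (Xs n t) \<partial>M) \<le> a * Im (z n) * p.A.alp (v n)"
      unfolding q_def using a_pos seq_Im_pos(1)[of n] p.A.alp_ge[OF seq_Im_pos(3) R(2)]
      by (intro mult_left_mono) auto
    also have "\<dots> \<le> (cmod (z n))\<^sup>2 * Im (u n)"
      using p.sol_norm_sq_Im[OF sols] a_pos b_pos seq_Im_pos(2)[of n]
        p.A.gam_nonneg[of "v n"] p.B.gam_nonneg[of "u n"] by simp
    finally show ?thesis .
  qed
  then have "a * Im z0 * (\<integral>t. q (X t) \<partial>M) \<le> (cmod z0)\<^sup>2 * Im u0"
    by (intro LIMSEQ_le[OF tendsto_mult[OF tendsto_mult[OF tendsto_const tendsto_Im[OF z_lim]] q_lim]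
         tendsto_mult[OF tendsto_power[OF tendsto_norm[OF z_lim]] tendsto_Im[OF assms(2)]]]) auto
  moreover have "0 < a * Im z0 * (\<integral>t. q (X t) \<partial>M)"
    using a_pos assms q_pos by simp
  ultimately have "0 < (cmod z0)\<^sup>2 * Im u0" by linarith
  then show ?thesis by (simp add: zero_less_mult_iff)
qed

lemma limit_sol:
  assumes "u \<longlonglongrightarrow> u0" "v \<longlonglongrightarrow> v0" "0 < Im z0"
  shows "sol z0 u0 v0"
proof -
  interpret sw: sol_seq N Y M X b a Ys Xs z v u z0 by (rule sol_seq_swap)
  have "0 < Im u0" "0 < Im v0"
    using limit_Im_fst_pos sw.limit_Im_fst_pos assms by auto
  then show ?thesis
    unfolding sol_def using limit_eq_fst sw.limit_eq_fst assms by auto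
qed

lemma exists_convergent_subseq:
  "\<exists>r u0 v0. strict_mono (r :: nat \<Rightarrow> nat) \<and> (\<lambda>n. u (r n)) \<longlonglongrightarrow> u0 \<and> (\<lambda>n. v (r n)) \<longlonglongrightarrow> v0"
proof -
  interpret sw: sol_seq N Y M X b a Ys Xs z v u z0 by (rule sol_seq_swap)
  obtain R R' where R: "\<And>n. cmod (u n) \<le> R" and R': "\<And>n. cmod (v n) \<le> R'"
    using fst_bounded sw.fst_bounded by blast
  have bdd: "bounded (range (\<lambda>n. (u n, v n)))"
    by (rule bounded_subset[OF bounded_Times[OF bounded_cball[of 0 R] bounded_cball[of 0 R']]])
       (use R R' in auto)
  obtain l r where r: "strict_mono (r :: nat \<Rightarrow> nat)" and l: "((\<lambda>n. (u n, v n)) \<circ> r) \<longlonglongrightarrow> l"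
    using bounded_imp_convergent_subsequence[OF bdd] by (elim exE conjE) (rule that)
  have "(\<lambda>n. u (r n)) \<longlonglongrightarrow> fst l" "(\<lambda>n. v (r n)) \<longlonglongrightarrow> snd l"
    using tendsto_fst[OF l] tendsto_snd[OF l] by (simp_all add: o_def)
  with r show ?thesis by blast
qed

lemma sol_seq_subseq:
  assumes "strict_mono (r :: nat \<Rightarrow> nat)"
  shows "sol_seq M X N Y a b (\<lambda>n. Xs (r n)) (\<lambda>n. Ys (r n)) (\<lambda>n. z (r n)) (\<lambda>n. u (r n)) (\<lambda>n. v (r n)) z0"
proof (rule sol_seq.intro[OF rv_pair_axioms sol_seq_axioms.intro])
  have r: "filterlim r at_top sequentially" using assms by (rule filterlim_subseq)
  show "(\<lambda>n. Xs (r n) t) \<longlonglongrightarrow> X t" for t by (rule filterlim_compose[OF Xs_lim r])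
  show "(\<lambda>n. Ys (r n) t) \<longlonglongrightarrow> Y t" for t by (rule filterlim_compose[OF Ys_lim r])
  show "(\<lambda>n. z (r n)) \<longlonglongrightarrow> z0" by (rule filterlim_compose[OF z_lim r])
qed (rule pairs sols Xs_le Ys_le z0_nz)+

end

section \<open>Existence\<close>

text \<open>From \<open>Im (z * (1 + w X)) >= Im z\<close> the denominator has modulus at least
  \<open>Im z / |z|\<close>. This bound is free of \<open>Im w\<close>, as a compact invariant set
  requires.\<close>

lemma (in pos_rv) norm_stj_le_bounded:
  assumes "\<And>t. X t \<le> C" "0 < Im z" "0 < Im w" "0 \<le> Im (z * w)"
  shows "cmod (stj w) \<le> C * cmod z / Im z"
proof -
  have "cmod (kern w (X t)) \<le> C * cmod z / Im z" for t
  proof -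
    have "Im z \<le> Im z + X t * Im (z * w)" using assms X_nonneg[of t] by simp
    also have "\<dots> = Im (z * (1 + w * of_real (X t)))" by (simp add: algebra_simps)
    also have "\<dots> \<le> cmod z * cmod (1 + w * of_real (X t))"
      using abs_Im_le_cmod[of "z * (1 + w * of_real (X t))"] unfolding norm_mult by linarith
    finally have *: "Im z \<le> cmod z * cmod (1 + w * of_real (X t))" .
    have "0 < cmod z" "0 < cmod (1 + w * of_real (X t))"
      using assms kern_denom_nonzero[of w "X t"] by auto
    then have "cmod (kern w (X t)) = X t * cmod z / (cmod z * cmod (1 + w * of_real (X t)))"
      using X_nonneg[of t] by (simp add: kern_def norm_divide)
    also have "\<dots> \<le> C * cmod z / Im z"
      using * assms X_nonneg[of t]
      by (intro frac_le mult_right_mono) (auto intro!: mult_nonneg_nonneg order_trans[OF X_nonneg assms(1)])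
    finally show ?thesis .
  qed
  then have "(\<integral>t. cmod (kern w (X t)) \<partial>M) \<le> (\<integral>t. C * cmod z / Im z \<partial>M)"
    using integrable_kern[OF assms(3)] by (intro integral_mono) auto
  then have "(\<integral>t. cmod (kern w (X t)) \<partial>M) \<le> C * cmod z / Im z" by (simp add: prob_space)
  then show ?thesis
    unfolding stj_def by (rule order_trans[OF integral_norm_bound])
qed

context rv_pair
begin

text \<open>The map \<open>v\<close> to \<open>- a stj v / z\<close> preserves the cone
  \<open>Im w > 0\<close>, \<open>Im (z * w) >= 0\<close>, with a quantitative lower bound on the
  new imaginary part.\<close>

lemma half_step:
  assumes "0 < Im z" "0 < Im v" "0 \<le> Im (z * v)" "- (z * u) = of_real a * A.stj v"
  shows "0 < Im u" "0 \<le> Im (z * u)" "a * Im z * A.alp v \<le> (cmod z)\<^sup>2 * Im u"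
proof -
  have "0 \<le> a * A.gam v * Im (z * v)"
    using a_pos assms A.gam_nonneg by simp
  then show *: "a * Im z * A.alp v \<le> (cmod z)\<^sup>2 * Im u"
    using norm_sq_Im_fst[OF assms(4,2)] by linarith
  have "0 < a * Im z * A.alp v"
    using a_pos assms A.alp_pos by simp
  with * have "0 < (cmod z)\<^sup>2 * Im u" by linarith
  then show "0 < Im u" by (simp add: zero_less_mult_iff)
  show "0 \<le> Im (z * u)"
    unfolding Im_mult_fst[OF assms(4,2)] using a_pos assms A.gam_nonneg by simp
qed

text \<open>Brouwer for the composition of the two half steps. Bounded variables give an upper bound
  on the modulus, and this in turn gives the lower bound \<open>e\<close> on the imaginary
  part.\<close>

lemma exists_sol_bounded:
  assumes X_le: "\<And>t. X t \<le> C" and Y_le: "\<And>t. Y t \<le> C" and z: "0 < Im z"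
  shows "\<exists>u v. sol z u v"
proof -
  interpret sw: rv_pair N Y M X b a by (rule rv_pair_swap)
  have z0: "z \<noteq> 0" using z by auto
  define D where "D = {u. 0 < Im u \<and> 0 \<le> Im (z * u)}"
  define V where "V u = - (of_real b / z) * B.stj u" for u
  define U where "U v = - (of_real a / z) * A.stj v" for v
  have V_eq: "- (z * V u) = of_real b * B.stj u" and U_eq: "- (z * U u) = of_real a * A.stj u" for u
    using z0 by (auto simp: V_def U_def)
  have V_D: "V u \<in> D" if "u \<in> D" for u
    using sw.half_step[OF z _ _ V_eq] that by (auto simp: D_def)
  have U_D: "U v \<in> D" if "v \<in> D" for v
    using half_step[OF z _ _ U_eq] that by (auto simp: D_def)
  define R where "R = a * C / Im z"
  define R' where "R' = b * C / Im z"
  have V_le: "cmod (V u) \<le> R'" if "u \<in> D" for u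
  proof -
    have "cmod (V u) = b / cmod z * cmod (B.stj u)"
      using b_pos by (simp add: V_def norm_mult norm_divide)
    also have "\<dots> \<le> b / cmod z * (C * cmod z / Im z)"
      using that b_pos by (intro mult_left_mono B.norm_stj_le_bounded[OF Y_le z]) (auto simp: D_def)
    finally show ?thesis using z0 by (simp add: R'_def)
  qed
  have U_le: "cmod (U u) \<le> R" if "u \<in> D" for u
  proof -
    have "cmod (U u) = a / cmod z * cmod (A.stj u)"
      using a_pos by (simp add: U_def norm_mult norm_divide)
    also have "\<dots> \<le> a / cmod z * (C * cmod z / Im z)"
      using that a_pos by (intro mult_left_mono A.norm_stj_le_bounded[OF X_le z]) (auto simp: D_def)
    finally show ?thesis using z0 by (simp add: R_def)
  qed
  \<comment> \<open>A point of the cone, needed for nonemptiness: \<open>z * (- 1 / z)\<close> is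
    real.\<close>
  have u1: "- 1 / z \<in> D"
  proof -
    have "0 < (Re z)\<^sup>2 + (Im z)\<^sup>2" using z by (intro add_nonneg_pos) auto
    then have "0 < Im (- 1 / z)" using z by (simp add: Im_divide)
    moreover have "z * (- 1 / z) = - 1" using z0 by simp
    ultimately show ?thesis by (simp add: D_def del: times_complex.sel)
  qed
  have R'_pos: "0 < R'"
    using V_le[OF u1] V_D[OF u1] by (smt (verit) D_def mem_Collect_eq abs_Im_le_cmod)
  \<comment> \<open>Minorant of \<open>alp\<close> on the disc of radius \<open>R'\<close>, which
    contains all values of \<open>V\<close>, scaled by \<open>a Im z / |z|^2\<close> as in
    \<open>half_step\<close>.\<close>
  define e where "e = a * Im z * (\<integral>t. X t / (1 + R' * X t)\<^sup>2 \<partial>M) / (cmod z)\<^sup>2"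
  have "0 < (\<integral>t. X t / (1 + R' * X t)\<^sup>2 \<partial>M)"
  proof (rule A.integral_pos_function[where g="\<lambda>x. x / (1 + R' * x)\<^sup>2"])
    show "0 < x / (1 + R' * x)\<^sup>2" if "0 < x" for x
      using that R'_pos add_pos_nonneg[of 1 "R' * x"] by simp
    show "x / (1 + R' * x)\<^sup>2 \<le> 1 / R'" if "0 \<le> x" for x
      using alp_minorant_le[OF R'_pos that] .
  qed auto
  then have "0 < e" using a_pos z z0 by (simp add: e_def)
  have U_ge: "e \<le> Im (U (V u))" if "u \<in> D" for u
  proof -
    have v: "V u \<in> D" using that by (rule V_D)
    have "a * Im z * (\<integral>t. X t / (1 + R' * X t)\<^sup>2 \<partial>M) \<le> a * Im z * A.alp (V u)"
      using a_pos z v V_le[OF that] by (intro mult_left_mono A.alp_ge) (auto simp: D_def)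
    also have "\<dots> \<le> (cmod z)\<^sup>2 * Im (U (V u))"
      using half_step(3)[OF z _ _ U_eq] v by (auto simp: D_def)
    finally show ?thesis using z0 by (simp add: e_def field_simps)
  qed
  \<comment> \<open>A disc cut by two closed half planes, hence compact and convex; the level
    \<open>e\<close> keeps it away from the real axis.\<close>
  define K where "K = cball 0 R \<inter> {u. e \<le> Im u} \<inter> {u. 0 \<le> Im (z * u)}"
  have K_D: "K \<subseteq> D" using \<open>0 < e\<close> by (auto simp: K_def D_def)
  have K_im: "U (V u) \<in> K" if "u \<in> D" for u
    using U_le[OF V_D[OF that]] U_ge[OF that] U_D[OF V_D[OF that]] by (auto simp: K_def D_def)
  have "compact K"
    unfolding K_def
    by (intro compact_Int_closed compact_cball closed_Collect_le continuous_intros)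
  moreover have "convex K"
  proof -
    have "{u. 0 \<le> Im (z * u)} = (\<lambda>u. z * u) -` {w. 0 \<le> Im w}" by auto
    moreover have "convex ((\<lambda>u. z * u) -` {w. 0 \<le> Im w})"
      by (intro convex_linear_vimage convex_halfspace_Im_ge)
         (auto simp: linear_iff algebra_simps)
    ultimately show ?thesis
      unfolding K_def by (intro convex_Int convex_cball convex_halfspace_Im_ge) simp
  qed
  moreover have "K \<noteq> {}" using K_im[OF u1] by auto
  moreover have "continuous_on K (\<lambda>u. U (V u))"
  proof -
    have cA: "continuous_on {w. 0 < Im w} A.stj" and cB: "continuous_on {w. 0 < Im w} B.stj"
      by (intro holomorphic_on_imp_continuous_on A.stj_holomorphic_on B.stj_holomorphic_on)+
    have "continuous_on D V"
      unfolding V_def using z0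
      by (intro continuous_intros continuous_on_subset[OF cB]) (auto simp: D_def)
    moreover have "continuous_on D U"
      unfolding U_def using z0
      by (intro continuous_intros continuous_on_subset[OF cA]) (auto simp: D_def)
    ultimately show ?thesis
      using V_D K_D by (intro continuous_on_compose2[of D U K V] continuous_on_subset[of D V K]) auto
  qed
  moreover have "(\<lambda>u. U (V u)) \<in> K \<rightarrow> K" using K_im K_D by auto
  ultimately obtain u where u: "u \<in> K" "U (V u) = u" by (rule brouwer)
  have "sol z u (V u)"
    unfolding sol_def using u K_D V_D[of u] V_eq[of u] U_eq[of "V u"] z by (auto simp: D_def)
  then show ?thesis by blast
qed

lemma rv_pair_truncate: "rv_pair M (\<lambda>t. min (X t) (real (Suc n))) N (\<lambda>t. min (Y t) (real (Suc n))) a b"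
proof unfold_locales
  \<comment> \<open>The level is \<open>Suc n\<close>, so it is positive and truncation creates no
    new zeros.\<close>
  have min0: "min x (real (Suc n)) = 0 \<longleftrightarrow> x = 0" for x :: real by (auto simp: min_def)
  show "\<not> (AE t in M. min (X t) (real (Suc n)) = 0)" "\<not> (AE t in N. min (Y t) (real (Suc n)) = 0)"
    unfolding min0 by (rule A.X_nonzero B.X_nonzero)+
qed (use A.X_nonneg B.X_nonneg a_pos b_pos in auto)

theorem exists_sol:
  assumes "0 < Im z"
  shows "\<exists>u v. sol z u v"
proof -
  let ?X = "\<lambda>n t. min (X t) (real (Suc n))" and ?Y = "\<lambda>n t. min (Y t) (real (Suc n))"
  have "\<exists>u v. rv_pair.sol M (?X n) N (?Y n) a b z u v" for n
    by (rule rv_pair.exists_sol_bounded[OF rv_pair_truncate _ _ assms, where C="real (Suc n)"]) auto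
  then obtain u v where uv: "\<And>n. rv_pair.sol M (?X n) N (?Y n) a b z (u n) (v n)" by metis
  interpret s: sol_seq M X N Y a b ?X ?Y "\<lambda>_. z" u v z
  proof (rule sol_seq.intro[OF rv_pair_axioms sol_seq_axioms.intro])
    show "z \<noteq> 0" using assms by auto
  qed (rule rv_pair_truncate uv min_truncate_tendsto min.cobounded1 tendsto_const)+
  obtain r u0 v0 where r: "strict_mono (r :: nat \<Rightarrow> nat)"
    and l: "(\<lambda>n. u (r n)) \<longlonglongrightarrow> u0" "(\<lambda>n. v (r n)) \<longlonglongrightarrow> v0"
    using s.exists_convergent_subseq by (elim exE conjE) (rule that)
  have "sol z u0 v0"
    by (rule sol_seq.limit_sol[OF s.sol_seq_subseq[OF r] l assms])
  then show ?thesis by blast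
qed

end

section \<open>Boundary limits\<close>

lemma borel_measurable_cnj [measurable]: "cnj \<in> borel_measurable borel"
  by (intro borel_measurable_continuous_onI continuous_intros)

context pos_rv
begin

lemma gam_lower_bound:
  assumes "\<And>n. 0 < Im (w n)" "\<And>n. cmod (w n) \<le> R" "0 < R"
  shows "\<exists>g>0. \<forall>n::nat. g \<le> gam (w n)"
proof -
  have "0 < (\<integral>t. (X t / (1 + R * X t))\<^sup>2 \<partial>M)"
  proof (rule integral_pos_function[where g="\<lambda>x. (x / (1 + R * x))\<^sup>2"])
    show "0 < (x / (1 + R * x))\<^sup>2" if "0 < x" for x
      using that assms(3) add_pos_nonneg[of 1 "R * x"] by (simp add: zero_less_power2)
    show "(x / (1 + R * x))\<^sup>2 \<le> (1 / R)\<^sup>2" if "0 \<le> x" for x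
      using kern_minorant_sq_le[OF assms(3) that] .
  qed auto
  moreover have "(\<integral>t. (X t / (1 + R * X t))\<^sup>2 \<partial>M) \<le> gam (w n)" for n
    using gam_ge assms by blast
  ultimately show ?thesis by blast
qed

text \<open>The defect in Cauchy--Schwarz: with \<open>p^2 = gam w'\<close>,
  \<open>q^2 = gam w\<close> and \<open>k\<close> the phase of \<open>cov w w'\<close>, the value is
  \<open>2 p q (p q - |cov w w'|)\<close>. The conjugate appears because \<open>cov\<close> is
  bilinear.\<close>

lemma integral_norm_sq_combination:
  assumes "0 < Im w" "0 < Im w'" "cmod k = 1"
  shows "(\<integral>t. (cmod (of_real p * kern w (X t) - k * of_real q * cnj (kern w' (X t))))\<^sup>2 \<partial>M)
    = p\<^sup>2 * gam w + q\<^sup>2 * gam w' - 2 * p * q * Re (cnj k * cov w w')"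
proof -
  have eq: "(cmod (of_real p * f - k * of_real q * cnj g))\<^sup>2
     = p\<^sup>2 * (cmod f)\<^sup>2 + q\<^sup>2 * (cmod g)\<^sup>2 - 2 * p * q * Re (cnj k * (f * g))" for f g :: complex
  proof -
    have k: "k * cnj k = 1"
      using assms(3) complex_norm_square[of k] by simp
    have "complex_of_real ((cmod (of_real p * f - k * of_real q * cnj g))\<^sup>2)
      = (of_real p * f - k * of_real q * cnj g) * (of_real p * cnj f - cnj k * of_real q * g)"
      unfolding complex_norm_square by simp
    also have "\<dots> = of_real (p\<^sup>2) * (f * cnj f) + (k * cnj k) * of_real (q\<^sup>2) * (g * cnj g)
       - of_real (p * q) * (cnj k * (f * g) + cnj (cnj k * (f * g)))"
      by (simp add: algebra_simps power2_eq_square)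
    also have "\<dots> = of_real (p\<^sup>2 * (cmod f)\<^sup>2 + q\<^sup>2 * (cmod g)\<^sup>2 - 2 * p * q * Re (cnj k * (f * g)))"
      unfolding k complex_add_cnj complex_norm_square[symmetric] by (simp add: assms(3) del: times_complex.sel)
    finally show ?thesis by (simp only: of_real_eq_iff)
  qed
  have i: "integrable M (\<lambda>t. kern w (X t) * kern w' (X t))"
    by (rule integrable_kern_mult[OF assms(1,2)])
  then have i2: "integrable M (\<lambda>t. cnj k * (kern w (X t) * kern w' (X t)))" by simp
  have "(\<integral>t. Re (cnj k * (kern w (X t) * kern w' (X t))) \<partial>M) = Re (cnj k * cov w w')"
    unfolding integral_Re[OF i2] cov_def by simp
  then show ?thesis
    unfolding eq gam_def using integrable_kern_sq[OF assms(1)] integrable_kern_sq[OF assms(2)] integrable_Re[OF i2]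
    by simp
qed

text \<open>Asymptotic equality in the Cauchy--Schwarz inequality. The integrand is multiplied by both
  denominators before passing to the limit, so that poles of the limiting kernels on the real axis
  do no harm.\<close>

lemma cov_equality_case:
  assumes im: "\<And>n. 0 < Im (v n)" "\<And>n. 0 < Im (v' n)"
    and v: "v \<longlonglongrightarrow> V" and v': "v' \<longlonglongrightarrow> V'"
    and cov: "(\<lambda>n. cov (v n) (v' n)) \<longlonglongrightarrow> e"
    and gg: "(\<lambda>n. gam (v n) * gam (v' n)) \<longlonglongrightarrow> (cmod e)\<^sup>2"
  shows "V = V' \<or> (\<exists>t0>0. AE t in M. X t = 0 \<or> X t = t0)"
proof -
  obtain R1 R2 where R12: "0 < R1" "\<And>n. cmod (v n) \<le> R1" "0 < R2" "\<And>n. cmod (v' n) \<le> R2"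
    using convergent_imp_Bseq[of v] convergent_imp_Bseq[of v'] v v'
    unfolding convergent_def Bseq_def by blast
  define R where "R = max R1 R2"
  have R: "0 < R" "\<And>n. cmod (v n) \<le> R" "\<And>n. cmod (v' n) \<le> R"
    using R12 by (auto simp: R_def le_max_iff_disj)
  obtain g1 where g1: "0 < g1" "\<And>n. g1 \<le> gam (v n)" using gam_lower_bound[of v R] im R by blast
  obtain g2 where g2: "0 < g2" "\<And>n. g2 \<le> gam (v' n)" using gam_lower_bound[of v' R] im R by blast
  obtain C where C: "\<And>n. gam (v n) * gam (v' n) \<le> C"
  proof -
    have "Bseq (\<lambda>n. gam (v n) * gam (v' n))"
      using gg by (intro convergent_imp_Bseq) (auto simp: convergent_def)
    then obtain C where "\<And>n. norm (gam (v n) * gam (v' n)) \<le> C" unfolding Bseq_def by blast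
    then show ?thesis by (intro that[of C]) (auto dest!: abs_le_D1)
  qed
  have up1: "gam (v n) \<le> C / g2" for n
  proof -
    have "gam (v n) * g2 \<le> gam (v n) * gam (v' n)" using g2(2)[of n] gam_nonneg by (intro mult_left_mono)
    also have "\<dots> \<le> C" by (rule C)
    finally show ?thesis using g2(1) by (simp add: field_simps)
  qed
  have up2: "gam (v' n) \<le> C / g1" for n
  proof -
    have "g1 * gam (v' n) \<le> gam (v n) * gam (v' n)" using g1(2)[of n] gam_nonneg by (intro mult_right_mono)
    also have "\<dots> \<le> C" by (rule C)
    finally show ?thesis using g1(1) by (simp add: field_simps)
  qed
  have e_nz: "e \<noteq> 0"
  proof
    assume "e = 0"
    have "g1 * g2 \<le> (cmod e)\<^sup>2"
      by (rule LIMSEQ_le_const[OF gg]) (use g1 g2 in \<open>auto intro!: mult_mono gam_nonneg\<close>)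
    then show False using g1 g2 \<open>e = 0\<close> by (simp add: mult_le_0_iff)
  qed
  \<comment> \<open>The phase of the limit: \<open>cnj k * e = |e|\<close>, the value at which the
    defect vanishes.\<close>
  define k where "k = e / of_real (cmod e)"
  have k1: "cmod k = 1" using e_nz by (simp add: k_def norm_divide)
  have ke: "cnj k * e = of_real (cmod e)"
    using e_nz complex_norm_square[of e] by (simp add: k_def field_simps power2_eq_square)
  \<comment> \<open>Only the product of the moments is known to converge; along a subsequence both
    square roots converge separately.\<close>
  have bdd: "bounded (range (\<lambda>n. (sqrt (gam (v' n)), sqrt (gam (v n)))))"
  proof (rule bounded_subset)
    show "bounded ({0..sqrt (C / g1)} \<times> {0..sqrt (C / g2)})"
      by (intro bounded_Times) auto
    show "range (\<lambda>n. (sqrt (gam (v' n)), sqrt (gam (v n)))) \<subseteq> {0..sqrt (C / g1)} \<times> {0..sqrt (C / g2)}"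
      using up1 up2 gam_nonneg by auto
  qed
  obtain l r where r: "strict_mono (r :: nat \<Rightarrow> nat)"
    and l: "((\<lambda>n. (sqrt (gam (v' n)), sqrt (gam (v n)))) \<circ> r) \<longlonglongrightarrow> l"
    using bounded_imp_convergent_subsequence[OF bdd] by (elim exE conjE) (rule that)
  define p where "p n = sqrt (gam (v' (r n)))" for n
  define q where "q n = sqrt (gam (v (r n)))" for n
  define P where "P = fst l"
  define Q where "Q = snd l"
  have p_lim: "p \<longlonglongrightarrow> P" and q_lim: "q \<longlonglongrightarrow> Q"
    using tendsto_fst[OF l] tendsto_snd[OF l] by (simp_all add: o_def p_def[abs_def] q_def[abs_def] P_def Q_def)
  have r_top: "filterlim r at_top sequentially" using r by (rule filterlim_subseq)
  have vr: "(\<lambda>n. v (r n)) \<longlonglongrightarrow> V" and v'r: "(\<lambda>n. v' (r n)) \<longlonglongrightarrow> V'"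
    by (rule filterlim_compose[OF v r_top] filterlim_compose[OF v' r_top])+
  have P_pos: "0 < P"
  proof -
    have "sqrt g2 \<le> P" by (rule LIMSEQ_le_const[OF p_lim]) (use g2 in \<open>auto simp: p_def\<close>)
    then show ?thesis using g2 by (smt (verit) real_sqrt_gt_zero)
  qed
  have sq: "(p n)\<^sup>2 = gam (v' (r n))" "(q n)\<^sup>2 = gam (v (r n))" for n
    using gam_nonneg by (auto simp: p_def q_def)
  have p_nn: "0 \<le> p n" and q_nn: "0 \<le> q n" for n by (auto simp: p_def q_def gam_nonneg)
  have p_le: "p n \<le> sqrt (C / g1)" and q_le: "q n \<le> sqrt (C / g2)" for n
    using up1 up2 by (auto simp: p_def q_def)
  define h where "h n t = of_real (p n) * kern (v (r n)) (X t) - k * of_real (q n) * cnj (kern (v' (r n)) (X t))" for n t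
  have [measurable]: "h n \<in> borel_measurable M" for n unfolding h_def by measurable
  \<comment> \<open>The weights are crossed, \<open>p\<close> from \<open>v'\<close> and
    \<open>q\<close> from \<open>v\<close>, so each square contributes
    \<open>p^2 q^2\<close>.\<close>
  have h_int: "(\<integral>t. (cmod (h n t))\<^sup>2 \<partial>M) = 2 * ((p n)\<^sup>2 * (q n)\<^sup>2) - 2 * (p n * q n) * Re (cnj k * cov (v (r n)) (v' (r n)))" for n
    unfolding h_def integral_norm_sq_combination[OF im(1) im(2) k1] sq[symmetric]
    by (simp add: algebra_simps)
  have pq_lim: "(\<lambda>n. p n * q n) \<longlonglongrightarrow> cmod e"
  proof -
    have "(\<lambda>n. sqrt (gam (v (r n)) * gam (v' (r n)))) \<longlonglongrightarrow> sqrt ((cmod e)\<^sup>2)"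
      by (intro tendsto_real_sqrt filterlim_compose[OF gg r_top])
    then show ?thesis by (simp add: p_def q_def real_sqrt_mult mult.commute)
  qed
  have "(\<lambda>n. 2 * (p n * q n)\<^sup>2 - 2 * (p n * q n) * Re (cnj k * cov (v (r n)) (v' (r n))))
     \<longlonglongrightarrow> 2 * (cmod e)\<^sup>2 - 2 * cmod e * Re (cnj k * e)"
    by (intro tendsto_intros pq_lim filterlim_compose[OF cov r_top])
  then have h_lim: "(\<lambda>n. \<integral>t. (cmod (h n t))\<^sup>2 \<partial>M) \<longlonglongrightarrow> 0"
    unfolding h_int ke by (simp add: power_mult_distrib power2_eq_square mult_ac)
  \<comment> \<open>Each removed denominator has modulus at most \<open>1 + R x\<close>; dividing by
    \<open>(1 + R x)^2\<close> therefore keeps \<open>H\<close> below \<open>h\<close> and also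
    bounded by a constant.\<close>
  define H where "H p q v v' x = of_real x * (of_real p * (1 + cnj v' * of_real x) - k * of_real q * (1 + v * of_real x))
     / of_real ((1 + R * x)\<^sup>2)" for p q v v' x
  have [measurable]: "(\<lambda>t. H p q v v' (X t)) \<in> borel_measurable M" for p q v v' unfolding H_def by measurable
  have pos1: "0 < 1 + R * X t" for t using R X_nonneg[of t] by (intro add_pos_nonneg) auto
  have nz1: "complex_of_real ((1 + R * X t)\<^sup>2) \<noteq> 0" for t
    unfolding of_real_eq_0_iff using pos1[of t] by simp
  have H_eq: "H (p n) (q n) (v (r n)) (v' (r n)) (X t)
      = h n t * ((1 + v (r n) * of_real (X t)) * cnj (1 + v' (r n) * of_real (X t)) / of_real ((1 + R * X t)\<^sup>2))" for n t
  proof -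
    have d: "1 + v (r n) * of_real (X t) \<noteq> 0" "cnj (1 + v' (r n) * of_real (X t)) \<noteq> 0"
      unfolding complex_cnj_zero_iff using kern_denom_nonzero[OF im(1)] kern_denom_nonzero[OF im(2)] by blast+
    have "h n t * ((1 + v (r n) * of_real (X t)) * cnj (1 + v' (r n) * of_real (X t)))
      = of_real (X t) * (of_real (p n) * cnj (1 + v' (r n) * of_real (X t)) - k * of_real (q n) * (1 + v (r n) * of_real (X t)))"
    proof -
      have "(A * (x / d1) - B * (x / d2)) * (d1 * d2) = x * (A * d2 - B * d1)"
        if "d1 \<noteq> 0" "d2 \<noteq> 0" for A B x d1 d2 :: complex
        using that by (simp add: field_simps)
      from this[OF d] show ?thesis
        unfolding h_def kern_def complex_cnj_divide complex_cnj_complex_of_real .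
    qed
    then show ?thesis unfolding H_def by (simp add: mult.assoc)
  qed
  have H_le: "cmod (H (p n) (q n) (v (r n)) (v' (r n)) (X t)) \<le> cmod (h n t)" for n t
  proof -
    have "cmod (1 + v (r n) * of_real (X t)) * cmod (1 + v' (r n) * of_real (X t)) \<le> (1 + R * X t) * (1 + R * X t)"
      using pos1[of t] norm_denom_le[OF R(2) X_nonneg] norm_denom_le[OF R(3) X_nonneg] by (intro mult_mono) auto
    then have "cmod ((1 + v (r n) * of_real (X t)) * cnj (1 + v' (r n) * of_real (X t)) / of_real ((1 + R * X t)\<^sup>2)) \<le> 1"
      using pos1[of t] unfolding norm_divide norm_mult complex_mod_cnj norm_of_real by (simp add: power2_eq_square)
    then show ?thesis
      unfolding H_eq norm_mult by (rule mult_left_le) simp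
  qed
  have H_bd: "cmod (H (p n) (q n) (v (r n)) (v' (r n)) (X t)) \<le> (sqrt (C / g1) + sqrt (C / g2)) / R" for n t
  proof -
    let ?s = "1 + R * X t"
    have "cmod (of_real (p n) * (1 + cnj (v' (r n)) * of_real (X t)) - k * of_real (q n) * (1 + v (r n) * of_real (X t)))
        \<le> p n * cmod (1 + cnj (v' (r n)) * of_real (X t)) + q n * cmod (1 + v (r n) * of_real (X t))"
      by (rule order_trans[OF norm_triangle_ineq4]) (simp add: norm_mult k1 p_nn q_nn)
    also have "\<dots> \<le> sqrt (C / g1) * ?s + sqrt (C / g2) * ?s"
      using norm_denom_le[OF R(2) X_nonneg] norm_denom_le[of "cnj (v' (r n))" R "X t"] R(3) X_nonneg p_le q_le
      by (intro add_mono mult_mono) (auto intro: order_trans[OF p_nn p_le] order_trans[OF q_nn q_le] simp del: real_sqrt_ge_0_iff)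
    finally have *: "cmod (of_real (p n) * (1 + cnj (v' (r n)) * of_real (X t)) - k * of_real (q n) * (1 + v (r n) * of_real (X t)))
        \<le> (sqrt (C / g1) + sqrt (C / g2)) * ?s" by (simp add: algebra_simps)
    have "cmod (H (p n) (q n) (v (r n)) (v' (r n)) (X t)) \<le> X t * ((sqrt (C / g1) + sqrt (C / g2)) * ?s) / ?s\<^sup>2"
      unfolding H_def norm_divide norm_mult norm_of_real using mult_left_mono[OF * X_nonneg[of t]] pos1[of t] X_nonneg[of t]
      by (simp add: divide_right_mono)
    also have "\<dots> = (sqrt (C / g1) + sqrt (C / g2)) * (X t / ?s)"
      using pos1[of t] by (simp add: power2_eq_square)
    also have "\<dots> \<le> (sqrt (C / g1) + sqrt (C / g2)) * (1 / R)"
    proof (rule mult_left_mono)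
      show "X t / ?s \<le> 1 / R" using pos1[of t] R(1) by (simp add: field_simps)
      show "0 \<le> sqrt (C / g1) + sqrt (C / g2)"
        using p_nn[of 0] p_le[of 0] q_nn[of 0] q_le[of 0] by linarith
    qed
    finally show ?thesis by simp
  qed
  let ?B = "(sqrt (C / g1) + sqrt (C / g2)) / R"
  have H_tendsto: "(\<lambda>n. H (p n) (q n) (v (r n)) (v' (r n)) (X t)) \<longlonglongrightarrow> H P Q V V' (X t)" for t
    unfolding H_def by (intro tendsto_intros p_lim q_lim vr v'r nz1)
  have H_bd': "cmod (H P Q V V' (X t)) \<le> ?B" for t
    by (rule LIMSEQ_le_const2[OF tendsto_norm[OF H_tendsto]]) (use H_bd in auto)
  have H_int_lim: "(\<lambda>n. \<integral>t. (cmod (H (p n) (q n) (v (r n)) (v' (r n)) (X t)))\<^sup>2 \<partial>M) \<longlonglongrightarrow> (\<integral>t. (cmod (H P Q V V' (X t)))\<^sup>2 \<partial>M)"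
  proof (rule integral_dominated_convergence[where w="\<lambda>_. ?B\<^sup>2"])
    show "AE t in M. (\<lambda>n. (cmod (H (p n) (q n) (v (r n)) (v' (r n)) (X t)))\<^sup>2) \<longlonglongrightarrow> (cmod (H P Q V V' (X t)))\<^sup>2"
      by (intro AE_I2 tendsto_intros H_tendsto)
    show "AE t in M. norm ((cmod (H (p n) (q n) (v (r n)) (v' (r n)) (X t)))\<^sup>2) \<le> ?B\<^sup>2" for n
      using power_mono[OF H_bd] by (intro AE_I2) simp
  qed auto
  have h_integrable: "integrable M (\<lambda>t. (cmod (h n t))\<^sup>2)" for n
  proof (rule integrable_const_bound)
    show "AE t in M. norm ((cmod (h n t))\<^sup>2) \<le> (p n * (1 / Im (v (r n))) + q n * (1 / Im (v' (r n))))\<^sup>2"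
    proof (rule AE_I2)
      fix t
      have "cmod (h n t) \<le> p n * cmod (kern (v (r n)) (X t)) + q n * cmod (kern (v' (r n)) (X t))"
        unfolding h_def by (rule order_trans[OF norm_triangle_ineq4]) (simp add: norm_mult k1 p_nn q_nn)
      also have "\<dots> \<le> p n * (1 / Im (v (r n))) + q n * (1 / Im (v' (r n)))"
        by (intro add_mono mult_left_mono norm_kern_le im X_nonneg p_nn q_nn)
      finally have "(cmod (h n t))\<^sup>2 \<le> (p n * (1 / Im (v (r n))) + q n * (1 / Im (v' (r n))))\<^sup>2"
        by (rule power_mono) simp
      then show "norm ((cmod (h n t))\<^sup>2) \<le> (p n * (1 / Im (v (r n))) + q n * (1 / Im (v' (r n))))\<^sup>2" by simp
    qed
  qed simp
  have "(\<integral>t. (cmod (H P Q V V' (X t)))\<^sup>2 \<partial>M) \<le> 0"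
  proof (rule LIMSEQ_le[OF H_int_lim h_lim])
    have "(\<integral>t. (cmod (H (p n) (q n) (v (r n)) (v' (r n)) (X t)))\<^sup>2 \<partial>M) \<le> (\<integral>t. (cmod (h n t))\<^sup>2 \<partial>M)" for n
    proof (rule integral_mono_AE')
      show "AE t in M. (cmod (H (p n) (q n) (v (r n)) (v' (r n)) (X t)))\<^sup>2 \<le> (cmod (h n t))\<^sup>2"
        using power_mono[OF H_le] by (intro AE_I2) simp
    qed (use h_integrable in auto)
    then show "\<exists>N. \<forall>n\<ge>N. (\<integral>t. (cmod (H (p n) (q n) (v (r n)) (v' (r n)) (X t)))\<^sup>2 \<partial>M) \<le> (\<integral>t. (cmod (h n t))\<^sup>2 \<partial>M)"
      by blast
  qed
  then have "(\<integral>t. (cmod (H P Q V V' (X t)))\<^sup>2 \<partial>M) = 0"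
    by (intro antisym) simp_all
  moreover have "integrable M (\<lambda>t. (cmod (H P Q V V' (X t)))\<^sup>2)"
    using power_mono[OF H_bd'] by (intro integrable_const_bound[of _ "?B\<^sup>2"]) auto
  ultimately have "AE t in M. (cmod (H P Q V V' (X t)))\<^sup>2 = 0"
    using integral_nonneg_eq_0_iff_AE[of M "\<lambda>t. (cmod (H P Q V V' (X t)))\<^sup>2"] by simp
  then have H0: "AE t in M. H P Q V V' (X t) = 0" by simp
  \<comment> \<open>Vanishing of \<open>H\<close> is an affine equation for \<open>X\<close> where
    \<open>X\<close> is nonzero; if \<open>c2\<close> is nonzero it leaves a single value.\<close>
  define c1 where "c1 = of_real P - k * of_real Q"
  define c2 where "c2 = of_real P * cnj V' - k * of_real Q * V"
  have lin: "AE t in M. X t = 0 \<or> c1 + c2 * of_real (X t) = 0"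
    using H0
  proof eventually_elim
    case (elim t)
    then have "X t = 0 \<or> of_real P * (1 + cnj V' * of_real (X t)) - k * of_real Q * (1 + V * of_real (X t)) = 0"
      using nz1[of t] by (simp add: H_def del: of_real_power of_real_add of_real_mult)
    then show ?case by (auto simp: c1_def c2_def algebra_simps)
  qed
  show ?thesis
  proof (cases "c2 = 0")
    case False
    define t0 where "t0 = Re (- c1 / c2)"
    have *: "AE t in M. X t = 0 \<or> X t = t0"
      using lin
    proof eventually_elim
      case (elim t)
      then show ?case
      proof
        assume "c1 + c2 * of_real (X t) = 0"
        then have "of_real (X t) = - c1 / c2" using False by (simp add: field_simps add_eq_0_iff)
        then have "X t = t0" unfolding t0_def by (metis Re_complex_of_real)
        then show ?thesis by simp
      qed simp
    qed
    have "0 < t0"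
    proof (rule ccontr)
      assume "\<not> 0 < t0"
      have "AE t in M. X t = 0"
        using * by eventually_elim (use X_nonneg \<open>\<not> 0 < t0\<close> in \<open>force simp: order_le_less\<close>)
      then show False using X_nonzero by simp
    qed
    then show ?thesis using * by blast
  next
    case c2: True
    have "c1 = 0"
    proof (rule ccontr)
      assume "c1 \<noteq> 0"
      then have "AE t in M. X t = 0" using lin c2 by simp
      then show False using X_nonzero by simp
    qed
    \<comment> \<open>Both coefficients vanish and \<open>P > 0\<close> cancels, so
      \<open>V = cnj V'\<close>; as neither point lies below the real axis, both are real.\<close>
    then have "k * of_real Q = of_real P" by (simp add: c1_def)
    then have "of_real P * (cnj V' - V) = 0" using c2 by (simp add: c2_def algebra_simps)
    then have VV: "V = cnj V'" using P_pos by simp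
    have "0 \<le> Im V" "0 \<le> Im V'"
      by (rule LIMSEQ_le_const[OF tendsto_Im[OF v]] LIMSEQ_le_const[OF tendsto_Im[OF v']];
          use im in \<open>auto intro: less_imp_le\<close>)+
    then have "V = V'" using VV by (auto simp: complex_eq_iff)
    then show ?thesis by simp
  qed
qed

text \<open>The kernel is constant where \<open>X\<close> is nonzero; the real constant is
  \<open>t0\<close> times the mass of that set.\<close>

lemma stj_two_point:
  assumes "AE t in M. X t = 0 \<or> X t = t0" "0 < t0"
  shows "\<exists>P::real. \<forall>w. 0 < Im w \<longrightarrow> stj w * (1 + w * of_real t0) = of_real P"
proof (intro exI allI impI)
  fix w :: complex assume w: "0 < Im w"
  have "stj w = (\<integral>t. kern w t0 * of_real (if X t = 0 then 0 else 1) \<partial>M)"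
    unfolding stj_def by (rule integral_cong_AE) (use assms(1) in \<open>auto elim!: eventually_mono\<close>)
  also have "\<dots> = kern w t0 * of_real (\<integral>t. (if X t = 0 then 0 else 1) \<partial>M)"
    by (subst integral_mult_right_zero) (simp only: integral_complex_of_real)
  finally show "stj w * (1 + w * of_real t0) = of_real (t0 * (\<integral>t. (if X t = 0 then 0 else 1) \<partial>M))"
    using kern_denom_nonzero[OF w, of t0] by (simp add: kern_def)
qed

end

context rv_pair
begin

text \<open>Cluster points of the solution at \<open>x\<close>, along sequences from the upper half
  plane; \<open>x\<close> may be interior or on the real axis.\<close>

definition sol_limit :: "complex \<Rightarrow> complex \<Rightarrow> complex \<Rightarrow> bool" where
  "sol_limit x U V \<longleftrightarrow> (\<exists>z u v. (\<forall>n::nat. sol (z n) (u n) (v n)) \<and> z \<longlonglongrightarrow> x \<and> u \<longlonglongrightarrow> U \<and> v \<longlonglongrightarrow> V)"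

lemma sol_limit_swap: "sol_limit x U V \<longleftrightarrow> rv_pair.sol_limit N Y M X b a x V U"
  unfolding sol_limit_def rv_pair.sol_limit_def[OF rv_pair_swap] sol_swap[symmetric] by blast

lemma sol_seq_const:
  assumes "\<And>n. sol (z n) (u n) (v n)" "z \<longlonglongrightarrow> x" "x \<noteq> 0"
  shows "sol_seq M X N Y a b (\<lambda>_. X) (\<lambda>_. Y) z u v x"
  by (rule sol_seq.intro[OF rv_pair_axioms sol_seq_axioms.intro])
     (rule rv_pair_axioms assms order_refl tendsto_const)+

lemma sol_limit_sol:
  assumes "sol_limit x U V" "0 < Im x"
  shows "sol x U V"
proof -
  obtain z u v where s: "\<And>n. sol (z n) (u n) (v n)" "z \<longlonglongrightarrow> x" and l: "u \<longlonglongrightarrow> U" "v \<longlonglongrightarrow> V"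
    using assms(1) unfolding sol_limit_def by blast
  have "x \<noteq> 0" using assms by auto
  then show ?thesis
    using sol_seq.limit_sol[OF sol_seq_const[OF s] l assms(2)] by blast
qed

lemma sol_limit_eq_fst:
  assumes "sol_limit x U V" "x \<noteq> 0" "0 < Im V"
  shows "- (x * U) = of_real a * A.stj V"
proof -
  obtain z u v where s: "\<And>n. sol (z n) (u n) (v n)" "z \<longlonglongrightarrow> x" and l: "u \<longlonglongrightarrow> U" "v \<longlonglongrightarrow> V"
    using assms(1) unfolding sol_limit_def by blast
  show ?thesis
    using sol_seq.limit_eq_fst[OF sol_seq_const[OF s assms(2)] l assms(3)] .
qed

lemma sol_limit_Im_nonneg:
  assumes "sol_limit x U V"
  shows "0 \<le> Im U" "0 \<le> Im V"
proof -
  obtain z u v where s: "\<And>n. sol (z n) (u n) (v n)" and l: "u \<longlonglongrightarrow> U" "v \<longlonglongrightarrow> V"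
    using assms unfolding sol_limit_def by blast
  have "0 \<le> Im (u n)" "0 \<le> Im (v n)" for n
    using sol_pos[OF s, of n] by simp_all
  then show "0 \<le> Im U" "0 \<le> Im V"
    using LIMSEQ_le_const[OF tendsto_Im[OF l(1)], of 0] LIMSEQ_le_const[OF tendsto_Im[OF l(2)], of 0] by blast+
qed

text \<open>Bounded \<open>u\<close> keeps \<open>B.gam (u n)\<close> away from 0, and the product
  of the moments is below \<open>|z|^2 / (a b)\<close>. The bound holds even if \<open>v\<close>
  approaches the real axis.\<close>

lemma gam_upper_bound:
  assumes s: "\<And>n. sol (z n) (u n) (v n)" and lim: "z \<longlonglongrightarrow> x" "u \<longlonglongrightarrow> U"
  shows "\<exists>C>0. \<forall>n::nat. A.gam (v n) \<le> C"
proof -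
  obtain R where R: "0 < R" "\<And>n. cmod (u n) \<le> R"
    using convergent_imp_Bseq[of u] lim unfolding convergent_def Bseq_def by blast
  obtain Z where Z: "0 < Z" "\<And>n. cmod (z n) \<le> Z"
    using convergent_imp_Bseq[of z] lim unfolding convergent_def Bseq_def by blast
  obtain g where g: "0 < g" "\<And>n. g \<le> B.gam (u n)"
    using B.gam_lower_bound[of u R] R sol_pos[OF s] by blast
  have "A.gam (v n) \<le> Z\<^sup>2 / (a * b * g)" for n
  proof -
    have "A.gam (v n) * (a * b * g) \<le> A.gam (v n) * (a * b * B.gam (u n))"
      using g(2)[of n] a_pos b_pos A.gam_nonneg by (intro mult_left_mono) auto
    also have "\<dots> = a * b * A.gam (v n) * B.gam (u n)" by simp
    also have "\<dots> \<le> (cmod (z n))\<^sup>2" using sol_gam_less[OF s] by (rule less_imp_le)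
    also have "\<dots> \<le> Z\<^sup>2" using Z(2) by (intro power_mono) auto
    finally show ?thesis using a_pos b_pos g(1) by (simp add: field_simps)
  qed
  moreover have "0 < Z\<^sup>2 / (a * b * g)" using a_pos b_pos g(1) Z(1) by simp
  ultimately show ?thesis by blast
qed

text \<open>Different \<open>z\<close> and \<open>z'\<close> are allowed because two boundary limits
  may arise along different sequences.\<close>

lemma sol_diff_fst:
  assumes "sol z u v" "sol z' u' v'"
  shows "z * u - z' * u' = of_real a * (v - v') * A.cov v v'"
proof -
  have "- (z * u) - (- (z' * u')) = of_real a * (A.stj v - A.stj v')"
    unfolding sol_eqs(1)[OF assms(1)] sol_eqs(1)[OF assms(2)] by (simp add: algebra_simps)
  also have "\<dots> = of_real a * ((v' - v) * A.cov v v')"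
    using A.stj_diff sol_pos[OF assms(1)] sol_pos[OF assms(2)] by simp
  finally show ?thesis by (simp add: algebra_simps)
qed

text \<open>The covariances stay bounded, so \<open>v - v'\<close> tending to 0 forces
  \<open>z u - z' u'\<close> to 0.\<close>

lemma sol_limit_eq_if_snd_eq:
  assumes "sol_limit x U V" "sol_limit x U' V" "x \<noteq> 0"
  shows "U = U'"
proof -
  obtain z u v where s: "\<And>n. sol (z n) (u n) (v n)" and l: "z \<longlonglongrightarrow> x" "u \<longlonglongrightarrow> U" "v \<longlonglongrightarrow> V"
    using assms(1) unfolding sol_limit_def by blast
  obtain z' u' v' where s': "\<And>n. sol (z' n) (u' n) (v' n)" and l': "z' \<longlonglongrightarrow> x" "u' \<longlonglongrightarrow> U'" "v' \<longlonglongrightarrow> V"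
    using assms(2) unfolding sol_limit_def by blast
  obtain C where C: "0 < C" "\<And>n. A.gam (v n) \<le> C" using gam_upper_bound[OF s l(1,2)] by blast
  obtain C' where C': "0 < C'" "\<And>n. A.gam (v' n) \<le> C'" using gam_upper_bound[OF s' l'(1,2)] by blast
  have cov_le: "cmod (A.cov (v n) (v' n)) \<le> sqrt (C * C')" for n
  proof (rule real_le_rsqrt)
    have "(cmod (A.cov (v n) (v' n)))\<^sup>2 \<le> A.gam (v n) * A.gam (v' n)"
      using sol_pos[OF s] sol_pos[OF s'] by (intro A.norm_cov_sq_le) auto
    also have "\<dots> \<le> C * C'" using C C' by (intro mult_mono) (auto simp: A.gam_nonneg)
    finally show "(cmod (A.cov (v n) (v' n)))\<^sup>2 \<le> C * C'" .
  qed
  have "(\<lambda>n. z n * u n - z' n * u' n) \<longlonglongrightarrow> 0"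
  proof (rule Lim_null_comparison)
    show "\<forall>\<^sub>F n in sequentially. norm (z n * u n - z' n * u' n) \<le> a * cmod (v n - v' n) * sqrt (C * C')"
      unfolding sol_diff_fst[OF s s'] norm_mult using cov_le a_pos
      by (intro always_eventually allI mult_mono) auto
    have "(\<lambda>n. a * cmod (v n - v' n) * sqrt (C * C')) \<longlonglongrightarrow> a * cmod (V - V) * sqrt (C * C')"
      by (intro tendsto_intros l l')
    then show "(\<lambda>n. a * cmod (v n - v' n) * sqrt (C * C')) \<longlonglongrightarrow> 0" by simp
  qed
  moreover have "(\<lambda>n. z n * u n - z' n * u' n) \<longlonglongrightarrow> x * U - x * U'"
    by (intro tendsto_intros l l')
  ultimately have "x * U - x * U' = 0" using LIMSEQ_unique by blast
  then show ?thesis using assms(3) by simp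
qed

text \<open>The difference equations force the two covariances to converge to \<open>e\<close> and
  \<open>e'\<close> with \<open>a b e e' = x^2\<close>. This exhausts the bound on the moments, so
  Cauchy--Schwarz is asymptotically an equality.\<close>

lemma sol_limit_two_point:
  assumes "sol_limit x U V" "sol_limit x U' V'" "x \<noteq> 0" "U \<noteq> U'" "V \<noteq> V'"
  shows "\<exists>t0>0. AE t in M. X t = 0 \<or> X t = t0"
proof -
  interpret sw: rv_pair N Y M X b a by (rule rv_pair_swap)
  obtain z u v where s: "\<And>n. sol (z n) (u n) (v n)" and l: "z \<longlonglongrightarrow> x" "u \<longlonglongrightarrow> U" "v \<longlonglongrightarrow> V"
    using assms(1) unfolding sol_limit_def by blast
  obtain z' u' v' where s': "\<And>n. sol (z' n) (u' n) (v' n)" and l': "z' \<longlonglongrightarrow> x" "u' \<longlonglongrightarrow> U'" "v' \<longlonglongrightarrow> V'"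
    using assms(2) unfolding sol_limit_def by blast
  note p = sol_pos[OF s] and p' = sol_pos[OF s']
  define e where "e = (x * U - x * U') / (of_real a * (V - V'))"
  define e' where "e' = (x * V - x * V') / (of_real b * (U - U'))"
  have nz: "e \<noteq> 0" "e' \<noteq> 0"
    using assms a_pos b_pos by (auto simp: e_def e'_def)
  have ev: "\<forall>\<^sub>F n in sequentially. v n \<noteq> v' n" and eu: "\<forall>\<^sub>F n in sequentially. u n \<noteq> u' n"
  proof -
    have "(\<lambda>n. v n - v' n) \<longlonglongrightarrow> V - V'" "(\<lambda>n. u n - u' n) \<longlonglongrightarrow> U - U'"
      by (intro tendsto_intros l l')+
    then have "\<forall>\<^sub>F n in sequentially. v n - v' n \<noteq> 0" "\<forall>\<^sub>F n in sequentially. u n - u' n \<noteq> 0"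
      using assms tendsto_imp_eventually_ne[of "\<lambda>n. v n - v' n" "V - V'" sequentially 0]
        tendsto_imp_eventually_ne[of "\<lambda>n. u n - u' n" "U - U'" sequentially 0] by simp_all
    then show "\<forall>\<^sub>F n in sequentially. v n \<noteq> v' n" "\<forall>\<^sub>F n in sequentially. u n \<noteq> u' n" by simp_all
  qed
  have cov1: "(\<lambda>n. A.cov (v n) (v' n)) \<longlonglongrightarrow> e"
  proof (rule Lim_transform_eventually)
    show "(\<lambda>n. (z n * u n - z' n * u' n) / (of_real a * (v n - v' n))) \<longlonglongrightarrow> e"
      unfolding e_def using assms a_pos by (intro tendsto_intros l l') auto
    show "\<forall>\<^sub>F n in sequentially. (z n * u n - z' n * u' n) / (of_real a * (v n - v' n)) = A.cov (v n) (v' n)"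
      using ev by eventually_elim (use a_pos in \<open>simp add: sol_diff_fst[OF s s']\<close>)
  qed
  have cov2: "(\<lambda>n. B.cov (u n) (u' n)) \<longlonglongrightarrow> e'"
  proof (rule Lim_transform_eventually)
    show "(\<lambda>n. (z n * v n - z' n * v' n) / (of_real b * (u n - u' n))) \<longlonglongrightarrow> e'"
      unfolding e'_def using assms b_pos by (intro tendsto_intros l l') auto
    have *: "z n * v n - z' n * v' n = of_real b * (u n - u' n) * B.cov (u n) (u' n)" for n
      using sw.sol_diff_fst s s' sol_swap by blast
    show "\<forall>\<^sub>F n in sequentially. (z n * v n - z' n * v' n) / (of_real b * (u n - u' n)) = B.cov (u n) (u' n)"
      using eu by eventually_elim (use b_pos in \<open>simp add: *\<close>)
  qed
  \<comment> \<open>Upper bound for \<open>A.gam (v n) * A.gam (v' n)\<close>, from the moment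
    estimates of both solutions and Cauchy--Schwarz on \<open>N\<close>; its limit is that of the
    lower bound \<open>|cov|^2\<close>.\<close>
  define F where "F n = (cmod (z n))\<^sup>2 * (cmod (z' n))\<^sup>2 / ((a * b)\<^sup>2 * (cmod (B.cov (u n) (u' n)))\<^sup>2)" for n
  have "F \<longlonglongrightarrow> (cmod x)\<^sup>2 * (cmod x)\<^sup>2 / ((a * b)\<^sup>2 * (cmod e')\<^sup>2)"
    unfolding F_def using nz a_pos b_pos by (intro tendsto_intros l l' cov2) auto
  moreover have "(cmod x)\<^sup>2 * (cmod x)\<^sup>2 / ((a * b)\<^sup>2 * (cmod e')\<^sup>2) = (cmod e)\<^sup>2"
  proof -
    have "of_real (a * b) * e * e' = x * x"
    proof -
      have "p * q * (x * d / (p * d')) * (x * d' / (q * d)) = x * x"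
        if "p \<noteq> 0" "q \<noteq> 0" "d \<noteq> 0" "d' \<noteq> 0" for p q d d' :: complex
        using that by (simp add: field_simps)
      from this[of "of_real a" "of_real b" "U - U'" "V - V'"] show ?thesis
        unfolding e_def e'_def using assms(4,5) a_pos b_pos by (simp add: right_diff_distrib[symmetric])
    qed
    then have "cmod (of_real (a * b) * e * e') = cmod (x * x)" by simp
    then have "(a * b) * cmod e * cmod e' = cmod x * cmod x"
      unfolding norm_mult norm_of_real using a_pos b_pos by simp
    then have "((a * b) * cmod e * cmod e')\<^sup>2 = (cmod x * cmod x)\<^sup>2" by simp
    then have "(cmod x)\<^sup>2 * (cmod x)\<^sup>2 = (cmod e)\<^sup>2 * ((a * b)\<^sup>2 * (cmod e')\<^sup>2)"
      by (simp add: power_mult_distrib mult_ac)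
    then show ?thesis using nz a_pos b_pos by simp
  qed
  ultimately have F_lim: "F \<longlonglongrightarrow> (cmod e)\<^sup>2" by simp
  have "(\<lambda>n. A.gam (v n) * A.gam (v' n)) \<longlonglongrightarrow> (cmod e)\<^sup>2"
  proof (rule tendsto_sandwich[OF _ _ tendsto_power[OF tendsto_norm[OF cov1]] F_lim])
    show "\<forall>\<^sub>F n in sequentially. (cmod (A.cov (v n) (v' n)))\<^sup>2 \<le> A.gam (v n) * A.gam (v' n)"
      using A.norm_cov_sq_le[OF p(3) p'(3)] by simp
    have "\<forall>\<^sub>F n in sequentially. B.cov (u n) (u' n) \<noteq> 0"
      using nz(2) by (rule tendsto_imp_eventually_ne[OF cov2])
    then show "\<forall>\<^sub>F n in sequentially. A.gam (v n) * A.gam (v' n) \<le> F n"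
    proof eventually_elim
      case (elim n)
      have "A.gam (v n) * A.gam (v' n) * ((a * b)\<^sup>2 * (cmod (B.cov (u n) (u' n)))\<^sup>2)
          \<le> A.gam (v n) * A.gam (v' n) * ((a * b)\<^sup>2 * (B.gam (u n) * B.gam (u' n)))"
        using B.norm_cov_sq_le[OF p(2) p'(2)] A.gam_nonneg by (intro mult_left_mono) auto
      also have "\<dots> = (a * b * A.gam (v n) * B.gam (u n)) * (a * b * A.gam (v' n) * B.gam (u' n))"
        by (simp add: power2_eq_square)
      also have "\<dots> \<le> (cmod (z n))\<^sup>2 * (cmod (z' n))\<^sup>2"
        using sol_gam_less[OF s, of n] sol_gam_less[OF s', of n] a_pos b_pos
        by (intro mult_mono) (auto intro!: mult_nonneg_nonneg A.gam_nonneg B.gam_nonneg)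
      finally show ?case
        unfolding F_def using elim a_pos b_pos by (subst pos_le_divide_eq) auto
    qed
  qed
  then show ?thesis
    using A.cov_equality_case[of v v' V V' e] p p' l l' cov1 assms(5) by blast
qed

text \<open>With the denominator cleared, the equation passes to the limit even where
  \<open>1 + V t0\<close> vanishes.\<close>

lemma sol_limit_two_point_eq:
  assumes "\<And>w. 0 < Im w \<Longrightarrow> A.stj w * (1 + w * of_real t0) = of_real P" "sol_limit x U V"
  shows "- (x * U) * (1 + V * of_real t0) = of_real (a * P)"
proof -
  obtain z u v where s: "\<And>n. sol (z n) (u n) (v n)" and l: "z \<longlonglongrightarrow> x" "u \<longlonglongrightarrow> U" "v \<longlonglongrightarrow> V"
    using assms(2) unfolding sol_limit_def by blast
  have "- (z n * u n) * (1 + v n * of_real t0) = of_real (a * P)" for n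
    unfolding sol_eqs(1)[OF s] using assms(1)[OF sol_pos(3)[OF s], of n] by (simp add: mult.assoc)
  moreover have "(\<lambda>n. - (z n * u n) * (1 + v n * of_real t0)) \<longlonglongrightarrow> - (x * U) * (1 + V * of_real t0)"
    by (intro tendsto_intros l)
  ultimately show ?thesis using LIMSEQ_unique[OF _ tendsto_const] by simp
qed

text \<open>In the two-point case the first coordinate of a limit is a root of a fixed quadratic polynomial.\<close>

lemma sol_limit_at_most_two:
  assumes X2: "AE t in M. X t = 0 \<or> X t = t0" "0 < t0" and Y2: "AE t in N. Y t = 0 \<or> Y t = s0" "0 < s0"
    and x: "x \<noteq> 0"
    and lim: "sol_limit x U V" "sol_limit x U' V'" "sol_limit x U'' V''"
    and ne: "U \<noteq> U'" "U \<noteq> U''"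
  shows "U' = U''"
proof -
  interpret sw: rv_pair N Y M X b a by (rule rv_pair_swap)
  obtain P where P: "\<And>w. 0 < Im w \<Longrightarrow> A.stj w * (1 + w * of_real t0) = of_real P"
    using A.stj_two_point[OF X2] by blast
  obtain Q where Q: "\<And>w. 0 < Im w \<Longrightarrow> B.stj w * (1 + w * of_real s0) = of_real Q"
    using B.stj_two_point[OF Y2] by blast
  have e1: "- (x * U) * (1 + V * of_real t0) = of_real (a * P)" if "sol_limit x U V" for U V
    using sol_limit_two_point_eq[OF P that] .
  have e2: "- (x * V) * (1 + U * of_real s0) = of_real (b * Q)" if "sol_limit x U V" for U V
    using sw.sol_limit_two_point_eq[OF Q] that sol_limit_swap by blast
  \<comment> \<open>A Vieta relation. Eliminating the product terms gives
    \<open>(U - U') s0 = (V - V') t0\<close>; then \<open>U - U'\<close> factors out of the first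
    equation. The relation determines \<open>U'\<close> from \<open>V\<close>.\<close>
  have key: "1 + V * of_real t0 + U' * of_real s0 = 0"
    if L: "sol_limit x U V" "sol_limit x U' V'" "U \<noteq> U'" for U V U' V'
  proof -
    have "x * ((U - U') * of_real s0) = x * ((V - V') * of_real t0)"
    proof -
      have "- (x * U) * (1 + V * of_real t0) * of_real s0 - (- (x * V) * (1 + U * of_real s0)) * of_real t0
        = - (x * U') * (1 + V' * of_real t0) * of_real s0 - (- (x * V') * (1 + U' * of_real s0)) * of_real t0"
        unfolding e1[OF L(1)] e1[OF L(2)] e2[OF L(1)] e2[OF L(2)] ..
      then show ?thesis by (simp add: algebra_simps)
    qed
    then have d: "(U - U') * of_real s0 = (V - V') * of_real t0" using x by simp
    have "x * (U * (1 + V * of_real t0)) = x * (U' * (1 + V' * of_real t0))"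
      using e1[OF L(1)] e1[OF L(2)] by (simp only: mult.assoc mult_minus_left[symmetric]) (metis minus_mult_left neg_equal_iff_equal)
    then have "U * (1 + V * of_real t0) = U' * (1 + V' * of_real t0)" using x by simp
    then have "(U - U') * (1 + V * of_real t0) + U' * ((V - V') * of_real t0) = 0"
      by (simp add: algebra_simps)
    then have "(U - U') * (1 + V * of_real t0 + U' * of_real s0) = 0"
      unfolding d[symmetric] by (simp add: algebra_simps)
    then show ?thesis using L(3) by simp
  qed
  have "U' * of_real s0 = U'' * of_real s0"
    using key[OF lim(1,2) ne(1)] key[OF lim(1,3) ne(2)] by (metis add_left_cancel)
  then show ?thesis using Y2(2) by simp
qed

section \<open>The solution map and the uniqueness of its cluster points\<close>

definition "sol_fst z = fst (SOME p. sol z (fst p) (snd p))"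
definition "sol_snd z = snd (SOME p. sol z (fst p) (snd p))"

lemma sol_sol_fst_snd: "0 < Im z \<Longrightarrow> sol z (sol_fst z) (sol_snd z)"
  unfolding sol_fst_def sol_snd_def using exists_sol[of z] by (metis (mono_tags, lifting) fst_conv snd_conv someI_ex)

lemma sol_eq_sol_fst_snd:
  assumes "sol z u v" shows "u = sol_fst z" "v = sol_snd z"
  using sol_unique[OF assms sol_sol_fst_snd] sol_pos(1)[OF assms] by auto

lemma sol_limit_subseq:
  assumes "\<And>n. 0 < Im (z n)" "z \<longlonglongrightarrow> x" "x \<noteq> 0"
  shows "\<exists>r U V. strict_mono (r :: nat \<Rightarrow> nat) \<and> (\<lambda>n. sol_fst (z (r n))) \<longlonglongrightarrow> U \<and>
    (\<lambda>n. sol_snd (z (r n))) \<longlonglongrightarrow> V \<and> sol_limit x U V"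
proof -
  have s: "sol (z n) (sol_fst (z n)) (sol_snd (z n))" for n
    using assms(1) by (rule sol_sol_fst_snd)
  interpret q: sol_seq M X N Y a b "\<lambda>_. X" "\<lambda>_. Y" z "\<lambda>n. sol_fst (z n)" "\<lambda>n. sol_snd (z n)" x
    by (rule sol_seq_const[OF s assms(2,3)])
  obtain r U V where r: "strict_mono (r :: nat \<Rightarrow> nat)"
    and l: "(\<lambda>n. sol_fst (z (r n))) \<longlonglongrightarrow> U" "(\<lambda>n. sol_snd (z (r n))) \<longlonglongrightarrow> V"
    using q.exists_convergent_subseq by (elim exE conjE) (rule that)
  have "(\<lambda>n. z (r n)) \<longlonglongrightarrow> x"
    by (rule filterlim_compose[OF assms(2) filterlim_subseq[OF r]])
  then have "sol_limit x U V"
    unfolding sol_limit_def using s l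
    by (intro exI[of _ "\<lambda>n. z (r n)"] exI[of _ "\<lambda>n. sol_fst (z (r n))"] exI[of _ "\<lambda>n. sol_snd (z (r n))"]) auto
  with r l show ?thesis by blast
qed

text \<open>Compactness: values along any sequence tending to \<open>x\<close> have a convergent
  subsequence, and its limit is the only cluster point. A vertical approach to \<open>x\<close>
  shows that one exists.\<close>

lemma tendsto_if_sol_limit_unique:
  assumes x: "x \<noteq> 0" "0 \<le> Im x"
    and unique: "\<And>U V U' V'. sol_limit x U V \<Longrightarrow> sol_limit x U' V' \<Longrightarrow> U = U' \<and> V = V'"
  shows "\<exists>U V. sol_limit x U V \<and> (sol_fst \<longlongrightarrow> U) (at x within {z. 0 < Im z}) \<and>
    (sol_snd \<longlongrightarrow> V) (at x within {z. 0 < Im z})"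
proof -
  have "(\<lambda>n. x + \<i> * of_real (1 / real (Suc n))) \<longlonglongrightarrow> x + \<i> * of_real 0"
    by (intro tendsto_intros LIMSEQ_Suc lim_1_over_n)
  then obtain U V where UV: "sol_limit x U V"
    using sol_limit_subseq[of "\<lambda>n. x + \<i> * of_real (1 / real (Suc n))" x] x by (auto simp: add_nonneg_pos)
  have "((\<lambda>z. (sol_fst z, sol_snd z)) \<longlongrightarrow> (U, V)) (at x within {z. 0 < Im z})"
  proof (rule ccontr)
    assume "\<not> ?thesis"
    then obtain e where e: "0 < e"
      "\<not> (\<forall>\<^sub>F z in at x within {z. 0 < Im z}. dist (sol_fst z, sol_snd z) (U, V) < e)"
      unfolding tendsto_iff by blast
    then have "\<exists>z. 0 < Im z \<and> dist z x < 1 / real (Suc n) \<and> e \<le> dist (sol_fst z, sol_snd z) (U, V)" for n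
      unfolding eventually_at by (metis (mono_tags, lifting) mem_Collect_eq not_less of_nat_0_less_iff zero_less_Suc zero_less_divide_1_iff)
    then obtain z where z: "\<And>n. 0 < Im (z n)" "\<And>n. dist (z n) x < 1 / real (Suc n)"
      "\<And>n. e \<le> dist (sol_fst (z n), sol_snd (z n)) (U, V)" by metis
    have "z \<longlonglongrightarrow> x"
    proof (rule iffD2[OF tendsto_dist_iff])
      show "(\<lambda>n. dist (z n) x) \<longlonglongrightarrow> 0"
        by (rule tendsto_sandwich[OF _ _ tendsto_const LIMSEQ_Suc[OF lim_1_over_n]])
           (use z(2) in \<open>auto intro!: always_eventually less_imp_le simp del: of_nat_Suc\<close>)
    qed
    then obtain r U' V' where r: "strict_mono (r :: nat \<Rightarrow> nat)" and l: "(\<lambda>n. sol_fst (z (r n))) \<longlonglongrightarrow> U'"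
      "(\<lambda>n. sol_snd (z (r n))) \<longlonglongrightarrow> V'" "sol_limit x U' V'"
      using sol_limit_subseq[of z x] z(1) x(1) by blast
    have "U' = U" "V' = V" using unique[OF l(3) UV] by auto
    then have "(\<lambda>n. dist (sol_fst (z (r n)), sol_snd (z (r n))) (U, V)) \<longlonglongrightarrow> dist (U, V) (U, V)"
      using l by (intro tendsto_intros) auto
    then have "e \<le> dist (U, V) (U, V)"
      by (rule LIMSEQ_le_const) (use z(3) in auto)
    then show False using e by simp
  qed
  from tendsto_fst[OF this] tendsto_snd[OF this] UV show ?thesis by auto
qed

text \<open>At an interior point every cluster point is a solution, hence unique.\<close>

lemma sol_fst_continuous_on: "continuous_on {z. 0 < Im z} sol_fst"
  unfolding continuous_on_def
proof
  fix x assume "x \<in> {z. 0 < Im z}"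
  then have x: "0 < Im x" "x \<noteq> 0" by auto
  have "U = sol_fst x \<and> V = sol_snd x" if "sol_limit x U V" for U V
    using sol_eq_sol_fst_snd[OF sol_limit_sol[OF that x(1)]] by simp
  then show "(sol_fst \<longlongrightarrow> sol_fst x) (at x within {z. 0 < Im z})"
    using tendsto_if_sol_limit_unique[OF x(2)] x(1) by (metis less_imp_le)
qed

text \<open>The cluster set of a continuous function at a boundary point of a half plane is connected.\<close>

lemma sol_limit_between:
  assumes "sol_limit x U V" "sol_limit x U' V'" "x \<noteq> 0" "U \<noteq> U'"
  shows "\<exists>U'' V''. sol_limit x U'' V'' \<and> cmod (U'' - U) = cmod (U' - U) / 2"
proof -
  define d where "d = cmod (U' - U) / 2"
  have "0 < d" using assms(4) by (simp add: d_def)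
  have "\<exists>z. 0 < Im z \<and> dist z x < 1 / real (Suc n) \<and> cmod (sol_fst z - U) = d" for n
  proof -
    \<comment> \<open>Convex, hence connected. On it \<open>g\<close> comes within \<open>d\<close>
      of 0 and within \<open>d\<close> of \<open>2 d\<close>, so it attains
      \<open>d\<close>.\<close>
    define S where "S = {z. 0 < Im z} \<inter> ball x (1 / real (Suc n))"
    define g where "g z = cmod (sol_fst z - U)" for z
    have "connected S"
      unfolding S_def by (intro convex_connected convex_Int convex_halfspace_Im_gt convex_ball)
    moreover have "continuous_on S g"
      unfolding g_def S_def by (intro continuous_intros continuous_on_subset[OF sol_fst_continuous_on]) auto
    ultimately have conn: "connected (g ` S)" by (rule connected_continuous_image[rotated])
    have *: "\<exists>z\<in>S. \<bar>g z - cmod (W - U)\<bar> < d" if "sol_limit x W W'" for W W'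
    proof -
      obtain z u v where s: "\<And>n. sol (z n) (u n) (v n)" and l: "z \<longlonglongrightarrow> x" "u \<longlonglongrightarrow> W"
        using \<open>sol_limit x W W'\<close> unfolding sol_limit_def by blast
      have "(\<lambda>n. cmod (u n - U)) \<longlonglongrightarrow> cmod (W - U)" by (intro tendsto_intros l)
      then have "\<forall>\<^sub>F n in sequentially. dist (cmod (u n - U)) (cmod (W - U)) < d"
        using \<open>0 < d\<close> by (rule tendstoD)
      moreover have "\<forall>\<^sub>F k in sequentially. dist (z k) x < 1 / real (Suc n)"
        using l(1) by (rule tendstoD) simp
      ultimately have "\<forall>\<^sub>F k in sequentially. dist (cmod (u k - U)) (cmod (W - U)) < d \<and> dist (z k) x < 1 / real (Suc n)"
        by (rule eventually_conj)
      then obtain k where k: "dist (cmod (u k - U)) (cmod (W - U)) < d" "dist (z k) x < 1 / real (Suc n)"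
        unfolding eventually_sequentially by blast
      have "z k \<in> S" using k(2) sol_pos(1)[OF s] by (simp add: S_def dist_commute)
      moreover have "\<bar>g (z k) - cmod (W - U)\<bar> < d"
        using k(1) sol_eq_sol_fst_snd(1)[OF s, of k] by (simp add: g_def dist_real_def)
      ultimately show ?thesis by blast
    qed
    obtain z1 where z1: "z1 \<in> S" "g z1 < d" using *[OF assms(1)] by auto
    obtain z2 where z2: "z2 \<in> S" "\<bar>g z2 - cmod (U' - U)\<bar> < d" using *[OF assms(2)] by blast
    moreover have "cmod (U' - U) = 2 * d" by (simp add: d_def)
    ultimately have "d < g z2" by linarith
    have "d \<in> g ` S"
      by (rule connectedD_interval[OF conn imageI[OF z1(1)] imageI[OF z2(1)]]) (use z1 \<open>d < g z2\<close> in auto)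
    then show ?thesis by (auto simp: S_def g_def dist_commute)
  qed
  then obtain z where z: "\<And>n. 0 < Im (z n)" "\<And>n. dist (z n) x < 1 / real (Suc n)"
    "\<And>n. cmod (sol_fst (z n) - U) = d" by metis
  have "z \<longlonglongrightarrow> x"
  proof (rule iffD2[OF tendsto_dist_iff])
    show "(\<lambda>n. dist (z n) x) \<longlonglongrightarrow> 0"
      by (rule tendsto_sandwich[OF _ _ tendsto_const LIMSEQ_Suc[OF lim_1_over_n]])
         (use z(2) in \<open>auto intro!: always_eventually less_imp_le simp del: of_nat_Suc\<close>)
  qed
  then obtain r U'' V'' where l: "(\<lambda>n. sol_fst (z (r n))) \<longlonglongrightarrow> U''" "sol_limit x U'' V''"
    using sol_limit_subseq[of z x] z(1) assms(3) by blast
  have "(\<lambda>n. cmod (sol_fst (z (r n)) - U)) \<longlonglongrightarrow> cmod (U'' - U)"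
    by (intro tendsto_intros l)
  then have "cmod (U'' - U) = d" unfolding z(3) using LIMSEQ_unique[OF tendsto_const] by blast
  then show ?thesis using l(2) d_def by blast
qed

theorem sol_limit_unique:
  assumes "x \<noteq> 0" "sol_limit x U V" "sol_limit x U' V'"
  shows "U = U' \<and> V = V'"
proof (rule ccontr)
  interpret sw: rv_pair N Y M X b a by (rule rv_pair_swap)
  assume neg: "\<not> (U = U' \<and> V = V')"
  have V: "V = V'" if "U = U'"
    using sw.sol_limit_eq_if_snd_eq[of x V U V'] that assms sol_limit_swap by blast
  have U: "U = U'" if "V = V'"
    using sol_limit_eq_if_snd_eq[of x U V U'] that assms by blast
  have ne: "U \<noteq> U'" "V \<noteq> V'" using neg U V by auto
  obtain t0 where t0: "0 < t0" "AE t in M. X t = 0 \<or> X t = t0"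
    using sol_limit_two_point[OF assms(2,3,1) ne] by blast
  have "sw.sol_limit x V U" "sw.sol_limit x V' U'" using assms sol_limit_swap by blast+
  then obtain s0 where s0: "0 < s0" "AE t in N. Y t = 0 \<or> Y t = s0"
    using sw.sol_limit_two_point[OF _ _ assms(1) ne(2) ne(1)] by blast
  obtain U'' V'' where U'': "sol_limit x U'' V''" "cmod (U'' - U) = cmod (U' - U) / 2"
    using sol_limit_between[OF assms(2,3,1) ne(1)] by blast
  \<comment> \<open>Lying at half the distance, \<open>U''\<close> differs from both
    \<open>U\<close> and \<open>U'\<close>, one root too many.\<close>
  then have "U \<noteq> U''" using ne(1) by auto
  then have "U' = U''"
    by (rule sol_limit_at_most_two[OF t0(2,1) s0(2,1) assms(1) assms(2,3) U''(1) ne(1)])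
  then show False using U''(2) ne(1) by auto
qed

lemma sol_limit_exists:
  assumes "x \<noteq> 0" "0 \<le> Im x"
  shows "\<exists>U V. sol_limit x U V \<and> (sol_fst \<longlongrightarrow> U) (at x within {z. 0 < Im z}) \<and>
    (sol_snd \<longlongrightarrow> V) (at x within {z. 0 < Im z})"
  using tendsto_if_sol_limit_unique[OF assms] sol_limit_unique[OF assms(1)] by blast

text \<open>Since \<open>gam (v n) <= C\<close>, \<open>Im (z u) = a Im v gam v\<close> gives
  \<open>|x| Im U <= a C Im V\<close> in the limit; the modulus covers either sign of
  \<open>x\<close>.\<close>

lemma sol_limit_real_Im_pos:
  assumes "sol_limit (of_real x) U V" "x \<noteq> 0" "0 < Im U"
  shows "0 < Im V"
proof -
  obtain z u v where s: "\<And>n. sol (z n) (u n) (v n)" and l: "z \<longlonglongrightarrow> of_real x" "u \<longlonglongrightarrow> U" "v \<longlonglongrightarrow> V"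
    using assms(1) unfolding sol_limit_def by blast
  obtain C where C: "0 < C" "\<And>n. A.gam (v n) \<le> C" using gam_upper_bound[OF s l(1,2)] by blast
  have "\<bar>Im (z n * u n)\<bar> \<le> a * C * Im (v n)" for n
  proof -
    have "Im (z n * u n) = a * Im (v n) * A.gam (v n)"
      using Im_mult_fst[OF sol_eqs(1)[OF s] sol_pos(3)[OF s]] .
    then have "\<bar>Im (z n * u n)\<bar> = a * Im (v n) * A.gam (v n)"
      using a_pos sol_pos(3)[OF s, of n] A.gam_nonneg[of "v n"] by simp
    also have "\<dots> \<le> a * Im (v n) * C"
      using a_pos sol_pos(3)[OF s, of n] C(2) by (intro mult_left_mono) auto
    finally show ?thesis by (simp only: mult_ac)
  qed
  then have "\<bar>Im (of_real x * U)\<bar> \<le> a * C * Im V"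
    by (intro LIMSEQ_le[OF tendsto_rabs[OF tendsto_Im[OF tendsto_mult[OF l(1,2)]]]
          tendsto_mult[OF tendsto_const tendsto_Im[OF l(3)]]]) auto
  moreover have "0 < \<bar>Im (of_real x * U)\<bar>" using assms by simp
  ultimately have "0 < a * C * Im V" by linarith
  then show ?thesis using mult_pos_pos[OF a_pos C(1)] by (simp only: zero_less_mult_pos)
qed

end

section \<open>Holomorphic continuation across the real axis\<close>

text \<open>Stated with an exact difference quotient \<open>K\<close> in the unknown, as
  \<open>cov\<close> supplies it; \<open>K x d d\<close> is the partial derivative. Banach's theorem
  gives the zero, while \<open>K\<close> being nonzero nearby gives uniqueness and the derivative of
  \<open>W\<close>.\<close>

lemma holomorphic_implicit_function:
  fixes H :: "complex \<Rightarrow> complex \<Rightarrow> complex" and K :: "complex \<Rightarrow> complex \<Rightarrow> complex \<Rightarrow> complex"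
  assumes r: "0 < r"
    and quot: "\<And>z w w'. \<lbrakk>z \<in> ball x r; w \<in> ball d r; w' \<in> ball d r\<rbrakk> \<Longrightarrow> H z w - H z w' = (w - w') * K z w w'"
    and K_cont: "continuous_on (ball x r \<times> ball d r \<times> ball d r) (\<lambda>(z, w, w'). K z w w')"
    and K_nz: "K x d d \<noteq> 0" and H_0: "H x d = 0"
    and H_hol: "\<And>w. w \<in> ball d r \<Longrightarrow> (\<lambda>z. H z w) holomorphic_on ball x r"
  obtains e s W where "0 < e" "e \<le> r" "0 < s" "W holomorphic_on ball x e"
    "\<And>z. z \<in> ball x e \<Longrightarrow> W z \<in> ball d r"
    "\<And>z w. z \<in> ball x e \<Longrightarrow> w \<in> ball d s \<Longrightarrow> H z w = 0 \<Longrightarrow> w = W z"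
proof -
  define k where "k = K x d d"
  have k: "k \<noteq> 0" using K_nz by (simp add: k_def)
  let ?D = "ball x r \<times> ball d r \<times> ball d r"
  have "open ?D" by (intro open_Times open_ball)
  have isK: "isCont (\<lambda>(z, w, w'). K z w w') p" if "p \<in> ?D" for p
    using K_cont that continuous_on_eq_continuous_at[OF \<open>open ?D\<close>] by blast
  have "isCont (\<lambda>(z, w, w'). K z w w') (x, d, d)" using r by (intro isK) auto
  then obtain \<delta> where \<delta>: "0 < \<delta>"
    "\<And>p. dist p (x, d, d) < \<delta> \<Longrightarrow> dist ((\<lambda>(z, w, w'). K z w w') p) k < cmod k / 2"
    using k unfolding continuous_at_eps_delta k_def by (metis (no_types, lifting) case_prod_conv zero_less_norm_iff half_gt_zero)
  \<comment> \<open>One third of the radius for each of the three coordinates.\<close>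
  define s where "s = min r (\<delta> / 3)"
  have s: "0 < s" "s \<le> r" using r \<delta>(1) by (auto simp: s_def)
  have K_near: "cmod (K z w w' - k) < cmod k / 2" if "z \<in> ball x s" "w \<in> ball d s" "w' \<in> ball d s" for z w w'
  proof -
    have "dist (z, w, w') (x, d, d) \<le> norm (z - x) + norm ((w, w') - (d, d))"
      unfolding dist_norm using norm_Pair_le[of "z - x" "(w, w') - (d, d)"] by simp
    also have "\<dots> \<le> norm (z - x) + (norm (w - d) + norm (w' - d))"
      using norm_Pair_le[of "w - d" "w' - d"] by simp
    also have "\<dots> < \<delta>" using that by (simp add: s_def dist_norm norm_minus_commute)
    finally show ?thesis using \<delta>(2)[of "(z, w, w')"] by (simp add: dist_norm)
  qed
  have K_ge: "cmod k / 2 \<le> cmod (K z w w')" if "z \<in> ball x s" "w \<in> ball d s" "w' \<in> ball d s" for z w w'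
    using K_near[OF that] norm_triangle_ineq3[of "K z w w'" k] by linarith
  define t where "t = s / 2"
  have t: "0 < t" "cball d t \<subseteq> ball d s" using s by (auto simp: t_def)
  have H_isCont: "isCont (\<lambda>z. H z w) z" if "w \<in> ball d r" "z \<in> ball x r" for w z
    using holomorphic_on_imp_continuous_on[OF H_hol[OF that(1)]] that(2) continuous_on_eq_continuous_at[OF open_ball] by blast
  obtain e0 where e0: "0 < e0" "\<And>z. dist z x < e0 \<Longrightarrow> cmod (H z d) < cmod k * t / 2"
  proof -
    have "isCont (\<lambda>z. H z d) x" using r by (intro H_isCont) auto
    then have "\<exists>e0>0. \<forall>z. dist z x < e0 \<longrightarrow> dist (H z d) (H x d) < cmod k * t / 2"
      unfolding continuous_at_eps_delta using k t by (metis half_gt_zero mult_pos_pos zero_less_norm_iff)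
    then show ?thesis using that H_0 by (auto simp: dist_norm)
  qed
  define e where "e = min e0 s"
  have e: "0 < e" "e \<le> s" using e0 s by (auto simp: e_def)
  have sub: "ball x e \<subseteq> ball x s" "ball x s \<subseteq> ball x r" "ball d s \<subseteq> ball d r" using e s by auto
  have "\<exists>w\<in>cball d t. H z w = 0" if z: "z \<in> ball x e" for z
  proof -
    \<comment> \<open>Newton's map with the slope frozen at \<open>k\<close>. It contracts by one
      half because \<open>K\<close> is within \<open>|k| / 2\<close> of \<open>k\<close>, and
      \<open>e0\<close> limits the displacement of the centre to \<open>t / 2\<close>.\<close>
    define T where "T w = w - H z w / k" for w
    have zs: "z \<in> ball x s" using z sub by auto
    have lip: "dist (T w) (T w') \<le> 1 / 2 * dist w w'" if w: "w \<in> cball d t" "w' \<in> cball d t" for w w'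
    proof -
      have ws: "w \<in> ball d s" "w' \<in> ball d s" using w t by auto
      have "T w - T w' = (w - w') - (H z w - H z w') / k"
        by (simp add: T_def diff_divide_distrib)
      also have "H z w - H z w' = (w - w') * K z w w'" using zs ws sub by (intro quot) auto
      also have "(w - w') - (w - w') * K z w w' / k = (w - w') * ((k - K z w w') / k)"
        using k by (simp add: field_simps)
      finally have "cmod (T w - T w') = cmod (w - w') * (cmod (K z w w' - k) / cmod k)"
        by (simp add: norm_mult norm_divide norm_minus_commute)
      also have "\<dots> \<le> cmod (w - w') * (1 / 2)"
        using K_near[OF zs ws] k by (intro mult_left_mono) (auto simp: field_simps)
      finally show ?thesis by (simp add: dist_norm)
    qed
    have Td: "dist (T d) d \<le> t / 2"
    proof -
      have "dist (T d) d = cmod (H z d) / cmod k" by (simp add: T_def dist_norm norm_divide)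
      also have "\<dots> \<le> (cmod k * t / 2) / cmod k"
        using e0(2)[of z] z by (intro divide_right_mono) (auto simp: e_def dist_commute)
      finally show ?thesis using k by simp
    qed
    have "T ` cball d t \<subseteq> cball d t"
    proof (rule image_subsetI)
      fix w assume w: "w \<in> cball d t"
      have "dist (T w) d \<le> dist (T w) (T d) + dist (T d) d" by (rule dist_triangle)
      also have "\<dots> \<le> 1 / 2 * dist w d + t / 2" using lip[OF w] Td t by (intro add_mono) auto
      also have "\<dots> \<le> t" using w by (simp add: dist_commute)
      finally show "T w \<in> cball d t" by (simp add: dist_commute)
    qed
    then have "\<exists>!w\<in>cball d t. T w = w"
      using t lip by (intro Banach_fix[of _ "1 / 2"]) (auto simp: complete_eq_closed)
    then obtain w where "w \<in> cball d t" "T w = w" by blast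
    then show ?thesis using k by (intro bexI[of _ w]) (auto simp: T_def)
  qed
  then obtain W where W: "\<And>z. z \<in> ball x e \<Longrightarrow> W z \<in> cball d t \<and> H z (W z) = 0" by metis
  have W_s: "W z \<in> ball d s" if "z \<in> ball x e" for z using W[OF that] t by auto
  have unique: "w = W z" if "z \<in> ball x e" "w \<in> ball d s" "H z w = 0" for z w
  proof -
    have "(w - W z) * K z w (W z) = H z w - H z (W z)"
      using that W_s[OF that(1)] sub by (intro quot[symmetric]) blast+
    then have "(w - W z) * K z w (W z) = 0" using W that by simp
    moreover have "K z w (W z) \<noteq> 0"
      using K_ge[of z w "W z"] that W_s[OF that(1)] sub k by force
    ultimately show ?thesis by simp
  qed
  have W_quot: "(W z - W y) * K z (W z) (W y) = - (H z (W y) - H y (W y))" if "z \<in> ball x e" "y \<in> ball x e" for z y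
  proof -
    have "(W z - W y) * K z (W z) (W y) = H z (W z) - H z (W y)"
      using that W_s sub by (intro quot[symmetric]) blast+
    then show ?thesis using W that by simp
  qed
  have "(W has_field_derivative - deriv (\<lambda>z. H z (W y)) y / K y (W y) (W y)) (at y)" if y: "y \<in> ball x e" for y
  proof -
    have Wy: "W y \<in> ball d r" using W_s[OF y] sub by blast
    have y_r: "y \<in> ball x r" using y sub by blast
    have ev: "\<forall>\<^sub>F z in at y. z \<in> ball x e" using y by (intro eventually_at_in_open') auto
    have dH: "((\<lambda>z. H z (W y)) has_field_derivative deriv (\<lambda>z. H z (W y)) y) (at y)"
      by (rule holomorphic_derivI[OF H_hol[OF Wy] open_ball]) (use y sub in blast)
    have W_cont: "(W \<longlongrightarrow> W y) (at y)"
    proof (rule LIM_zero_cancel)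
      show "((\<lambda>z. W z - W y) \<longlongrightarrow> 0) (at y)"
      proof (rule Lim_null_comparison)
        show "\<forall>\<^sub>F z in at y. norm (W z - W y) \<le> cmod (H z (W y) - H y (W y)) * (2 / cmod k)"
          using ev
        proof eventually_elim
          case (elim z)
          have "cmod (W z - W y) * (cmod k / 2) \<le> cmod (W z - W y) * cmod (K z (W z) (W y))"
            by (rule mult_left_mono[OF K_ge[OF subsetD[OF sub(1) elim] W_s[OF elim] W_s[OF y]] norm_ge_zero])
          also have "\<dots> = cmod (H z (W y) - H y (W y))"
            unfolding norm_mult[symmetric] W_quot[OF elim y] by (rule norm_minus_cancel)
          finally show ?case using k by (simp add: field_simps)
        qed
        have "((\<lambda>z. cmod (H z (W y) - H y (W y)) * (2 / cmod k)) \<longlongrightarrow> cmod (H y (W y) - H y (W y)) * (2 / cmod k)) (at y)"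
          using H_isCont[OF Wy y_r] unfolding isCont_def by (intro tendsto_intros) auto
        then show "((\<lambda>z. cmod (H z (W y) - H y (W y)) * (2 / cmod k)) \<longlongrightarrow> 0) (at y)" by simp
      qed
    qed
    have K_lim: "((\<lambda>z. K z (W z) (W y)) \<longlongrightarrow> K y (W y) (W y)) (at y)"
    proof -
      have "isCont (\<lambda>(z, w, w'). K z w w') (y, W y, W y)"
        using y_r Wy by (intro isK) auto
      moreover have "((\<lambda>z. (z, W z, W y)) \<longlongrightarrow> (y, W y, W y)) (at y)"
        by (intro tendsto_intros W_cont)
      ultimately show ?thesis using isCont_tendsto_compose by fastforce
    qed
    have K_y: "K y (W y) (W y) \<noteq> 0" using K_ge[of y "W y" "W y"] y W_s sub k by force
    show ?thesis
      unfolding has_field_derivative_iff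
    proof (rule Lim_transform_eventually)
      show "((\<lambda>z. - ((H z (W y) - H y (W y)) / (z - y)) / K z (W z) (W y)) \<longlongrightarrow>
          - deriv (\<lambda>z. H z (W y)) y / K y (W y) (W y)) (at y)"
        using dH K_lim K_y unfolding has_field_derivative_iff by (intro tendsto_intros) auto
      show "\<forall>\<^sub>F z in at y. - ((H z (W y) - H y (W y)) / (z - y)) / K z (W z) (W y) = (W z - W y) / (z - y)"
        using ev
      proof eventually_elim
        case (elim z)
        have "K z (W z) (W y) \<noteq> 0" using K_ge[of z "W z" "W y"] elim y W_s sub k by force
        then show ?case using W_quot[OF elim y]
          by (metis (no_types, lifting) minus_divide_left nonzero_mult_div_cancel_right divide_divide_eq_left' mult.commute divide_divide_eq_left)
      qed
    qed
  qed
  then have "W holomorphic_on ball x e"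
    unfolding holomorphic_on_def field_differentiable_def by (blast intro: has_field_derivative_at_within)
  then show ?thesis
    using that[of e s W] e s unique W_s sub by (meson order_trans subsetD)
qed

section \<open>Nonvanishing of the derivative at a real point\<close>

context pos_rv
begin

text \<open>Integrate \<open>2 (Im g)^2 = |g|^2 - Re (g^2)\<close> for
  \<open>g = k * kern w\<close>: the hypothesis makes the right-hand side 0.\<close>

lemma Im_kern_eq_0_AE:
  assumes w: "0 < Im w" and eq: "k\<^sup>2 * cov w w = of_real (gam w)" and k: "cmod k = 1"
  shows "AE t in M. Im (k * kern w (X t)) = 0"
proof -
  have i1: "integrable M (\<lambda>t. k\<^sup>2 * (kern w (X t) * kern w (X t)))"
    using integrable_kern_mult[OF w w] by simp
  have id: "2 * (Im g)\<^sup>2 = (cmod g)\<^sup>2 - Re (g * g)" for g :: complex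
    unfolding cmod_power2 by (simp add: power2_eq_square)
  have eq2: "2 * (Im (k * kern w (X t)))\<^sup>2 = (cmod (kern w (X t)))\<^sup>2 - Re (k\<^sup>2 * (kern w (X t) * kern w (X t)))" for t
  proof -
    have "(k * kern w (X t)) * (k * kern w (X t)) = k\<^sup>2 * (kern w (X t) * kern w (X t))"
      by (simp add: power2_eq_square)
    then show ?thesis using id[of "k * kern w (X t)"] by (simp only: norm_mult k mult_1)
  qed
  have i2: "integrable M (\<lambda>t. 2 * (Im (k * kern w (X t)))\<^sup>2)"
    unfolding eq2 using integrable_kern_sq[OF w] integrable_Re[OF i1] by (rule Bochner_Integration.integrable_diff)
  have "(\<integral>t. 2 * (Im (k * kern w (X t)))\<^sup>2 \<partial>M) = gam w - Re (k\<^sup>2 * cov w w)"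
    unfolding eq2 gam_def cov_def integral_mult_right_zero[symmetric]
    using integrable_kern_sq[OF w] integrable_Re[OF i1] integral_Re[OF i1]
    by (subst Bochner_Integration.integral_diff) auto
  also have "\<dots> = 0" unfolding eq by simp
  finally have "AE t in M. 2 * (Im (k * kern w (X t)))\<^sup>2 = 0"
    using integral_nonneg_eq_0_iff_AE[OF i2] by simp
  then show ?thesis by eventually_elim simp
qed

text \<open>In \<open>kern_decomp\<close> the second term times \<open>w\<close> is real. Hence the
  product is real only at \<open>x = 0\<close>, which yields the final contradiction of
  \<open>derivative_nonzero\<close>.\<close>

lemma Im_mult_kern:
  assumes "0 < Im w"
  shows "Im (w * kern w x) = Im w * (x / (cmod (1 + w * of_real x))\<^sup>2)"
proof -
  let ?\<alpha> = "x / (cmod (1 + w * of_real x))\<^sup>2"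
  have "w * kern w x = w * of_real ?\<alpha> + (w * cnj w) * of_real ((cmod (kern w x))\<^sup>2)"
    by (subst kern_decomp[OF assms]) (simp only: ring_distribs mult.assoc)
  also have "\<dots> = w * of_real ?\<alpha> + of_real ((cmod w)\<^sup>2 * (cmod (kern w x))\<^sup>2)"
    unfolding complex_norm_square[symmetric] by simp
  finally show ?thesis by (simp del: of_real_divide of_real_power of_real_mult)
qed

end

context rv_pair
begin

text \<open>At a real point the contraction estimate degenerates to the equality \<open>x\<^sup>2 = a b \<gamma> \<gamma>'\<close>, so a
  vanishing derivative would force equality in \<open>\<bar>\<integral> f\<^sup>2\<bar> \<le> \<integral> \<bar>f\<bar>\<^sup>2\<close> for both kernels.\<close>

lemma derivative_nonzero:
  assumes x: "x \<noteq> 0" and im: "0 < Im U" "0 < Im V"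
    and eq: "- (of_real x * U) = of_real a * A.stj V" "- (of_real x * V) = of_real b * B.stj U"
  shows "of_real (a * b) * A.cov V V * B.cov U U \<noteq> of_real (x\<^sup>2)"
proof
  assume deg: "of_real (a * b) * A.cov V V * B.cov U U = of_real (x\<^sup>2)"
  have ab: "0 < a * b" using a_pos b_pos by simp
  have e1: "x * Im U = a * Im V * A.gam V" using Im_mult_fst[OF eq(1) im(2)] by simp
  have e2: "x * Im V = b * Im U * B.gam U" using Im_mult_snd[OF eq(2) im(1)] by simp
  have "(x * Im U) * (x * Im V) = (a * Im V * A.gam V) * (b * Im U * B.gam U)" unfolding e1 e2 ..
  then have "x\<^sup>2 * (Im U * Im V) = (a * b * A.gam V * B.gam U) * (Im U * Im V)"
    by (simp add: power2_eq_square mult_ac)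
  then have x2: "x\<^sup>2 = a * b * (A.gam V * B.gam U)" using im by simp
  have gp: "0 < A.gam V" "0 < B.gam U" using A.gam_pos B.gam_pos im by auto
  have prod: "A.cov V V * B.cov U U = of_real (A.gam V * B.gam U)"
  proof -
    have "of_real (a * b) * (A.cov V V * B.cov U U) = of_real (a * b) * of_real (A.gam V * B.gam U)"
      using deg unfolding x2 by (simp add: mult.assoc)
    then show ?thesis using ab by (metis mult_cancel_left of_real_eq_0_iff less_irrefl)
  qed
  have cA: "cmod (A.cov V V) \<le> A.gam V"
    by (rule power2_le_imp_le) (use A.norm_cov_sq_le[OF im(2) im(2)] gp in \<open>simp_all add: power2_eq_square[of "A.gam V"]\<close>)
  have cB: "cmod (B.cov U U) \<le> B.gam U"
    by (rule power2_le_imp_le) (use B.norm_cov_sq_le[OF im(1) im(1)] gp in \<open>simp_all add: power2_eq_square[of "B.gam U"]\<close>)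
  have np: "cmod (A.cov V V) * cmod (B.cov U U) = A.gam V * B.gam U"
    using arg_cong[OF prod, of cmod] gp by (simp add: norm_mult)
  have nA: "cmod (A.cov V V) = A.gam V"
  proof (rule antisym[OF cA])
    have "A.gam V * B.gam U \<le> cmod (A.cov V V) * B.gam U"
      unfolding np[symmetric] using cB by (intro mult_left_mono) auto
    then show "A.gam V \<le> cmod (A.cov V V)" using gp by simp
  qed
  \<comment> \<open>A phase that makes \<open>k * kern V X\<close> real almost everywhere. As the
    product of the covariances is positive, \<open>cnj k\<close> does the same for
    \<open>kern U Y\<close>.\<close>
  define k where "k = csqrt (cnj (A.cov V V) / of_real (A.gam V))"
  have k2: "k\<^sup>2 = cnj (A.cov V V) / of_real (A.gam V)" by (simp add: k_def)
  have "(cmod k)\<^sup>2 = 1" unfolding norm_power[symmetric] k2 using nA gp by (simp add: norm_divide)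
  then have k1: "cmod k = 1" by (simp add: power2_eq_1_iff) (smt (verit) norm_ge_zero)
  have kA: "k\<^sup>2 * A.cov V V = of_real (A.gam V)"
    unfolding k2 using complex_norm_square[of "A.cov V V"] nA gp
    by (simp add: divide_eq_eq mult.commute power2_eq_square)
  have kk: "k * cnj k = 1" using complex_norm_square[of k] k1 by simp
  have kB: "(cnj k)\<^sup>2 * B.cov U U = of_real (B.gam U)"
  proof -
    have "(cnj k)\<^sup>2 * B.cov U U * of_real (A.gam V) = (cnj k)\<^sup>2 * B.cov U U * (k\<^sup>2 * A.cov V V)"
      unfolding kA ..
    also have "\<dots> = (k * cnj k)\<^sup>2 * (A.cov V V * B.cov U U)" by (simp add: power2_eq_square mult_ac)
    also have "\<dots> = of_real (B.gam U) * of_real (A.gam V)" unfolding kk prod by simp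
    finally show ?thesis using gp by simp
  qed
  have "Im (k * A.stj V) = (\<integral>t. Im (k * kern V (X t)) \<partial>M)"
    unfolding A.stj_def integral_mult_right_zero[symmetric] using A.integrable_kern[OF im(2)]
    by (intro integral_Im[symmetric]) simp
  also have "\<dots> = 0"
    using A.Im_kern_eq_0_AE[OF im(2) kA k1] A.integrable_kern[OF im(2)]
    by (subst integral_cong_AE[where g="\<lambda>_. 0"]) auto
  finally have kS: "Im (k * A.stj V) = 0" .
  have Im_scale: "Im (k * (of_real r * w)) = r * Im (k * w)" for r w
    by (simp add: algebra_simps)
  have "- (x * Im (k * U)) = Im (k * - (of_real x * U))"
    using Im_scale[of x U] by (simp only: mult_minus_right uminus_complex.sel)
  also have "\<dots> = a * Im (k * A.stj V)" unfolding eq(1) by (rule Im_scale)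
  finally have "x * Im (k * U) = 0" unfolding kS by simp
  then have kU: "Im (k * U) = 0" using x by simp
  have "AE t in N. Im (cnj k * kern U (Y t)) = 0"
    using B.Im_kern_eq_0_AE[OF im(1) kB] k1 by simp
  then have "AE t in N. Y t = 0"
  proof eventually_elim
    case (elim t)
    \<comment> \<open>The first equation at real \<open>x\<close> made \<open>k * U\<close> real;
      with \<open>cnj k * kern U Y\<close> real the product has imaginary part 0.\<close>
    have "U * kern U (Y t) = (k * cnj k) * (U * kern U (Y t))" unfolding kk by simp
    also have "\<dots> = (k * U) * (cnj k * kern U (Y t))" by (simp only: mult_ac)
    also have "Im \<dots> = Re (k * U) * Im (cnj k * kern U (Y t)) + Im (k * U) * Re (cnj k * kern U (Y t))"
      by (rule times_complex.sel)
    finally have "Im (U * kern U (Y t)) = 0" unfolding kU elim by simp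
    then show ?case
      unfolding B.Im_mult_kern[OF im(1)] using im(1) kern_denom_nonzero[OF im(1), of "Y t"] by simp
  qed
  then show False using B.X_nonzero by simp
qed

definition "snd_of z w = - (of_real b / z) * B.stj w"

lemma sol_snd_eq: "0 < Im z \<Longrightarrow> sol_snd z = snd_of z (sol_fst z)"
  unfolding snd_of_def using sol_eqs(2)[OF sol_sol_fst_snd, of z]
  by (metis complex.sel(2) less_irrefl minus_divide_left minus_mult_left nonzero_mult_div_cancel_left times_divide_eq_left zero_complex.sel(2) minus_minus)

text \<open>Eliminating \<open>v\<close> by \<open>snd_of\<close> leaves one scalar equation
  \<open>H z w = 0\<close> for \<open>w = u\<close>. Near \<open>x\<close> the solution is close to
  \<open>U\<close>, hence equals the holomorphic branch through \<open>U\<close>.\<close>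

theorem stieltjes_holomorphic_extension:
  assumes x: "x \<noteq> 0" and lim: "sol_limit (of_real x) U V" and im: "0 < Im U"
    and U: "(sol_fst \<longlongrightarrow> U) (at (of_real x) within {z. 0 < Im z})"
  shows "\<exists>e>0. \<exists>h. h holomorphic_on ball (of_real x) e \<and>
    (\<forall>z\<in>ball (of_real x) e. 0 < Im z \<longrightarrow> - 1 / z - sol_fst z * sol_snd z / of_real a = h z)"
proof -
  interpret sw: rv_pair N Y M X b a by (rule rv_pair_swap)
  let ?x = "complex_of_real x" and ?H = "{w. 0 < Im w}"
  have x': "?x \<noteq> 0" using x by simp
  have V: "0 < Im V" using sol_limit_real_Im_pos[OF lim x im] .
  have eq1: "- (?x * U) = of_real a * A.stj V" using sol_limit_eq_fst[OF lim x' V] .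
  have eq2: "- (?x * V) = of_real b * B.stj U"
    using sw.sol_limit_eq_fst[OF _ x' im] lim sol_limit_swap by blast
  have V_eq: "snd_of ?x U = V"
    unfolding snd_of_def using eq2 x' by (simp add: field_simps) (metis minus_minus)
  have hA: "A.stj holomorphic_on ?H" and hB: "B.stj holomorphic_on ?H"
    by (rule A.stj_holomorphic_on B.stj_holomorphic_on)+
  note cA = holomorphic_on_imp_continuous_on[OF hA] and cB = holomorphic_on_imp_continuous_on[OF hB]
  have c_snd: "continuous_on ((- {0}) \<times> ?H) (\<lambda>p. snd_of (fst p) (snd p))"
    unfolding snd_of_def
    by (intro continuous_intros continuous_on_compose2[OF cB]) auto
  \<comment> \<open>Open domain on which the eliminated unknown stays in the upper half plane, so
    that \<open>A.stj\<close> may be applied also for \<open>z\<close> on or below the real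
    axis.\<close>
  define S where "S = ((- {0}) \<times> ?H) \<inter> (\<lambda>p. snd_of (fst p) (snd p)) -` ?H"
  have "open S"
    unfolding S_def
    by (intro continuous_open_preimage c_snd open_Times open_halfspace_Im_gt open_Compl closed_singleton)
  moreover have "(?x, U) \<in> S" using x' im V V_eq by (simp add: S_def)
  ultimately obtain e where e: "0 < e" "ball (?x, U) e \<subseteq> S" using open_contains_ball by blast
  define r where "r = e / 2"
  have r: "0 < r" using e by (simp add: r_def)
  have in_S: "z \<noteq> 0 \<and> 0 < Im w \<and> 0 < Im (snd_of z w)" if "z \<in> ball ?x r" "w \<in> ball U r" for z w
  proof -
    have "dist (z, w) (?x, U) \<le> norm (z - ?x) + norm (w - U)"
      unfolding dist_norm using norm_Pair_le[of "z - ?x" "w - U"] by simp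
    also have "\<dots> < e" using that by (simp add: r_def dist_norm norm_minus_commute)
    finally have "(z, w) \<in> S" using e(2) by (auto simp: dist_commute)
    then show ?thesis by (simp add: S_def)
  qed
  define H where "H z w = z * w + of_real a * A.stj (snd_of z w)" for z w
  \<comment> \<open>Difference quotient of \<open>H\<close>, by \<open>stj_diff\<close> used twice;
    \<open>K x U U = (x^2 - a b cov cov) / x\<close>.\<close>
  define K where "K z w w' = z - of_real (a * b) / z * (A.cov (snd_of z w) (snd_of z w') * B.cov w w')" for z w w'
  obtain e1 s W where e1: "0 < e1" "e1 \<le> r" "0 < s" and W_hol: "W holomorphic_on ball ?x e1"
    and W_r: "\<And>z. z \<in> ball ?x e1 \<Longrightarrow> W z \<in> ball U r"
    and W_unique: "\<And>z w. z \<in> ball ?x e1 \<Longrightarrow> w \<in> ball U s \<Longrightarrow> H z w = 0 \<Longrightarrow> w = W z"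
  proof (rule holomorphic_implicit_function[OF r, of ?x U H K])
    show "H z w - H z w' = (w - w') * K z w w'" if "z \<in> ball ?x r" "w \<in> ball U r" "w' \<in> ball U r" for z w w'
    proof -
      note n = in_S[OF that(1,2)] in_S[OF that(1,3)]
      have "H z w - H z w' = z * (w - w') + of_real a * (A.stj (snd_of z w) - A.stj (snd_of z w'))"
        by (simp add: H_def algebra_simps)
      also have "A.stj (snd_of z w) - A.stj (snd_of z w') = (snd_of z w' - snd_of z w) * A.cov (snd_of z w) (snd_of z w')"
        using n by (intro A.stj_diff) auto
      also have "snd_of z w' - snd_of z w = of_real b / z * (B.stj w - B.stj w')"
        by (simp add: snd_of_def algebra_simps)
      also have "B.stj w - B.stj w' = (w' - w) * B.cov w w'"
        using n by (intro B.stj_diff) auto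
      finally show ?thesis
        by (simp add: K_def algebra_simps diff_divide_distrib)
    qed
    show "continuous_on (ball ?x r \<times> ball U r \<times> ball U r) (\<lambda>(z, w, w'). K z w w')"
    proof -
      let ?D = "ball ?x r \<times> ball U r \<times> ball U r"
      have c1: "continuous_on ?D (\<lambda>p. snd_of (fst p) (fst (snd p)))"
        using continuous_on_compose2[OF c_snd, of ?D "\<lambda>p. (fst p, fst (snd p))"] in_S
        by (force intro!: continuous_intros)
      have c2: "continuous_on ?D (\<lambda>p. snd_of (fst p) (snd (snd p)))"
        using continuous_on_compose2[OF c_snd, of ?D "\<lambda>p. (fst p, snd (snd p))"] in_S
        by (force intro!: continuous_intros)
      have c3: "continuous_on ?D (\<lambda>p. A.cov (snd_of (fst p) (fst (snd p))) (snd_of (fst p) (snd (snd p))))"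
        using continuous_on_compose2[OF A.continuous_on_cov continuous_on_Pair[OF c1 c2]] in_S by force
      have c4: "continuous_on ?D (\<lambda>p. B.cov (fst (snd p)) (snd (snd p)))"
      proof -
        have "continuous_on ?D (\<lambda>p. (\<lambda>(w, w'). B.cov w w') (fst (snd p), snd (snd p)))"
          by (rule continuous_on_compose2[OF B.continuous_on_cov])
             (use in_S[of ?x] r in \<open>auto intro!: continuous_intros\<close>)
        then show ?thesis by (simp only: prod.case)
      qed
      show ?thesis
        unfolding K_def case_prod_beta using in_S
        by (intro continuous_intros c3 c4) (use in_S r in force)+
    qed
    show "K ?x U U \<noteq> 0"
    proof
      assume "K ?x U U = 0"
      then have "of_real (a * b) * A.cov V V * B.cov U U = of_real (x\<^sup>2)"
        using x' by (simp add: K_def V_eq field_simps power2_eq_square)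
      then show False using derivative_nonzero[OF x im V eq1 eq2] by simp
    qed
    show "H ?x U = 0" unfolding H_def V_eq eq1[symmetric] by simp
    show "(\<lambda>z. H z w) holomorphic_on ball ?x r" if "w \<in> ball U r" for w
    proof -
      have "(\<lambda>z. snd_of z w) holomorphic_on ball ?x r"
        unfolding snd_of_def using in_S that by (intro holomorphic_intros) blast
      then have "(A.stj \<circ> (\<lambda>z. snd_of z w)) holomorphic_on ball ?x r"
        using in_S that by (intro holomorphic_on_compose_gen[OF _ hA]) auto
      then show ?thesis
        unfolding H_def o_def by (intro holomorphic_intros)
    qed
  qed blast
  have "\<forall>\<^sub>F z in at ?x within ?H. dist (sol_fst z) U < s"
    using U e1(3) by (rule tendstoD)
  then obtain e2 where e2: "0 < e2" "\<And>z. 0 < Im z \<Longrightarrow> z \<noteq> ?x \<Longrightarrow> dist z ?x < e2 \<Longrightarrow> dist (sol_fst z) U < s"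
    unfolding eventually_at by auto
  define e3 where "e3 = min e1 e2"
  define h where "h z = - 1 / z - W z * snd_of z (W z) / of_real a" for z
  have sub: "ball ?x e3 \<subseteq> ball ?x e1" "ball ?x e1 \<subseteq> ball ?x r" using e1 by (auto simp: e3_def)
  have "h holomorphic_on ball ?x e3"
  proof -
    have W3: "W holomorphic_on ball ?x e3" using W_hol sub(1) by (rule holomorphic_on_subset)
    have nz: "z \<noteq> 0" "W z \<in> ?H" if "z \<in> ball ?x e3" for z
      using in_S[OF _ W_r, of z z] that sub by blast+
    have "(B.stj \<circ> W) holomorphic_on ball ?x e3"
      using nz(2) by (intro holomorphic_on_compose_gen[OF W3 hB]) auto
    then show ?thesis
      unfolding h_def snd_of_def o_def using nz(1) a_pos by (intro holomorphic_intros W3) auto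
  qed
  moreover have "- 1 / z - sol_fst z * sol_snd z / of_real a = h z" if "z \<in> ball ?x e3" "0 < Im z" for z
  proof -
    have "z \<noteq> ?x" using that by auto
    then have "sol_fst z \<in> ball U s" using e2(2)[of z] that by (simp add: e3_def dist_commute)
    moreover have "H z (sol_fst z) = 0"
      unfolding H_def sol_snd_eq[OF that(2), symmetric] sol_eqs(1)[OF sol_sol_fst_snd[OF that(2)], symmetric] by simp
    ultimately have "sol_fst z = W z" using W_unique that sub by blast
    then show ?thesis unfolding h_def sol_snd_eq[OF that(2)] by simp
  qed
  moreover have "0 < e3" using e1 e2 by (simp add: e3_def)
  ultimately show ?thesis by blast
qed

end

section \<open>From the continued transform to the density\<close>

lemma upper_half_nontrivial: "at (complex_of_real y) within {z. 0 < Im z} \<noteq> bot"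
proof -
  have "complex_of_real y islimpt {z. 0 < Im z}"
    unfolding islimpt_approachable
  proof (intro allI impI)
    fix e :: real assume "0 < e"
    then show "\<exists>z\<in>{z. 0 < Im z}. z \<noteq> of_real y \<and> dist z (of_real y) < e"
      by (intro bexI[of _ "of_real y + \<i> * of_real (e / 2)"]) (auto simp: dist_norm norm_mult)
  qed
  then show ?thesis by (simp add: trivial_limit_within)
qed

text \<open>At a real centre the powers \<open>(t - y)^n\<close> are real, so imaginary parts can be
  taken coefficientwise in the Taylor series.\<close>

lemma real_analytic_on_Im_holomorphic:
  assumes "h holomorphic_on ball (of_real x) e" and f: "\<And>y. y \<in> ball x e \<Longrightarrow> f y = Im (h (of_real y)) / p"
  shows "real_analytic_on f (ball x e)"
  unfolding real_analytic_on_def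
proof
  fix y assume y: "y \<in> ball x e"
  define r where "r = e - dist x y"
  have "0 < r" using y by (simp add: r_def)
  have "ball (complex_of_real y) r \<subseteq> ball (of_real x) e"
  proof
    fix w assume "w \<in> ball (complex_of_real y) r"
    then have "dist (of_real x) w < e"
      using dist_triangle[of "complex_of_real x" w "of_real y"] by (simp add: r_def dist_of_real)
    then show "w \<in> ball (of_real x) e" by simp
  qed
  then have hol: "h holomorphic_on ball (of_real y) r" using assms holomorphic_on_subset by blast
  define c where "c n = Im ((deriv ^^ n) h (of_real y) / fact n) / p" for n
  have "(\<lambda>n. c n * (t - y) ^ n) sums f t" if "\<bar>t - y\<bar> < r" for t
  proof -
    have "complex_of_real t \<in> ball (of_real y) r"
      using that by (simp add: dist_of_real dist_real_def abs_minus_commute)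
    then have "(\<lambda>n. (deriv ^^ n) h (of_real y) / fact n * (of_real t - of_real y) ^ n) sums h (of_real t)"
      by (rule holomorphic_power_series[OF hol])
    then have "(\<lambda>n. Im ((deriv ^^ n) h (of_real y) / fact n * (of_real t - of_real y) ^ n) / p) sums (Im (h (of_real t)) / p)"
      by (intro sums_divide sums_Im)
    moreover have "Im ((deriv ^^ n) h (of_real y) / fact n * (of_real t - of_real y) ^ n) / p = c n * (t - y) ^ n" for n
    proof -
      have "(complex_of_real t - of_real y) ^ n = of_real ((t - y) ^ n)" by simp
      moreover have "Im (q * of_real u) / p = Im q / p * u" for q u by simp
      ultimately show ?thesis unfolding c_def by (simp only:)
    qed
    moreover have "t \<in> ball x e"
      using that dist_triangle[of x t y] by (simp add: r_def dist_real_def)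
    ultimately show ?thesis by (simp add: f)
  qed
  then show "\<exists>r>0. \<exists>c. \<forall>t. \<bar>t - y\<bar> < r \<longrightarrow> (\<lambda>n. c n * (t - y) ^ n) sums f t"
    using \<open>0 < r\<close> by blast
qed

text \<open>If the variable vanished almost everywhere, every measurable set would have the mass
  given by the Dirac measure.\<close>

lemma pos_rv_max:
  assumes "prob_space \<nu>" "sets \<nu> = sets borel" "AE t in \<nu>. t \<ge> 0" "\<nu> \<noteq> return borel 0"
  shows "pos_rv \<nu> (\<lambda>t::real. max t 0)"
proof -
  interpret prob_space \<nu> by fact
  have [measurable_cong]: "sets \<nu> = sets borel" by fact
  have "\<not> (AE t in \<nu>. max t 0 = 0)"
  proof
    assume "AE t in \<nu>. max t 0 = 0"
    then have AE0: "AE t in \<nu>. t = 0" using assms(3) by eventually_elim auto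
    have "\<nu> = return borel 0"
    proof (rule measure_eqI)
      fix S assume S: "S \<in> sets \<nu>"
      show "emeasure \<nu> S = emeasure (return borel 0) S"
      proof (cases "0 \<in> S")
        case True
        have "AE t in \<nu>. t \<in> S" using AE0 by eventually_elim (use True in simp)
        then have "emeasure \<nu> S = 1" using S emeasure_eq_1_AE by blast
        then show ?thesis using True S assms(2) by simp
      next
        case False
        have "AE t in \<nu>. t \<notin> S" using AE0 by eventually_elim (use False in simp)
        then have "emeasure \<nu> S = 0" using S AE_iff_measurable[of S \<nu> "\<lambda>t. t \<notin> S"] sets.sets_into_space[OF S] by auto
        then show ?thesis using False S assms(2) by simp
      qed
    qed (simp add: assms(2))
    then show False using assms(4) by simp
  qed
  then show ?thesis by unfold_locales auto
qed

lemma integral_eq_stj: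
  assumes "pos_rv \<nu> (\<lambda>t::real. max t 0)" "sets \<nu> = sets borel" "AE t in \<nu>. t \<ge> 0"
  shows "(\<integral>t. complex_of_real t / (- z * (1 + w * of_real t)) \<partial>\<nu>) = - (pos_rv.stj \<nu> (\<lambda>t. max t 0) w / z)"
proof -
  interpret pos_rv \<nu> "\<lambda>t. max t 0" by fact
  have [measurable_cong]: "sets \<nu> = sets borel" by fact
  have "(\<integral>t. complex_of_real t / (- z * (1 + w * of_real t)) \<partial>\<nu>) = (\<integral>t. - 1 / z * kern w (max t 0) \<partial>\<nu>)"
    by (rule integral_cong_AE) (use assms(3) in \<open>auto elim!: eventually_mono simp: kern_def max_def\<close>)
  then show ?thesis unfolding stj_def by simp
qed

theorem theorem3p12:
  fixes c :: real and \<nu> \<nu>' :: "real measure" and x :: real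
  assumes "c > 0"
    and "prob_space \<nu>" and "sets \<nu> = sets borel" and "AE t in \<nu>. t \<ge> 0"
    and "\<nu> \<noteq> return borel 0"
    and "prob_space \<nu>'" and "sets \<nu>' = sets borel" and "AE t in \<nu>'. t \<ge> 0"
    and "\<nu>' \<noteq> return borel 0"
    and "x \<noteq> 0"
    and "dens_f c \<nu> \<nu>' x > 0"
  shows "\<exists>e>0. real_analytic_on (dens_f c \<nu> \<nu>') (ball x e)"
proof -
  let ?X = "\<lambda>t::real. max t 0"
  have pA: "pos_rv \<nu> ?X" and pB: "pos_rv \<nu>' ?X" by (intro pos_rv_max assms)+
  interpret A: pos_rv \<nu> ?X by (rule pA)
  interpret B: pos_rv \<nu>' ?X by (rule pB)
  interpret rv_pair \<nu> ?X \<nu>' ?X c 1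
    by unfold_locales (use assms(1) in auto)
  have [measurable_cong]: "sets \<nu> = sets borel" by fact
  have H: "upper_half = {z. 0 < Im z}" by (simp add: upper_half_def)
  have delta: "delta_pair c \<nu> \<nu>' z = (sol_fst z, sol_snd z)" if z: "0 < Im z" for z
  proof -
    have z0: "z \<noteq> 0" using z by auto
    have e: "p = of_real r * - (q / z) \<longleftrightarrow> - (z * p) = of_real r * q" for p q r
    proof -
      have "p = of_real r * - (q / z) \<longleftrightarrow> z * p = z * (of_real r * - (q / z))"
        using z0 by (simp only: mult_cancel_left simp_thms)
      also have "z * (of_real r * - (q / z)) = - (of_real r * q)" using z0 by simp
      also have "z * p = - (of_real r * q) \<longleftrightarrow> - (z * p) = of_real r * q"
        by (metis minus_minus)
      finally show ?thesis .
    qed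
    have "fst p \<in> upper_half \<and> snd p \<in> upper_half \<and>
      fst p = complex_of_real c * (\<integral>t. complex_of_real t / (- z * (1 + snd p * complex_of_real t)) \<partial>\<nu>) \<and>
      snd p = (\<integral>t. complex_of_real t / (- z * (1 + fst p * complex_of_real t)) \<partial>\<nu>')
      \<longleftrightarrow> sol z (fst p) (snd p)" for p
      unfolding sol_def integral_eq_stj[OF pA assms(3,4)] integral_eq_stj[OF pB assms(7,8)] H
      using e[of "snd p" 1 "B.stj (fst p)"]
      by (simp only: e mem_Collect_eq z simp_thms of_real_1 mult_1)
    then have "delta_pair c \<nu> \<nu>' z = (THE p. sol z (fst p) (snd p))"
      unfolding delta_pair_def by simp
    \<comment> \<open>Existence and uniqueness together make the definite description
      meaningful.\<close>
    also have "\<dots> = (sol_fst z, sol_snd z)"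
    proof (rule the_equality)
      show "sol z (fst (sol_fst z, sol_snd z)) (snd (sol_fst z, sol_snd z))"
        using sol_sol_fst_snd[OF z] by simp
      show "p = (sol_fst z, sol_snd z)" if "sol z (fst p) (snd p)" for p
        using sol_eq_sol_fst_snd[OF that] by (simp add: prod_eq_iff)
    qed
    finally show ?thesis .
  qed
  have m: "m_fun c \<nu> \<nu>' z = - 1 / z - sol_fst z * sol_snd z / of_real c" if z: "0 < Im z" for z
  proof -
    let ?v = "sol_snd z"
    note s = sol_sol_fst_snd[OF z]
    have z0: "z \<noteq> 0" using z by auto
    have v: "0 < Im ?v" using sol_pos[OF s] by simp
    have "m_fun c \<nu> \<nu>' z = (\<integral>t. - 1 / z * (1 / (1 + ?v * of_real (max t 0))) \<partial>\<nu>)"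
      unfolding m_fun_def delta[OF z] snd_conv
    proof (rule integral_cong_AE)
      show "AE t in \<nu>. 1 / (- z * (1 + ?v * of_real t)) = - 1 / z * (1 / (1 + ?v * of_real (max t 0)))"
        using assms(4) by eventually_elim (simp add: max_absorb1)
    qed measurable
    also have "\<dots> = (\<integral>t. - 1 / z * (1 - ?v * kern ?v (max t 0)) \<partial>\<nu>)"
      unfolding one_plus_mult_kern[OF v] ..
    also have "\<dots> = - 1 / z * (1 - ?v * A.stj ?v)"
      unfolding A.stj_def using A.integrable_kern[OF v] by (simp add: A.prob_space)
    also have "A.stj ?v = - (z * sol_fst z) / of_real c"
      using sol_eqs(1)[OF s] assms(1) by (simp add: field_simps)
    finally show ?thesis using z0 by (simp add: field_simps)
  qed
  \<comment> \<open>\<open>Lim\<close> returns a given limit only at a nontrivial filter; every real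
    point is a limit point of the half plane.\<close>
  have m_lim: "dens_f c \<nu> \<nu>' y = Im l / pi"
    if "(m_fun c \<nu> \<nu>' \<longlongrightarrow> l) (at (of_real y) within upper_half)" for y l
    unfolding dens_f_def H using tendsto_Lim[OF upper_half_nontrivial that[unfolded H]] by simp
  have x: "complex_of_real x \<noteq> 0" using assms(10) by simp
  obtain U V where UV: "sol_limit (of_real x) U V"
    and lim: "(sol_fst \<longlongrightarrow> U) (at (of_real x) within {z. 0 < Im z})" "(sol_snd \<longlongrightarrow> V) (at (of_real x) within {z. 0 < Im z})"
    using sol_limit_exists[OF x] by auto
  have "(m_fun c \<nu> \<nu>' \<longlongrightarrow> - 1 / of_real x - U * V / of_real c) (at (of_real x) within upper_half)"
  proof (rule Lim_transform_eventually)
    show "((\<lambda>z. - 1 / z - sol_fst z * sol_snd z / of_real c) \<longlongrightarrow> - 1 / of_real x - U * V / of_real c) (at (of_real x) within upper_half)"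
      unfolding H using x assms(1) by (intro tendsto_intros lim) auto
    show "\<forall>\<^sub>F z in at (of_real x) within upper_half. - 1 / z - sol_fst z * sol_snd z / of_real c = m_fun c \<nu> \<nu>' z"
      unfolding H eventually_at using m by (auto intro!: exI[of _ 1])
  qed
  \<comment> \<open>\<open>- 1 / x\<close> is real, so positivity of the density forces
    \<open>Im (U * V)\<close> to be nonzero and excludes that both limits are real.\<close>
  from m_lim[OF this] have "Im (U * V) \<noteq> 0"
    using assms(11) by (auto simp: Im_divide)
  moreover have "0 \<le> Im U" "0 \<le> Im V" using sol_limit_Im_nonneg[OF UV] by auto
  moreover have "0 < Im U" if "0 < Im V"
    using rv_pair.sol_limit_real_Im_pos[OF rv_pair_swap _ assms(10) that] UV sol_limit_swap by blast
  ultimately have "0 < Im U" by (cases "Im U = 0"; cases "Im V = 0") auto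
  then obtain e h where e: "0 < e" and h: "h holomorphic_on ball (of_real x) e"
    and eq: "\<And>z. z \<in> ball (of_real x) e \<Longrightarrow> 0 < Im z \<Longrightarrow> - 1 / z - sol_fst z * sol_snd z / of_real c = h z"
    using stieltjes_holomorphic_extension[OF assms(10) UV _ lim(1)] by blast
  \<comment> \<open>\<open>h\<close> extends \<open>m\<close> continuously to each real point of the
    ball, so one function represents the density there.\<close>
  have dens: "dens_f c \<nu> \<nu>' y = Im (h (of_real y)) / pi" if "y \<in> ball x e" for y
  proof (rule m_lim)
    have y: "complex_of_real y \<in> ball (of_real x) e" using that by (simp add: dist_of_real)
    have "(h \<longlongrightarrow> h (of_real y)) (at (of_real y))"
      using holomorphic_on_imp_continuous_on[OF h] y continuous_on_eq_continuous_at[OF open_ball] isCont_def by blast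
    then have "(h \<longlongrightarrow> h (of_real y)) (at (of_real y) within upper_half)"
      by (rule tendsto_within_subset) simp
    moreover have "\<forall>\<^sub>F z in at (of_real y) within upper_half. h z = m_fun c \<nu> \<nu>' z"
    proof -
      have "\<forall>\<^sub>F z in at (of_real y) within upper_half. z \<in> ball (of_real x) e"
        using y eventually_at_in_open'[OF open_ball] eventually_at_filter eventually_mono
        by (metis (mono_tags, lifting) eventually_at_topological open_ball)
      moreover have "\<forall>\<^sub>F z in at (of_real y) within upper_half. z \<in> upper_half"
        by (auto simp: eventually_at_topological)
      ultimately show ?thesis
        by eventually_elim (use eq m in \<open>auto simp: H\<close>)
    qed
    ultimately show "(m_fun c \<nu> \<nu>' \<longlongrightarrow> h (of_real y)) (at (of_real y) within upper_half)"
      by (rule Lim_transform_eventually)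
  qed
  then have "real_analytic_on (dens_f c \<nu> \<nu>') (ball x e)"
    by (rule real_analytic_on_Im_holomorphic[OF h])
  then show ?thesis using e by blast
qed

end
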